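(* Let $\mathcal C$ be a locally bounded $\mathcal V$-category over a locally bounded closed category $\mathcal V$. If $j:\mathcal J\hookrightarrow\mathcal C$ is a small subcategory of arities, then $\mathcal J$ is bounded.
   Context: **Base.** $\mathcal V=(\mathcal V_0,\otimes,I)$ is a symmetric monoidal closed category with $\mathcal V_0$ locally small and having all small limits and colimits. $\mathcal V$-categories may be large; $\mathcal C_0$ is the underlying ordinary category of $\mathcal C$. A $\mathcal V$-category is cocomplete if it has all small weighted colimits. **Factegories.** An enriched factorization system on a $\mathcal V$-category $\mathcal C$ is a pair $(\mathcal E,\mathcal M)$ of classes of morphisms of $\mathcal C_0$ such that every morphism factors as an $\mathcal E$-morphism followed by an $\mathcal M$-morphism, and $\mathcal E$ (resp. $\mathcal M$) consists of exactly the morphisms $\mathcal V$-orthogonal to all morphisms in $\mathcal M$ (resp. $\mathcal E$); here $e:A\to B$ is $\mathcal V$-orthogonal to $m:X\to Y$ if the square formed by $\mathcal C(B,X)\to\mathcal C(A,X)$, $\mathcal C(B,X)\to\mathcal C(B,Y)$, $\mathcal C(A,X)\to\mathcal C(A,Y)$, $\mathcal C(B,Y)\to\mathcal C(A,Y)$ is a pullback in $\mathcal V_0$. $\mathcal V$ is a closed factegory if it is equipped with an enriched factorization system $(\mathcal E,\mathcal M)$. A $\mathcal V$-factegory is then a $\mathcal V$-category $\mathcal C$ with an enriched factorization system $(\mathcal E_{\mathcal C},\mathcal M_{\mathcal C})$ such that $m\in\mathcal M_{\mathcal C}$ implies $\mathcal C(C,m)\in\mathcal M$ for all $C\in\mathcal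 C$. It is proper if $\mathcal E_{\mathcal C}$ consists of $\mathcal V$-epimorphisms (each $\mathcal C(e,C)$ is a monomorphism in $\mathcal V_0$) and $\mathcal M_{\mathcal C}$ of $\mathcal V$-monomorphisms (each $\mathcal C(C,m)$ is a monomorphism in $\mathcal V_0$). It is cocomplete if $\mathcal C$ is a cocomplete $\mathcal V$-category with arbitrary conical cointersections (wide pushouts of arbitrary families with common domain) of $\mathcal E_{\mathcal C}$-morphisms. The same terms apply to the closed factegory $\mathcal V$ itself. **Boundedness.** For a regular cardinal $\alpha$ and $\mathcal V$-factegories $\mathcal C,\mathcal D$ with small conical colimits, a $\mathcal V$-functor $F:\mathcal C\to\mathcal D$ is $\alpha$-bounded if for every small $\alpha$-filtered diagram $D:\mathcal A\to\mathcal C_0$ and every cocone $(m_A:DA\to C)_{A}$ with all $m_A\in\mathcal M_{\mathcal C}$, if the induced $\mathrm{colim}\,D\to C$ lies in $\mathcal E_{\mathcal C}$ then the induced $\mathrm{colim}\,FD\to FC$ lies in $\mathcal E_{\mathcal D}$. An object $C$ of $\mathcal C$ is $\alpha$-bounded if $\mathcal C(C,-):\mathcal C\to\mathcal V$ is $\alpha$-bounded. **Local boundedness.** Let $\mathcal V$ be a cocomplete proper closed factegory, e.g. $\mathcal V=\mathrm{Set}$ with (surjections, injections). If $\mathcal C$ is a cocomplete proper $\mathcal V$-factegory, a small set $\mathcal G\subseteq\mathrm{ob}\,\mathcal C$ is an enriched $(\mathcal E,\mathcal M)$-generator if for each $C\in\mathcal C$ the canonical morphism $\coprod_{G\in\mathcal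 G}\mathcal C(G,C)\otimes G\to C$ lies in $\mathcal E_{\mathcal C}$ (with $\otimes$ the $\mathcal V$-enriched tensor). $\mathcal C$ is locally $\alpha$-bounded if it is a cocomplete proper $\mathcal V$-factegory with an enriched $(\mathcal E,\mathcal M)$-generator consisting of $\alpha$-bounded objects; it is locally bounded if this holds for some regular cardinal $\alpha$. A symmetric monoidal closed category $\mathcal V$ is locally $\alpha$-bounded as a closed category if $\mathcal V_0$ is a locally $\alpha$-bounded $\mathrm{Set}$-category (with generator $\mathcal G$), its proper factorization system $(\mathcal E,\mathcal M)$ is $\mathcal V$-enriched, the unit $I$ is $\alpha$-bounded, and $G\otimes G'$ is $\alpha$-bounded for all $G,G'\in\mathcal G$; it is a locally bounded closed category if this holds for some regular cardinal $\alpha$. Such $\mathcal V$ is regarded as a closed factegory via this $(\mathcal E,\mathcal M)$. **Arities.** A subcategory of arities in $\mathcal C$ is a $\mathcal V$-category $\mathcal J$ with a fully faithful dense $\mathcal V$-functor $j:\mathcal J\hookrightarrow\mathcal C$; it is small if $\mathcal J$ is small. It is bounded if $\mathcal J$ is small and for some regular cardinal $\alpha$ every $J\in\mathcal J$ is an $\alpha$-bounded object of $\mathcal C$. *)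

theory Defs
  imports Main
begin

unbundle cardinal_syntax

section \<open>Size\<close>

text \<open>
  Smallness is relative to a set \<open>U\<close> of strongly inaccessible cardinality, which plays the role of
  the universe of small sets: a set of any type is small if its cardinality is less than that of
  \<open>U\<close>. Every small structure has an isomorphic copy whose elements have type \<^typ>\<open>'u\<close>, so small index
  categories are taken over \<^typ>\<open>'u\<close>. Sets that are not small serve as large collections.
\<close>

definition universe :: "'u set \<Rightarrow> bool" where
  "universe U \<longleftrightarrow> natLeq <o |U| \<and> regularCard |U| \<and>
     (\<forall>S. S \<subseteq> U \<and> |S| <o |U| \<longrightarrow> |Pow S| <o |U| )"

definition small :: "'u set \<Rightarrow> 'b set \<Rightarrow> bool" where
  "small U S \<longleftrightarrow> |S| <o |U|"

definition regular_cardinal :: "'u set \<Rightarrow> 'u rel \<Rightarrow> bool" where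
  "regular_cardinal U \<alpha> \<longleftrightarrow> Card_order \<alpha> \<and> cinfinite \<alpha> \<and> regularCard \<alpha> \<and> \<alpha> <o |U|"

section \<open>Ordinary categories\<close>

record ('o, 'a) cat =
  Obj :: "'o set"
  Arr :: "'a set"
  Dom :: "'a \<Rightarrow> 'o"
  Cod :: "'a \<Rightarrow> 'o"
  Id :: "'o \<Rightarrow> 'a"
  Comp :: "'a \<Rightarrow> 'a \<Rightarrow> 'a"  (infixr "\<cdot>\<index>" 70)

definition hom :: "('o, 'a, 'm) cat_scheme \<Rightarrow> 'o \<Rightarrow> 'o \<Rightarrow> 'a set" where
  "hom C A B = {f \<in> Arr C. Dom C f = A \<and> Cod C f = B}"

locale category =
  fixes C :: "('o, 'a, 'm) cat_scheme" (structure)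
  assumes Dom_in_Obj: "f \<in> Arr C \<Longrightarrow> Dom C f \<in> Obj C"
    and Cod_in_Obj: "f \<in> Arr C \<Longrightarrow> Cod C f \<in> Obj C"
    and Id_in_hom: "A \<in> Obj C \<Longrightarrow> Id C A \<in> hom C A A"
    and Comp_in_hom: "\<lbrakk>f \<in> hom C A B; g \<in> hom C B D\<rbrakk> \<Longrightarrow> g \<cdot> f \<in> hom C A D"
    and Comp_Id: "f \<in> hom C A B \<Longrightarrow> f \<cdot> Id C A = f"
    and Id_Comp: "f \<in> hom C A B \<Longrightarrow> Id C B \<cdot> f = f"
    and Comp_assoc:
      "\<lbrakk>f \<in> hom C A B; g \<in> hom C B D; h \<in> hom C D E\<rbrakk> \<Longrightarrow> (h \<cdot> g) \<cdot> f = h \<cdot> (g \<cdot> f)"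

definition locally_small :: "'u set \<Rightarrow> ('o, 'a, 'm) cat_scheme \<Rightarrow> bool" where
  "locally_small U C \<longleftrightarrow> (\<forall>A \<in> Obj C. \<forall>B \<in> Obj C. small U (hom C A B))"

definition small_category :: "'u set \<Rightarrow> ('o, 'a, 'm) cat_scheme \<Rightarrow> bool" where
  "small_category U C \<longleftrightarrow> category C \<and> small U (Obj C) \<and> small U (Arr C)"

definition op_cat :: "('o, 'a, 'm) cat_scheme \<Rightarrow> ('o, 'a) cat" where
  "op_cat C = \<lparr>Obj = Obj C, Arr = Arr C, Dom = Cod C, Cod = Dom C, Id = Id C,
     Comp = (\<lambda>g f. f \<cdot>\<^bsub>C\<^esub> g)\<rparr>"

definition discrete :: "'i set \<Rightarrow> ('i, 'i) cat" where
  "discrete S = \<lparr>Obj = S, Arr = S, Dom = id, Cod = id, Id = id, Comp = (\<lambda>g f. f)\<rparr>"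

definition monic :: "('o, 'a, 'm) cat_scheme \<Rightarrow> 'a \<Rightarrow> bool" where
  "monic C m \<longleftrightarrow> m \<in> Arr C \<and>
     (\<forall>W. \<forall>f \<in> hom C W (Dom C m). \<forall>g \<in> hom C W (Dom C m). m \<cdot>\<^bsub>C\<^esub> f = m \<cdot>\<^bsub>C\<^esub> g \<longrightarrow> f = g)"

definition epic :: "('o, 'a, 'm) cat_scheme \<Rightarrow> 'a \<Rightarrow> bool" where
  "epic C e \<longleftrightarrow> e \<in> Arr C \<and>
     (\<forall>W. \<forall>f \<in> hom C (Cod C e) W. \<forall>g \<in> hom C (Cod C e) W. f \<cdot>\<^bsub>C\<^esub> e = g \<cdot>\<^bsub>C\<^esub> e \<longrightarrow> f = g)"

definition inverse_arrows :: "('o, 'a, 'm) cat_scheme \<Rightarrow> 'a \<Rightarrow> 'a \<Rightarrow> bool" where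
  "inverse_arrows C f g \<longleftrightarrow> f \<in> Arr C \<and> g \<in> hom C (Cod C f) (Dom C f) \<and>
     g \<cdot>\<^bsub>C\<^esub> f = Id C (Dom C f) \<and> f \<cdot>\<^bsub>C\<^esub> g = Id C (Cod C f)"

definition iso :: "('o, 'a, 'm) cat_scheme \<Rightarrow> 'a \<Rightarrow> bool" where
  "iso C f \<longleftrightarrow> (\<exists>g. inverse_arrows C f g)"

definition inv_arr :: "('o, 'a, 'm) cat_scheme \<Rightarrow> 'a \<Rightarrow> 'a" where
  "inv_arr C f = (THE g. inverse_arrows C f g)"

text \<open>In the square \<open>f \<cdot> p = g \<cdot> q\<close>, the arrows \<open>p\<close> and \<open>q\<close> are the pullback projections.\<close>

definition is_pullback :: "('o, 'a, 'm) cat_scheme \<Rightarrow> 'a \<Rightarrow> 'a \<Rightarrow> 'a \<Rightarrow> 'a \<Rightarrow> bool" where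
  "is_pullback C p q f g \<longleftrightarrow>
     f \<in> Arr C \<and> g \<in> Arr C \<and> Cod C f = Cod C g \<and>
     p \<in> hom C (Dom C p) (Dom C f) \<and> q \<in> hom C (Dom C p) (Dom C g) \<and> f \<cdot>\<^bsub>C\<^esub> p = g \<cdot>\<^bsub>C\<^esub> q \<and>
     (\<forall>W. \<forall>x \<in> hom C W (Dom C f). \<forall>y \<in> hom C W (Dom C g). f \<cdot>\<^bsub>C\<^esub> x = g \<cdot>\<^bsub>C\<^esub> y \<longrightarrow>
        (\<exists>!u. u \<in> hom C W (Dom C p) \<and> p \<cdot>\<^bsub>C\<^esub> u = x \<and> q \<cdot>\<^bsub>C\<^esub> u = y))"

definition ord_functor ::
  "('o, 'a, 'm) cat_scheme \<Rightarrow> ('p, 'b, 'n) cat_scheme \<Rightarrow> ('o \<Rightarrow> 'p) \<Rightarrow> ('a \<Rightarrow> 'b) \<Rightarrow> bool" where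
  "ord_functor A C Fo Fa \<longleftrightarrow>
     (\<forall>X \<in> Obj A. Fo X \<in> Obj C \<and> Fa (Id A X) = Id C (Fo X)) \<and>
     (\<forall>f \<in> Arr A. Fa f \<in> hom C (Fo (Dom A f)) (Fo (Cod A f))) \<and>
     (\<forall>f \<in> Arr A. \<forall>g \<in> Arr A. Cod A f = Dom A g \<longrightarrow> Fa (g \<cdot>\<^bsub>A\<^esub> f) = Fa g \<cdot>\<^bsub>C\<^esub> Fa f)"

definition cocone ::
  "('i, 'k, 'n) cat_scheme \<Rightarrow> ('o, 'a, 'm) cat_scheme \<Rightarrow> ('i \<Rightarrow> 'o) \<Rightarrow> ('k \<Rightarrow> 'a) \<Rightarrow>
   'o \<Rightarrow> ('i \<Rightarrow> 'a) \<Rightarrow> bool" where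
  "cocone A C Do Da L l \<longleftrightarrow> L \<in> Obj C \<and> (\<forall>i \<in> Obj A. l i \<in> hom C (Do i) L) \<and>
     (\<forall>f \<in> Arr A. l (Cod A f) \<cdot>\<^bsub>C\<^esub> Da f = l (Dom A f))"

definition cone ::
  "('i, 'k, 'n) cat_scheme \<Rightarrow> ('o, 'a, 'm) cat_scheme \<Rightarrow> ('i \<Rightarrow> 'o) \<Rightarrow> ('k \<Rightarrow> 'a) \<Rightarrow>
   'o \<Rightarrow> ('i \<Rightarrow> 'a) \<Rightarrow> bool" where
  "cone A C Do Da L l \<longleftrightarrow> L \<in> Obj C \<and> (\<forall>i \<in> Obj A. l i \<in> hom C L (Do i)) \<and>
     (\<forall>f \<in> Arr A. Da f \<cdot>\<^bsub>C\<^esub> l (Dom A f) = l (Cod A f))"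

definition is_colimit ::
  "('i, 'k, 'n) cat_scheme \<Rightarrow> ('o, 'a, 'm) cat_scheme \<Rightarrow> ('i \<Rightarrow> 'o) \<Rightarrow> ('k \<Rightarrow> 'a) \<Rightarrow>
   'o \<Rightarrow> ('i \<Rightarrow> 'a) \<Rightarrow> bool" where
  "is_colimit A C Do Da L l \<longleftrightarrow> cocone A C Do Da L l \<and>
     (\<forall>X x. cocone A C Do Da X x \<longrightarrow>
        (\<exists>!u. u \<in> hom C L X \<and> (\<forall>i \<in> Obj A. u \<cdot>\<^bsub>C\<^esub> l i = x i)))"

definition is_limit ::
  "('i, 'k, 'n) cat_scheme \<Rightarrow> ('o, 'a, 'm) cat_scheme \<Rightarrow> ('i \<Rightarrow> 'o) \<Rightarrow> ('k \<Rightarrow> 'a) \<Rightarrow>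
   'o \<Rightarrow> ('i \<Rightarrow> 'a) \<Rightarrow> bool" where
  "is_limit A C Do Da L l \<longleftrightarrow> cone A C Do Da L l \<and>
     (\<forall>X x. cone A C Do Da X x \<longrightarrow>
        (\<exists>!u. u \<in> hom C X L \<and> (\<forall>i \<in> Obj A. l i \<cdot>\<^bsub>C\<^esub> u = x i)))"

definition has_small_colimits :: "'u set \<Rightarrow> ('o, 'a, 'm) cat_scheme \<Rightarrow> bool" where
  "has_small_colimits U C \<longleftrightarrow>
     (\<forall>(A :: ('u, 'u) cat) Do Da. small_category U A \<and> ord_functor A C Do Da \<longrightarrow>
        (\<exists>L l. is_colimit A C Do Da L l))"

definition has_small_limits :: "'u set \<Rightarrow> ('o, 'a, 'm) cat_scheme \<Rightarrow> bool" where
  "has_small_limits U C \<longleftrightarrow>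
     (\<forall>(A :: ('u, 'u) cat) Do Da. small_category U A \<and> ord_functor A C Do Da \<longrightarrow>
        (\<exists>L l. is_limit A C Do Da L l))"

definition filtered :: "'u rel \<Rightarrow> ('u, 'u) cat \<Rightarrow> bool" where
  "filtered \<alpha> A \<longleftrightarrow>
     (\<forall>(B :: ('u, 'u) cat) To Ta. category B \<and> |Arr B| <o \<alpha> \<and> ord_functor B A To Ta \<longrightarrow>
        (\<exists>X x. cocone B A To Ta X x))"

text \<open>
  The shape of a wide pushout of a set \<open>S\<close> of arrows with common domain: \<^const>\<open>None\<close> stands for the
  domain and \<open>Some e\<close> for the codomain of \<open>e\<close>. Families of arrows are indexed by their own
  members; as wide pushouts are only taken of epimorphisms, repetitions would change nothing.
\<close>

definition span_shape :: "'a set \<Rightarrow> ('a option, 'a option \<times> 'a option) cat" where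
  "span_shape S = \<lparr>Obj = insert None (Some ` S),
     Arr = {(x, x) | x. x \<in> insert None (Some ` S)} \<union> {(None, Some e) | e. e \<in> S},
     Dom = fst, Cod = snd, Id = (\<lambda>x. (x, x)), Comp = (\<lambda>g f. (fst f, snd g))\<rparr>"

definition span_obj :: "('o, 'a, 'm) cat_scheme \<Rightarrow> 'o \<Rightarrow> 'a option \<Rightarrow> 'o" where
  "span_obj C A x = (case x of None \<Rightarrow> A | Some e \<Rightarrow> Cod C e)"

definition span_arr :: "('o, 'a, 'm) cat_scheme \<Rightarrow> 'o \<Rightarrow> 'a option \<times> 'a option \<Rightarrow> 'a" where
  "span_arr C A p = (case p of (None, Some e) \<Rightarrow> e | (x, y) \<Rightarrow> Id C (span_obj C A x))"

section \<open>Symmetric monoidal closed categories\<close>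

record ('o, 'a) smc = "('o, 'a) cat" +
  Tens :: "'o \<Rightarrow> 'o \<Rightarrow> 'o"  (infixr "\<otimes>\<index>" 75)
  TensA :: "'a \<Rightarrow> 'a \<Rightarrow> 'a"  (infixr "\<odot>\<index>" 75)
  Unit :: "'o"
  Assoc :: "'o \<Rightarrow> 'o \<Rightarrow> 'o \<Rightarrow> 'a"
  LUnit :: "'o \<Rightarrow> 'a"
  RUnit :: "'o \<Rightarrow> 'a"
  Sym :: "'o \<Rightarrow> 'o \<Rightarrow> 'a"
  IHom :: "'o \<Rightarrow> 'o \<Rightarrow> 'o"
  Ev :: "'o \<Rightarrow> 'o \<Rightarrow> 'a"

locale sym_monoidal_closed = category V
  for V :: "('o, 'a) smc" (structure) +
  assumes Unit_in_Obj: "Unit V \<in> Obj V"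
    and Tens_in_Obj: "\<lbrakk>A \<in> Obj V; B \<in> Obj V\<rbrakk> \<Longrightarrow> A \<otimes> B \<in> Obj V"
    and TensA_in_hom: "\<lbrakk>f \<in> hom V A B; g \<in> hom V X Y\<rbrakk> \<Longrightarrow> f \<odot> g \<in> hom V (A \<otimes> X) (B \<otimes> Y)"
    and TensA_Id: "\<lbrakk>A \<in> Obj V; B \<in> Obj V\<rbrakk> \<Longrightarrow> Id V A \<odot> Id V B = Id V (A \<otimes> B)"
    and TensA_Comp:
      "\<lbrakk>f \<in> hom V A B; f' \<in> hom V B D; g \<in> hom V X Y; g' \<in> hom V Y Z\<rbrakk>
        \<Longrightarrow> (f' \<cdot> f) \<odot> (g' \<cdot> g) = (f' \<odot> g') \<cdot> (f \<odot> g)"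
    and Assoc_in_hom:
      "\<lbrakk>A \<in> Obj V; B \<in> Obj V; D \<in> Obj V\<rbrakk>
        \<Longrightarrow> Assoc V A B D \<in> hom V ((A \<otimes> B) \<otimes> D) (A \<otimes> (B \<otimes> D))"
    and Assoc_iso: "\<lbrakk>A \<in> Obj V; B \<in> Obj V; D \<in> Obj V\<rbrakk> \<Longrightarrow> iso V (Assoc V A B D)"
    and Assoc_natural:
      "\<lbrakk>f \<in> hom V A A'; g \<in> hom V B B'; h \<in> hom V D D'\<rbrakk>
        \<Longrightarrow> Assoc V A' B' D' \<cdot> ((f \<odot> g) \<odot> h) = (f \<odot> (g \<odot> h)) \<cdot> Assoc V A B D"
    and LUnit_in_hom: "A \<in> Obj V \<Longrightarrow> LUnit V A \<in> hom V (Unit V \<otimes> A) A"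
    and LUnit_iso: "A \<in> Obj V \<Longrightarrow> iso V (LUnit V A)"
    and LUnit_natural: "f \<in> hom V A B \<Longrightarrow> LUnit V B \<cdot> (Id V (Unit V) \<odot> f) = f \<cdot> LUnit V A"
    and RUnit_in_hom: "A \<in> Obj V \<Longrightarrow> RUnit V A \<in> hom V (A \<otimes> Unit V) A"
    and RUnit_iso: "A \<in> Obj V \<Longrightarrow> iso V (RUnit V A)"
    and RUnit_natural: "f \<in> hom V A B \<Longrightarrow> RUnit V B \<cdot> (f \<odot> Id V (Unit V)) = f \<cdot> RUnit V A"
    and Sym_in_hom: "\<lbrakk>A \<in> Obj V; B \<in> Obj V\<rbrakk> \<Longrightarrow> Sym V A B \<in> hom V (A \<otimes> B) (B \<otimes> A)"
    and Sym_natural: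
      "\<lbrakk>f \<in> hom V A A'; g \<in> hom V B B'\<rbrakk> \<Longrightarrow> Sym V A' B' \<cdot> (f \<odot> g) = (g \<odot> f) \<cdot> Sym V A B"
    and Sym_Sym: "\<lbrakk>A \<in> Obj V; B \<in> Obj V\<rbrakk> \<Longrightarrow> Sym V B A \<cdot> Sym V A B = Id V (A \<otimes> B)"
    and pentagon:
      "\<lbrakk>A \<in> Obj V; B \<in> Obj V; D \<in> Obj V; E \<in> Obj V\<rbrakk>
        \<Longrightarrow> Assoc V A B (D \<otimes> E) \<cdot> Assoc V (A \<otimes> B) D E =
            (Id V A \<odot> Assoc V B D E) \<cdot> Assoc V A (B \<otimes> D) E \<cdot> (Assoc V A B D \<odot> Id V E)"
    and triangle:
      "\<lbrakk>A \<in> Obj V; B \<in> Obj V\<rbrakk>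
        \<Longrightarrow> (Id V A \<odot> LUnit V B) \<cdot> Assoc V A (Unit V) B = RUnit V A \<odot> Id V B"
    and hexagon:
      "\<lbrakk>A \<in> Obj V; B \<in> Obj V; D \<in> Obj V\<rbrakk>
        \<Longrightarrow> Assoc V B D A \<cdot> Sym V A (B \<otimes> D) \<cdot> Assoc V A B D =
            (Id V B \<odot> Sym V A D) \<cdot> Assoc V B A D \<cdot> (Sym V A B \<odot> Id V D)"
    and IHom_in_Obj: "\<lbrakk>A \<in> Obj V; B \<in> Obj V\<rbrakk> \<Longrightarrow> IHom V A B \<in> Obj V"
    and Ev_in_hom: "\<lbrakk>A \<in> Obj V; B \<in> Obj V\<rbrakk> \<Longrightarrow> Ev V A B \<in> hom V (IHom V A B \<otimes> A) B"
    and Ev_universal: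
      "\<lbrakk>W \<in> Obj V; A \<in> Obj V; B \<in> Obj V; f \<in> hom V (W \<otimes> A) B\<rbrakk>
        \<Longrightarrow> \<exists>!g. g \<in> hom V W (IHom V A B) \<and> Ev V A B \<cdot> (g \<odot> Id V A) = f"

definition transpose :: "('o, 'a) smc \<Rightarrow> 'o \<Rightarrow> 'o \<Rightarrow> 'o \<Rightarrow> 'a \<Rightarrow> 'a" where
  "transpose V W A B f =
     (THE g. g \<in> hom V W (IHom V A B) \<and> Ev V A B \<cdot>\<^bsub>V\<^esub> (g \<odot>\<^bsub>V\<^esub> Id V A) = f)"

section \<open>Enriched categories and functors\<close>

text \<open>\<open>VComp C A B D\<close> is the composition \<open>C(B,D) \<otimes> C(A,B) \<rightarrow> C(A,D)\<close>.\<close>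

record ('x, 'o, 'a) vcat =
  VObj :: "'x set"
  VHom :: "'x \<Rightarrow> 'x \<Rightarrow> 'o"
  VComp :: "'x \<Rightarrow> 'x \<Rightarrow> 'x \<Rightarrow> 'a"
  VId :: "'x \<Rightarrow> 'a"

locale vcategory =
  fixes V :: "('o, 'a) smc" (structure) and C :: "('x, 'o, 'a) vcat"
  assumes VHom_in_Obj: "\<lbrakk>A \<in> VObj C; B \<in> VObj C\<rbrakk> \<Longrightarrow> VHom C A B \<in> Obj V"
    and VComp_in_hom:
      "\<lbrakk>A \<in> VObj C; B \<in> VObj C; D \<in> VObj C\<rbrakk>
        \<Longrightarrow> VComp C A B D \<in> hom V (VHom C B D \<otimes> VHom C A B) (VHom C A D)"
    and VId_in_hom: "A \<in> VObj C \<Longrightarrow> VId C A \<in> hom V (Unit V) (VHom C A A)"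
    and VComp_assoc:
      "\<lbrakk>A \<in> VObj C; B \<in> VObj C; D \<in> VObj C; E \<in> VObj C\<rbrakk>
        \<Longrightarrow> VComp C A B E \<cdot> (VComp C B D E \<odot> Id V (VHom C A B)) =
            VComp C A D E \<cdot> (Id V (VHom C D E) \<odot> VComp C A B D) \<cdot>
              Assoc V (VHom C D E) (VHom C B D) (VHom C A B)"
    and VId_VComp:
      "\<lbrakk>A \<in> VObj C; B \<in> VObj C\<rbrakk>
        \<Longrightarrow> VComp C A B B \<cdot> (VId C B \<odot> Id V (VHom C A B)) = LUnit V (VHom C A B)"
    and VComp_VId:
      "\<lbrakk>A \<in> VObj C; B \<in> VObj C\<rbrakk>
        \<Longrightarrow> VComp C A A B \<cdot> (Id V (VHom C A B) \<odot> VId C A) = RUnit V (VHom C A B)"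

definition vfunctor ::
  "('o, 'a) smc \<Rightarrow> ('x, 'o, 'a) vcat \<Rightarrow> ('y, 'o, 'a) vcat \<Rightarrow> ('x \<Rightarrow> 'y) \<Rightarrow> ('x \<Rightarrow> 'x \<Rightarrow> 'a) \<Rightarrow> bool" where
  "vfunctor V K C Fo Fa \<longleftrightarrow>
     (\<forall>x \<in> VObj K. Fo x \<in> VObj C \<and> Fa x x \<cdot>\<^bsub>V\<^esub> VId K x = VId C (Fo x)) \<and>
     (\<forall>x \<in> VObj K. \<forall>y \<in> VObj K. Fa x y \<in> hom V (VHom K x y) (VHom C (Fo x) (Fo y))) \<and>
     (\<forall>x \<in> VObj K. \<forall>y \<in> VObj K. \<forall>z \<in> VObj K.
        Fa x z \<cdot>\<^bsub>V\<^esub> VComp K x y z = VComp C (Fo x) (Fo y) (Fo z) \<cdot>\<^bsub>V\<^esub> (Fa y z \<odot>\<^bsub>V\<^esub> Fa x y))"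

definition vfully_faithful ::
  "('o, 'a) smc \<Rightarrow> ('x, 'o, 'a) vcat \<Rightarrow> ('x \<Rightarrow> 'x \<Rightarrow> 'a) \<Rightarrow> bool" where
  "vfully_faithful V K Fa \<longleftrightarrow> (\<forall>x \<in> VObj K. \<forall>y \<in> VObj K. iso V (Fa x y))"

subsection \<open>Weighted colimits\<close>

text \<open>
  A weight, i.e. a \<open>V\<close>-functor \<open>W : K\<^sup>o\<^sup>p \<rightarrow> V\<close>, is given by its objects \<open>Wo k\<close> and the transposes
  \<open>Wa k k' : W k' \<otimes> K(k,k') \<rightarrow> W k\<close> of the maps \<open>K(k,k') \<rightarrow> [W k', W k]\<close>.
\<close>

definition weight ::
  "('o, 'a) smc \<Rightarrow> ('k, 'o, 'a) vcat \<Rightarrow> ('k \<Rightarrow> 'o) \<Rightarrow> ('k \<Rightarrow> 'k \<Rightarrow> 'a) \<Rightarrow> bool" where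
  "weight V K Wo Wa \<longleftrightarrow>
     (\<forall>k \<in> VObj K. Wo k \<in> Obj V \<and>
        Wa k k \<cdot>\<^bsub>V\<^esub> (Id V (Wo k) \<odot>\<^bsub>V\<^esub> VId K k) = RUnit V (Wo k)) \<and>
     (\<forall>k \<in> VObj K. \<forall>k' \<in> VObj K. Wa k k' \<in> hom V (Wo k' \<otimes>\<^bsub>V\<^esub> VHom K k k') (Wo k)) \<and>
     (\<forall>k \<in> VObj K. \<forall>k' \<in> VObj K. \<forall>k'' \<in> VObj K.
        Wa k k' \<cdot>\<^bsub>V\<^esub> (Wa k' k'' \<odot>\<^bsub>V\<^esub> Id V (VHom K k k')) =
        Wa k k'' \<cdot>\<^bsub>V\<^esub> (Id V (Wo k'') \<odot>\<^bsub>V\<^esub> VComp K k k' k'') \<cdot>\<^bsub>V\<^esub>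
          Assoc V (Wo k'') (VHom K k' k'') (VHom K k k'))"

text \<open>
  The arrows \<open>\<phi> k : Z \<otimes> W k \<rightarrow> C(D k, Y)\<close> are the transposes of a family
  \<open>Z \<rightarrow> [W k, C(D k, Y)]\<close>; the condition is \<open>V\<close>-naturality of that family in \<open>k\<close>.
\<close>

definition vnat_family ::
  "('o, 'a) smc \<Rightarrow> ('k, 'o, 'a) vcat \<Rightarrow> ('k \<Rightarrow> 'o) \<Rightarrow> ('k \<Rightarrow> 'k \<Rightarrow> 'a) \<Rightarrow> ('x, 'o, 'a) vcat \<Rightarrow>
   ('k \<Rightarrow> 'x) \<Rightarrow> ('k \<Rightarrow> 'k \<Rightarrow> 'a) \<Rightarrow> 'o \<Rightarrow> 'x \<Rightarrow> ('k \<Rightarrow> 'a) \<Rightarrow> bool" where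
  "vnat_family V K Wo Wa C Do Da Z Y \<phi> \<longleftrightarrow>
     (\<forall>k \<in> VObj K. \<phi> k \<in> hom V (Z \<otimes>\<^bsub>V\<^esub> Wo k) (VHom C (Do k) Y)) \<and>
     (\<forall>k \<in> VObj K. \<forall>k' \<in> VObj K.
        \<phi> k \<cdot>\<^bsub>V\<^esub> (Id V Z \<odot>\<^bsub>V\<^esub> Wa k k') \<cdot>\<^bsub>V\<^esub> Assoc V Z (Wo k') (VHom K k k') =
        VComp C (Do k) (Do k') Y \<cdot>\<^bsub>V\<^esub> (\<phi> k' \<odot>\<^bsub>V\<^esub> Da k k'))"

text \<open>
  \<open>(L, \<eta>)\<close> is a colimit of \<open>D : K \<rightarrow> C\<close> weighted by \<open>W\<close>, with \<open>V\<close>-natural unit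
  \<open>\<eta> k : W k \<rightarrow> C(D k, L)\<close>: for each \<open>Y\<close>, the family \<open>C(L,Y) \<rightarrow> [W k, C(D k, Y)]\<close> induced by \<open>\<eta>\<close>
  exhibits \<open>C(L,Y)\<close> as the end \<open>[K\<^sup>o\<^sup>p, V](W, C(D-,Y))\<close>.
\<close>

definition is_weighted_colimit ::
  "('o, 'a) smc \<Rightarrow> ('k, 'o, 'a) vcat \<Rightarrow> ('k \<Rightarrow> 'o) \<Rightarrow> ('k \<Rightarrow> 'k \<Rightarrow> 'a) \<Rightarrow> ('x, 'o, 'a) vcat \<Rightarrow>
   ('k \<Rightarrow> 'x) \<Rightarrow> ('k \<Rightarrow> 'k \<Rightarrow> 'a) \<Rightarrow> 'x \<Rightarrow> ('k \<Rightarrow> 'a) \<Rightarrow> bool" where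
  "is_weighted_colimit V K Wo Wa C Do Da L \<eta> \<longleftrightarrow>
     L \<in> VObj C \<and>
     (\<forall>k \<in> VObj K. \<eta> k \<in> hom V (Wo k) (VHom C (Do k) L)) \<and>
     (\<forall>k \<in> VObj K. \<forall>k' \<in> VObj K.
        \<eta> k \<cdot>\<^bsub>V\<^esub> Wa k k' = VComp C (Do k) (Do k') L \<cdot>\<^bsub>V\<^esub> (\<eta> k' \<odot>\<^bsub>V\<^esub> Da k k')) \<and>
     (\<forall>Y \<in> VObj C. \<forall>Z \<in> Obj V. \<forall>\<phi>. vnat_family V K Wo Wa C Do Da Z Y \<phi> \<longrightarrow>
        (\<exists>!\<psi>. \<psi> \<in> hom V Z (VHom C L Y) \<and>
           (\<forall>k \<in> VObj K. \<phi> k = VComp C (Do k) L Y \<cdot>\<^bsub>V\<^esub> (\<psi> \<odot>\<^bsub>V\<^esub> \<eta> k))))"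

definition vcocomplete :: "'u set \<Rightarrow> ('o, 'a) smc \<Rightarrow> ('x, 'o, 'a) vcat \<Rightarrow> bool" where
  "vcocomplete U V C \<longleftrightarrow>
     (\<forall>(K :: ('u, 'o, 'a) vcat) Wo Wa Do Da.
        vcategory V K \<and> small U (VObj K) \<and> weight V K Wo Wa \<and> vfunctor V K C Do Da \<longrightarrow>
        (\<exists>L \<eta>. is_weighted_colimit V K Wo Wa C Do Da L \<eta>))"

text \<open>
  The nerve \<open>C \<rightarrow> [J\<^sup>o\<^sup>p, V]\<close>, \<open>X \<mapsto> C(j-, X)\<close>, of \<open>j\<close> is fully faithful: each \<open>C(X,Y)\<close> is, via
  composition, the end \<open>[J\<^sup>o\<^sup>p, V](C(j-,X), C(j-,Y))\<close>. Equivalently, the identities exhibit each \<open>X\<close>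
  as the colimit of \<open>j\<close> weighted by \<open>C(j-,X)\<close>.
\<close>

definition vdense ::
  "('o, 'a) smc \<Rightarrow> ('x, 'o, 'a) vcat \<Rightarrow> ('j, 'o, 'a) vcat \<Rightarrow> ('j \<Rightarrow> 'x) \<Rightarrow> ('j \<Rightarrow> 'j \<Rightarrow> 'a) \<Rightarrow> bool" where
  "vdense V C J jo ja \<longleftrightarrow>
     (\<forall>X \<in> VObj C. is_weighted_colimit V J
        (\<lambda>k. VHom C (jo k) X)
        (\<lambda>k k'. VComp C (jo k) (jo k') X \<cdot>\<^bsub>V\<^esub> (Id V (VHom C (jo k') X) \<odot>\<^bsub>V\<^esub> ja k k'))
        C jo ja X (\<lambda>k. Id V (VHom C (jo k) X)))"

section \<open>The underlying category and its hom functor\<close>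

text \<open>
  A category equipped with a functor \<open>C(-,-) : C\<^sub>0\<^sup>o\<^sup>p \<times> C\<^sub>0 \<rightarrow> V\<^sub>0\<close>: \<open>HomR A g\<close> is \<open>C(A,g)\<close> and \<open>HomL f X\<close>
  is \<open>C(f,X)\<close>. It serves to treat uniformly a \<open>V\<close>-category with its underlying category, and \<open>V\<close>
  itself, whose underlying category is identified with \<open>V\<^sub>0\<close> and whose hom functor is the
  internal hom.
\<close>

record ('o, 'a, 'vo, 'va) hcat = "('o, 'a) cat" +
  HomO :: "'o \<Rightarrow> 'o \<Rightarrow> 'vo"
  HomR :: "'o \<Rightarrow> 'a \<Rightarrow> 'va"
  HomL :: "'a \<Rightarrow> 'o \<Rightarrow> 'va"

text \<open>An arrow \<open>A \<rightarrow> B\<close> of the underlying category is a triple \<open>(A, B, f)\<close> with \<open>f : I \<rightarrow> C(A,B)\<close>.\<close>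

definition underlying ::
  "('o, 'a) smc \<Rightarrow> ('x, 'o, 'a) vcat \<Rightarrow> ('x, 'x \<times> 'x \<times> 'a, 'o, 'a) hcat" where
  "underlying V C = \<lparr>
     Obj = VObj C,
     Arr = {(A, B, f). A \<in> VObj C \<and> B \<in> VObj C \<and> f \<in> hom V (Unit V) (VHom C A B)},
     Dom = (\<lambda>(A, B, f). A),
     Cod = (\<lambda>(A, B, f). B),
     Id = (\<lambda>A. (A, A, VId C A)),
     Comp = (\<lambda>(B, D, g) (A, _, f).
       (A, D, VComp C A B D \<cdot>\<^bsub>V\<^esub> (g \<odot>\<^bsub>V\<^esub> f) \<cdot>\<^bsub>V\<^esub> inv_arr V (LUnit V (Unit V)))),
     HomO = VHom C,
     HomR = (\<lambda>A (X, Y, g).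
       VComp C A X Y \<cdot>\<^bsub>V\<^esub> (g \<odot>\<^bsub>V\<^esub> Id V (VHom C A X)) \<cdot>\<^bsub>V\<^esub> inv_arr V (LUnit V (VHom C A X))),
     HomL = (\<lambda>(A, B, f) X.
       VComp C A B X \<cdot>\<^bsub>V\<^esub> (Id V (VHom C B X) \<odot>\<^bsub>V\<^esub> f) \<cdot>\<^bsub>V\<^esub> inv_arr V (RUnit V (VHom C B X)))\<rparr>"

definition self_enriched :: "('o, 'a) smc \<Rightarrow> ('o, 'a, 'o, 'a) hcat" where
  "self_enriched V = \<lparr>
     Obj = Obj V, Arr = Arr V, Dom = Dom V, Cod = Cod V, Id = Id V, Comp = Comp V,
     HomO = IHom V,
     HomR = (\<lambda>A g. transpose V (IHom V A (Dom V g)) A (Cod V g) (g \<cdot>\<^bsub>V\<^esub> Ev V A (Dom V g))),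
     HomL = (\<lambda>f X. transpose V (IHom V (Cod V f) X) (Dom V f) X
       (Ev V (Cod V f) X \<cdot>\<^bsub>V\<^esub> (Id V (IHom V (Cod V f) X) \<odot>\<^bsub>V\<^esub> f)))\<rparr>"

definition is_conical_colimit ::
  "('i, 'k, 'n) cat_scheme \<Rightarrow> ('vo, 'va, 'm) cat_scheme \<Rightarrow> ('o, 'a, 'vo, 'va) hcat \<Rightarrow>
   ('i \<Rightarrow> 'o) \<Rightarrow> ('k \<Rightarrow> 'a) \<Rightarrow> 'o \<Rightarrow> ('i \<Rightarrow> 'a) \<Rightarrow> bool" where
  "is_conical_colimit A V C Do Da L l \<longleftrightarrow> cocone A C Do Da L l \<and>
     (\<forall>Y \<in> Obj C. is_limit (op_cat A) V (\<lambda>i. HomO C (Do i) Y) (\<lambda>f. HomL C (Da f) Y)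
        (HomO C L Y) (\<lambda>i. HomL C (l i) Y))"

section \<open>Factegories\<close>

definition vorthogonal ::
  "('vo, 'va, 'm) cat_scheme \<Rightarrow> ('o, 'a, 'vo, 'va) hcat \<Rightarrow> 'a \<Rightarrow> 'a \<Rightarrow> bool" where
  "vorthogonal V C e m \<longleftrightarrow>
     is_pullback V (HomL C e (Dom C m)) (HomR C (Cod C e) m) (HomR C (Dom C e) m) (HomL C e (Cod C m))"

definition enriched_factorization_system ::
  "('vo, 'va, 'm) cat_scheme \<Rightarrow> ('o, 'a, 'vo, 'va) hcat \<Rightarrow> 'a set \<Rightarrow> 'a set \<Rightarrow> bool" where
  "enriched_factorization_system V C E M \<longleftrightarrow> E \<subseteq> Arr C \<and> M \<subseteq> Arr C \<and>
     (\<forall>f \<in> Arr C. \<exists>e \<in> E. \<exists>m \<in> M. Cod C e = Dom C m \<and> f = m \<cdot>\<^bsub>C\<^esub> e) \<and>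
     (\<forall>e \<in> Arr C. e \<in> E \<longleftrightarrow> (\<forall>m \<in> M. vorthogonal V C e m)) \<and>
     (\<forall>m \<in> Arr C. m \<in> M \<longleftrightarrow> (\<forall>e \<in> E. vorthogonal V C e m))"

text \<open>Here \<open>\<M>\<close> is the right class of the closed factegory \<open>V\<close>.\<close>

definition factegory ::
  "('vo, 'va, 'm) cat_scheme \<Rightarrow> 'va set \<Rightarrow> ('o, 'a, 'vo, 'va) hcat \<Rightarrow> 'a set \<Rightarrow> 'a set \<Rightarrow> bool" where
  "factegory V \<M> C E M \<longleftrightarrow> enriched_factorization_system V C E M \<and>
     (\<forall>m \<in> M. \<forall>A \<in> Obj C. HomR C A m \<in> \<M>)"

definition vproper ::
  "('vo, 'va, 'm) cat_scheme \<Rightarrow> ('o, 'a, 'vo, 'va) hcat \<Rightarrow> 'a set \<Rightarrow> 'a set \<Rightarrow> bool" where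
  "vproper V C E M \<longleftrightarrow>
     (\<forall>e \<in> E. \<forall>A \<in> Obj C. monic V (HomL C e A)) \<and>
     (\<forall>m \<in> M. \<forall>A \<in> Obj C. monic V (HomR C A m))"

definition has_conical_cointersections ::
  "('vo, 'va, 'm) cat_scheme \<Rightarrow> ('o, 'a, 'vo, 'va) hcat \<Rightarrow> 'a set \<Rightarrow> bool" where
  "has_conical_cointersections V C E \<longleftrightarrow>
     (\<forall>A \<in> Obj C. \<forall>S \<subseteq> E. (\<forall>e \<in> S. Dom C e = A) \<longrightarrow>
        (\<exists>P p. is_conical_colimit (span_shape S) V C (span_obj C A) (span_arr C A) P p))"

definition cocomplete_proper_factegory ::
  "'u set \<Rightarrow> ('o, 'a) smc \<Rightarrow> 'a set \<Rightarrow> ('x, 'o, 'a) vcat \<Rightarrow>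
   ('x \<times> 'x \<times> 'a) set \<Rightarrow> ('x \<times> 'x \<times> 'a) set \<Rightarrow> bool" where
  "cocomplete_proper_factegory U V \<M> C EC MC \<longleftrightarrow>
     vcocomplete U V C \<and> factegory V \<M> (underlying V C) EC MC \<and>
     vproper V (underlying V C) EC MC \<and> has_conical_cointersections V (underlying V C) EC"

section \<open>Boundedness\<close>

text \<open>
  \<open>Fo\<close> and \<open>Fa\<close> are the underlying ordinary functor of a \<open>V\<close>-functor from \<open>C\<close> to \<open>D\<close>; boundedness
  depends on nothing else. The arrows \<open>u\<close> and \<open>u'\<close> are those induced on the colimits.
\<close>

definition bounded_functor ::
  "'u set \<Rightarrow> 'u rel \<Rightarrow> ('vo, 'va, 'm) cat_scheme \<Rightarrow> ('o, 'a, 'vo, 'va) hcat \<Rightarrow> 'a set \<Rightarrow> 'a set \<Rightarrow>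
   ('p, 'b, 'vo, 'va) hcat \<Rightarrow> 'b set \<Rightarrow> ('o \<Rightarrow> 'p) \<Rightarrow> ('a \<Rightarrow> 'b) \<Rightarrow> bool" where
  "bounded_functor U \<alpha> V C EC MC D ED Fo Fa \<longleftrightarrow>
     (\<forall>(A :: ('u, 'u) cat) Do Da X m L l u L' l' u'.
        small_category U A \<and> filtered \<alpha> A \<and> ord_functor A C Do Da \<and>
        cocone A C Do Da X m \<and> (\<forall>i \<in> Obj A. m i \<in> MC) \<and>
        is_conical_colimit A V C Do Da L l \<and>
        u \<in> hom C L X \<and> (\<forall>i \<in> Obj A. u \<cdot>\<^bsub>C\<^esub> l i = m i) \<and>
        is_conical_colimit A V D (Fo \<circ> Do) (Fa \<circ> Da) L' l' \<and>
        u' \<in> hom D L' (Fo X) \<and> (\<forall>i \<in> Obj A. u' \<cdot>\<^bsub>D\<^esub> l' i = Fa (m i)) \<and>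
        u \<in> EC \<longrightarrow> u' \<in> ED)"

text \<open>Boundedness of \<open>C(G,-) : C \<rightarrow> V\<close>, where \<open>E\<close> is the left class of the closed factegory \<open>V\<close>.\<close>

definition bounded_object ::
  "'u set \<Rightarrow> 'u rel \<Rightarrow> ('o, 'a) smc \<Rightarrow> 'a set \<Rightarrow> ('x, 'o, 'a) vcat \<Rightarrow>
   ('x \<times> 'x \<times> 'a) set \<Rightarrow> ('x \<times> 'x \<times> 'a) set \<Rightarrow> 'x \<Rightarrow> bool" where
  "bounded_object U \<alpha> V E C EC MC G \<longleftrightarrow>
     bounded_functor U \<alpha> V (underlying V C) EC MC (self_enriched V) E
       (HomO (underlying V C) G) (HomR (underlying V C) G)"

section \<open>Locally bounded \<open>V\<close>-categories\<close>

text \<open>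
  \<open>(T, \<eta>)\<close> is a tensor \<open>X \<otimes> G\<close>, with unit \<open>\<eta> : X \<rightarrow> C(G,T)\<close>: the induced arrows
  \<open>C(T,Y) \<rightarrow> [X, C(G,Y)]\<close> are isomorphisms.
\<close>

definition is_tensor ::
  "('o, 'a) smc \<Rightarrow> ('x, 'o, 'a) vcat \<Rightarrow> 'o \<Rightarrow> 'x \<Rightarrow> 'x \<Rightarrow> 'a \<Rightarrow> bool" where
  "is_tensor V C X G T \<eta> \<longleftrightarrow> T \<in> VObj C \<and> \<eta> \<in> hom V X (VHom C G T) \<and>
     (\<forall>Y \<in> VObj C. iso V (transpose V (VHom C T Y) X (VHom C G Y)
        (VComp C G T Y \<cdot>\<^bsub>V\<^esub> (Id V (VHom C T Y) \<odot>\<^bsub>V\<^esub> \<eta>))))"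

text \<open>
  \<open>s\<close> is the canonical arrow from a coproduct of the tensors \<open>C(G,X) \<otimes> G\<close>, \<open>G \<in> \<G>\<close>, to \<open>X\<close>: its
  restriction to \<open>C(G,X) \<otimes> G\<close> corresponds to the identity of \<open>C(G,X)\<close>. It is determined up to
  isomorphism by the choice of tensors and coproduct, which exist if \<open>C\<close> is cocomplete and \<open>\<G>\<close> is small.
\<close>

definition is_generator_arrow ::
  "('o, 'a) smc \<Rightarrow> ('x, 'o, 'a) vcat \<Rightarrow> 'x set \<Rightarrow> 'x \<Rightarrow> 'x \<times> 'x \<times> 'a \<Rightarrow> bool" where
  "is_generator_arrow V C \<G> X s \<longleftrightarrow>
     (\<exists>T \<eta> P \<iota>.
        (\<forall>G \<in> \<G>. is_tensor V C (VHom C G X) G (T G) (\<eta> G)) \<and>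
        is_conical_colimit (discrete \<G>) V (underlying V C) T (\<lambda>G. Id (underlying V C) (T G)) P \<iota> \<and>
        s \<in> hom (underlying V C) P X \<and>
        (\<forall>G \<in> \<G>. HomR (underlying V C) G (s \<cdot>\<^bsub>underlying V C\<^esub> \<iota> G) \<cdot>\<^bsub>V\<^esub> \<eta> G = Id V (VHom C G X)))"

definition enriched_generator ::
  "'u set \<Rightarrow> ('o, 'a) smc \<Rightarrow> ('x, 'o, 'a) vcat \<Rightarrow> ('x \<times> 'x \<times> 'a) set \<Rightarrow> 'x set \<Rightarrow> bool" where
  "enriched_generator U V C EC \<G> \<longleftrightarrow> \<G> \<subseteq> VObj C \<and> small U \<G> \<and>
     (\<forall>X \<in> VObj C. \<exists>s \<in> EC. is_generator_arrow V C \<G> X s)"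

definition locally_bounded_at ::
  "'u set \<Rightarrow> 'u rel \<Rightarrow> ('o, 'a) smc \<Rightarrow> 'a set \<Rightarrow> 'a set \<Rightarrow> ('x, 'o, 'a) vcat \<Rightarrow>
   ('x \<times> 'x \<times> 'a) set \<Rightarrow> ('x \<times> 'x \<times> 'a) set \<Rightarrow> bool" where
  "locally_bounded_at U \<alpha> V E M C EC MC \<longleftrightarrow>
     cocomplete_proper_factegory U V M C EC MC \<and>
     (\<exists>\<G>. enriched_generator U V C EC \<G> \<and> (\<forall>G \<in> \<G>. bounded_object U \<alpha> V E C EC MC G))"

definition locally_bounded ::
  "'u set \<Rightarrow> ('o, 'a) smc \<Rightarrow> 'a set \<Rightarrow> 'a set \<Rightarrow> ('x, 'o, 'a) vcat \<Rightarrow>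
   ('x \<times> 'x \<times> 'a) set \<Rightarrow> ('x \<times> 'x \<times> 'a) set \<Rightarrow> bool" where
  "locally_bounded U V E M C EC MC \<longleftrightarrow>
     (\<exists>\<alpha>. regular_cardinal U \<alpha> \<and> locally_bounded_at U \<alpha> V E M C EC MC)"

section \<open>The case of \<open>Set\<close>-enrichment\<close>

text \<open>
  The same notions for \<open>V = Set\<close> with (surjections, injections): a \<open>Set\<close>-category is a locally small
  category, cocompleteness is existence of small colimits, tensors are copowers, and the condition
  that \<open>Hom(A,m)\<close> be injective for \<open>m \<in> M\<close> is part of properness.
\<close>

definition orthogonal :: "('o, 'a, 'm) cat_scheme \<Rightarrow> 'a \<Rightarrow> 'a \<Rightarrow> bool" where
  "orthogonal C e m \<longleftrightarrow>
     (\<forall>u \<in> hom C (Dom C e) (Dom C m). \<forall>v \<in> hom C (Cod C e) (Cod C m). m \<cdot>\<^bsub>C\<^esub> u = v \<cdot>\<^bsub>C\<^esub> e \<longrightarrow>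
        (\<exists>!d. d \<in> hom C (Cod C e) (Dom C m) \<and> d \<cdot>\<^bsub>C\<^esub> e = u \<and> m \<cdot>\<^bsub>C\<^esub> d = v))"

definition factorization_system ::
  "('o, 'a, 'm) cat_scheme \<Rightarrow> 'a set \<Rightarrow> 'a set \<Rightarrow> bool" where
  "factorization_system C E M \<longleftrightarrow> E \<subseteq> Arr C \<and> M \<subseteq> Arr C \<and>
     (\<forall>f \<in> Arr C. \<exists>e \<in> E. \<exists>m \<in> M. Cod C e = Dom C m \<and> f = m \<cdot>\<^bsub>C\<^esub> e) \<and>
     (\<forall>e \<in> Arr C. e \<in> E \<longleftrightarrow> (\<forall>m \<in> M. orthogonal C e m)) \<and>
     (\<forall>m \<in> Arr C. m \<in> M \<longleftrightarrow> (\<forall>e \<in> E. orthogonal C e m))"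

definition proper :: "('o, 'a, 'm) cat_scheme \<Rightarrow> 'a set \<Rightarrow> 'a set \<Rightarrow> bool" where
  "proper C E M \<longleftrightarrow> (\<forall>e \<in> E. epic C e) \<and> (\<forall>m \<in> M. monic C m)"

definition has_cointersections :: "('o, 'a, 'm) cat_scheme \<Rightarrow> 'a set \<Rightarrow> bool" where
  "has_cointersections C E \<longleftrightarrow>
     (\<forall>A \<in> Obj C. \<forall>S \<subseteq> E. (\<forall>e \<in> S. Dom C e = A) \<longrightarrow>
        (\<exists>P p. is_colimit (span_shape S) C (span_obj C A) (span_arr C A) P p))"

text \<open>
  The colimit of the sets \<open>So i\<close>: the quotient of their disjoint union by the equivalence relation
  generated by \<open>(i, x) ~ (k, Sa f x)\<close> for \<open>f : i \<rightarrow> k\<close>.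
\<close>

definition set_colimit ::
  "('i, 'k, 'n) cat_scheme \<Rightarrow> ('i \<Rightarrow> 'x set) \<Rightarrow> ('k \<Rightarrow> 'x \<Rightarrow> 'x) \<Rightarrow> ('i \<times> 'x) set set" where
  "set_colimit A So Sa =
     (let r = {((Dom A f, x), (Cod A f, Sa f x)) | f x. f \<in> Arr A \<and> x \<in> So (Dom A f)}
      in Sigma (Obj A) So // (r \<union> r\<inverse>)\<^sup>*)"

text \<open>
  The last two lines say that the map from the colimit of \<open>Hom(G, D i)\<close> to \<open>Hom(G,X)\<close> induced by
  composition with the \<open>m i\<close>, which is constant on representatives, is surjective.
\<close>

definition ord_bounded_object ::
  "'u set \<Rightarrow> 'u rel \<Rightarrow> ('o, 'a, 'm) cat_scheme \<Rightarrow> 'a set \<Rightarrow> 'a set \<Rightarrow> 'o \<Rightarrow> bool" where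
  "ord_bounded_object U \<alpha> C E M G \<longleftrightarrow>
     (\<forall>(A :: ('u, 'u) cat) Do Da X m L l u.
        small_category U A \<and> filtered \<alpha> A \<and> ord_functor A C Do Da \<and>
        cocone A C Do Da X m \<and> (\<forall>i \<in> Obj A. m i \<in> M) \<and>
        is_colimit A C Do Da L l \<and>
        u \<in> hom C L X \<and> (\<forall>i \<in> Obj A. u \<cdot>\<^bsub>C\<^esub> l i = m i) \<and> u \<in> E \<longrightarrow>
        (\<lambda>q. the_elem ((\<lambda>(i, h). m i \<cdot>\<^bsub>C\<^esub> h) ` q)) `
          set_colimit A (\<lambda>i. hom C G (Do i)) (\<lambda>f h. Da f \<cdot>\<^bsub>C\<^esub> h) = hom C G X)"

text \<open>\<open>T G\<close> is the copower \<open>Hom(G,X) \<cdot> G\<close> with injections \<open>\<kappa> G f\<close>, \<open>f : G \<rightarrow> X\<close>.\<close>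

definition is_ord_generator_arrow ::
  "('o, 'a, 'm) cat_scheme \<Rightarrow> 'o set \<Rightarrow> 'o \<Rightarrow> 'a \<Rightarrow> bool" where
  "is_ord_generator_arrow C \<G> X s \<longleftrightarrow>
     (\<exists>T \<kappa> P \<iota>.
        (\<forall>G \<in> \<G>. is_colimit (discrete (hom C G X)) C (\<lambda>_. G) (\<lambda>_. Id C G) (T G) (\<kappa> G)) \<and>
        is_colimit (discrete \<G>) C T (\<lambda>G. Id C (T G)) P \<iota> \<and>
        s \<in> hom C P X \<and> (\<forall>G \<in> \<G>. \<forall>f \<in> hom C G X. (s \<cdot>\<^bsub>C\<^esub> \<iota> G) \<cdot>\<^bsub>C\<^esub> \<kappa> G f = f))"

definition ord_generator ::
  "'u set \<Rightarrow> ('o, 'a, 'm) cat_scheme \<Rightarrow> 'a set \<Rightarrow> 'o set \<Rightarrow> bool" where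
  "ord_generator U C E \<G> \<longleftrightarrow> \<G> \<subseteq> Obj C \<and> small U \<G> \<and>
     (\<forall>X \<in> Obj C. \<exists>s \<in> E. is_ord_generator_arrow C \<G> X s)"

text \<open>\<open>C\<close> is a locally \<open>\<alpha>\<close>-bounded \<open>Set\<close>-category with generator \<open>\<G>\<close>.\<close>

definition ord_locally_bounded_at ::
  "'u set \<Rightarrow> 'u rel \<Rightarrow> ('o, 'a, 'm) cat_scheme \<Rightarrow> 'a set \<Rightarrow> 'a set \<Rightarrow> 'o set \<Rightarrow> bool" where
  "ord_locally_bounded_at U \<alpha> C E M \<G> \<longleftrightarrow>
     category C \<and> locally_small U C \<and> has_small_colimits U C \<and>
     factorization_system C E M \<and> proper C E M \<and> has_cointersections C E \<and>
     ord_generator U C E \<G> \<and> (\<forall>G \<in> \<G>. ord_bounded_object U \<alpha> C E M G)"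

text \<open>Boundedness of the unit and of the \<open>G \<otimes> G'\<close> refers to the \<open>Set\<close>-category \<open>V\<^sub>0\<close>.\<close>

definition locally_bounded_closed_at ::
  "'u set \<Rightarrow> 'u rel \<Rightarrow> ('o, 'a) smc \<Rightarrow> 'a set \<Rightarrow> 'a set \<Rightarrow> bool" where
  "locally_bounded_closed_at U \<alpha> V E M \<longleftrightarrow>
     (\<exists>\<G>. ord_locally_bounded_at U \<alpha> V E M \<G> \<and>
        enriched_factorization_system V (self_enriched V) E M \<and>
        ord_bounded_object U \<alpha> V E M (Unit V) \<and>
        (\<forall>G \<in> \<G>. \<forall>G' \<in> \<G>. ord_bounded_object U \<alpha> V E M (G \<otimes>\<^bsub>V\<^esub> G')))"

definition locally_bounded_closed ::
  "'u set \<Rightarrow> ('o, 'a) smc \<Rightarrow> 'a set \<Rightarrow> 'a set \<Rightarrow> bool" where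
  "locally_bounded_closed U V E M \<longleftrightarrow>
     (\<exists>\<alpha>. regular_cardinal U \<alpha> \<and> locally_bounded_closed_at U \<alpha> V E M)"

section \<open>Subcategories of arities\<close>

definition subcategory_of_arities ::
  "('o, 'a) smc \<Rightarrow> ('x, 'o, 'a) vcat \<Rightarrow> ('j, 'o, 'a) vcat \<Rightarrow> ('j \<Rightarrow> 'x) \<Rightarrow> ('j \<Rightarrow> 'j \<Rightarrow> 'a) \<Rightarrow> bool" where
  "subcategory_of_arities V C J jo ja \<longleftrightarrow>
     vcategory V J \<and> vfunctor V J C jo ja \<and> vfully_faithful V J ja \<and> vdense V C J jo ja"

definition bounded_arities ::
  "'u set \<Rightarrow> ('o, 'a) smc \<Rightarrow> 'a set \<Rightarrow> ('x, 'o, 'a) vcat \<Rightarrow> ('x \<times> 'x \<times> 'a) set \<Rightarrow>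
   ('x \<times> 'x \<times> 'a) set \<Rightarrow> ('j, 'o, 'a) vcat \<Rightarrow> ('j \<Rightarrow> 'x) \<Rightarrow> bool" where
  "bounded_arities U V E C EC MC J jo \<longleftrightarrow> small U (VObj J) \<and>
     (\<exists>\<alpha>. regular_cardinal U \<alpha> \<and> (\<forall>x \<in> VObj J. bounded_object U \<alpha> V E C EC MC (jo x)))"

end

theory Submission
  imports Defs
begin

text \<open>
  Every object \<open>X\<close> of a locally bounded \<open>V\<close>-category \<open>C\<close> is \<open>\<beta>\<close>-bounded for all sufficiently large
  regular cardinals \<open>\<beta>\<close>. Besides the cardinals of boundedness of \<open>V\<close> and \<open>C\<close>, it is enough that \<open>\<beta>\<close>
  exceed the number of arrows from the generator of \<open>V\<close> to the objects \<open>C(H,X)\<close>, where \<open>H\<close> runs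
  through the generator of \<open>C\<close>. For a small set of objects \<open>X\<close> these numbers are bounded by one
  small cardinal, so that a single \<open>\<beta>\<close> serves all of them.

  Let \<open>\<G>\<close> and \<open>\<H>\<close> be the generators of \<open>V\<close> and \<open>C\<close>, and let \<open>m i : D i \<rightarrow> Y\<close> be a \<open>\<beta>\<close>-filtered
  cocone of \<open>MC\<close>-arrows in \<open>C\<close> whose induced arrow is in \<open>EC\<close>. It is to be shown that the arrow
  \<open>colim C(X, D i) \<rightarrow> C(X,Y)\<close> lies in \<open>E\<close>. As the \<open>M\<close>-arrows of \<open>V\<close> are monic, \<open>u t \<in> E\<close>
  implies \<open>u \<in> E\<close>, and it suffices (\<open>left_class_if_generator_lifts\<close>) that each arrow
  \<open>g : G \<rightarrow> C(X,Y)\<close> with \<open>G \<in> \<G>\<close> factors through one of the arrows \<open>C(X, m i)\<close>.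

  Take \<open>H \<in> \<H>\<close>, \<open>G' \<in> \<G>\<close> and \<open>p : G' \<rightarrow> C(H,X)\<close>. Composition turns \<open>g\<close> and \<open>p\<close> into an arrow
  \<open>G \<otimes> G' \<rightarrow> C(H,Y)\<close>. Since \<open>H\<close> is bounded, \<open>colim C(H, D i) \<rightarrow> C(H,Y)\<close> lies in \<open>E\<close>; since
  \<open>G \<otimes> G'\<close> is bounded in \<open>V\<^sub>0\<close>, the arrow factors through some \<open>C(H, m i)\<close>
  (\<open>bounded_object_factor\<close>). There are fewer than \<open>\<beta>\<close> triples \<open>(H, G', p)\<close>, so a single index \<open>k\<close>
  works for all of them (\<open>filtered_upper_bound\<close>). From here on orthogonality does the rest. As the
  arrows \<open>p\<close> jointly form an \<open>E\<close>-arrow onto \<open>C(H,X)\<close>, the whole arrow \<open>G \<otimes> C(H,X) \<rightarrow> C(H,Y)\<close> given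
  by \<open>g\<close> factors through the \<open>M\<close>-arrow \<open>C(H, m k)\<close>
  (\<open>tensor_factors_through_if_generator_factors\<close>). As the tensors \<open>C(H,X) \<otimes> H\<close> jointly form an
  \<open>EC\<close>-arrow onto \<open>X\<close>, these factorizations for all \<open>H\<close> give one of \<open>g\<close> through \<open>C(X, m k)\<close>
  (\<open>factors_through_HomR_if_generator_factors\<close>).
\<close>

section \<open>Arrows in a category\<close>

context category
begin

lemma Comp_simps:
  assumes "f \<in> Arr C" "g \<in> Arr C" "Cod C f = Dom C g"
  shows "g \<cdot> f \<in> Arr C" "Dom C (g \<cdot> f) = Dom C f" "Cod C (g \<cdot> f) = Cod C g"
  using Comp_in_hom[of f "Dom C f" "Cod C f" g "Cod C g"] assms by (auto simp: hom_def)

lemma Id_simps: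
  assumes "A \<in> Obj C"
  shows "Id C A \<in> Arr C" "Dom C (Id C A) = A" "Cod C (Id C A) = A"
  using Id_in_hom[OF assms] by (auto simp: hom_def)

lemma Comp_assoc_Arr:
  assumes "f \<in> Arr C" "g \<in> Arr C" "h \<in> Arr C" "Cod C f = Dom C g" "Cod C g = Dom C h"
  shows "(h \<cdot> g) \<cdot> f = h \<cdot> (g \<cdot> f)"
  by (rule Comp_assoc) (use assms in \<open>auto simp: hom_def\<close>)

text \<open>
  Typing an arrow by its membership in \<open>Arr\<close> and its domain and codomain, rather than by a hom-set,
  lets the simplifier check composability without having to guess the object in the middle.
\<close>

lemmas arr_simps = hom_def Comp_simps Id_simps Dom_in_Obj Cod_in_Obj

lemma homD:
  assumes "f \<in> hom C A B"
  shows "f \<in> Arr C" "Dom C f = A" "Cod C f = B"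
  using assms by (auto simp: hom_def)

lemma hom_Obj: "f \<in> hom C A B \<Longrightarrow> A \<in> Obj C" "f \<in> hom C A B \<Longrightarrow> B \<in> Obj C"
  using Dom_in_Obj Cod_in_Obj by (auto simp: hom_def)

lemma inverse_arrows_unique:
  assumes "inverse_arrows C f g" "inverse_arrows C f h"
  shows "g = h"
proof -
  have *: "f \<in> hom C (Dom C f) (Cod C f)" "g \<in> hom C (Cod C f) (Dom C f)"
    "h \<in> hom C (Cod C f) (Dom C f)"
    using assms by (auto simp: inverse_arrows_def hom_def)
  have "g = (h \<cdot> f) \<cdot> g"
    using assms * Id_Comp by (simp add: inverse_arrows_def)
  also have "\<dots> = h \<cdot> (f \<cdot> g)"
    by (rule Comp_assoc[OF *(2,1,3)])
  also have "\<dots> = h"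
    using assms * Comp_Id by (simp add: inverse_arrows_def)
  finally show ?thesis .
qed

lemma inv_arr:
  assumes "iso C f" "f \<in> hom C A B"
  shows "inv_arr C f \<in> hom C B A" "inv_arr C f \<cdot> f = Id C A" "f \<cdot> inv_arr C f = Id C B"
proof -
  obtain g where g: "inverse_arrows C f g"
    using assms(1) by (auto simp: iso_def)
  have "inv_arr C f = g"
    unfolding inv_arr_def by (rule the_equality, rule g, rule inverse_arrows_unique[OF _ g])
  then show "inv_arr C f \<in> hom C B A" "inv_arr C f \<cdot> f = Id C A" "f \<cdot> inv_arr C f = Id C B"
    using g assms(2) by (simp_all add: inverse_arrows_def hom_def)
qed

lemma iso_cancel_left:
  assumes "iso C f" "f \<in> hom C A B" "x \<in> hom C W A" "y \<in> hom C W A" "f \<cdot> x = f \<cdot> y"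
  shows "x = y"
proof -
  note i = inv_arr[OF assms(1,2)]
  have "x = inv_arr C f \<cdot> (f \<cdot> x)"
    using Comp_assoc[OF assms(3,2) i(1)] i(2) Id_Comp[OF assms(3)] by simp
  also have "\<dots> = y"
    using Comp_assoc[OF assms(4,2) i(1)] i(2) Id_Comp[OF assms(4)] assms(5) by simp
  finally show ?thesis .
qed

lemma iso_cancel_right:
  assumes "iso C f" "f \<in> hom C A B" "x \<in> hom C B W" "y \<in> hom C B W" "x \<cdot> f = y \<cdot> f"
  shows "x = y"
proof -
  note i = inv_arr[OF assms(1,2)]
  have "x = (x \<cdot> f) \<cdot> inv_arr C f"
    using Comp_assoc[OF i(1) assms(2,3)] i(3) Comp_Id[OF assms(3)] by simp
  also have "\<dots> = y"
    using Comp_assoc[OF i(1) assms(2,4)] i(3) Comp_Id[OF assms(4)] assms(5) by simp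
  finally show ?thesis .
qed

end

section \<open>Coherence for the unit\<close>

context sym_monoidal_closed
begin

lemma TensA_simps:
  assumes "f \<in> Arr V" "g \<in> Arr V"
  shows "f \<odot> g \<in> Arr V" "Dom V (f \<odot> g) = Dom V f \<otimes> Dom V g" "Cod V (f \<odot> g) = Cod V f \<otimes> Cod V g"
  using TensA_in_hom[of f "Dom V f" "Cod V f" g "Dom V g" "Cod V g"] assms by (auto simp: hom_def)

lemmas lunit_inv = inv_arr[OF LUnit_iso LUnit_in_hom]
lemmas runit_inv = inv_arr[OF RUnit_iso RUnit_in_hom]
lemmas assoc_inv = inv_arr[OF Assoc_iso Assoc_in_hom]

lemmas V_simps = arr_simps TensA_simps Tens_in_Obj Unit_in_Obj IHom_in_Obj
  homD[OF Assoc_in_hom] homD[OF LUnit_in_hom] homD[OF RUnit_in_hom] homD[OF Sym_in_hom]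
  homD[OF Ev_in_hom] homD[OF lunit_inv(1)] homD[OF runit_inv(1)]

abbreviation lunit_inv :: "'o \<Rightarrow> 'a" where
  "lunit_inv A \<equiv> inv_arr V (LUnit V A)"

abbreviation runit_inv :: "'o \<Rightarrow> 'a" where
  "runit_inv A \<equiv> inv_arr V (RUnit V A)"

lemma tens_split:
  assumes "f \<in> hom V A B" "g \<in> hom V X Y"
  shows "f \<odot> g = (f \<odot> Id V Y) \<cdot> (Id V A \<odot> g)" "f \<odot> g = (Id V B \<odot> g) \<cdot> (f \<odot> Id V X)"
  using TensA_Comp[OF Id_in_hom assms(1) assms(2) Id_in_hom]
    TensA_Comp[OF assms(1) Id_in_hom Id_in_hom assms(2)] hom_Obj[OF assms(1)] hom_Obj[OF assms(2)]
    Comp_Id[OF assms(1)] Comp_Id[OF assms(2)] Id_Comp[OF assms(1)] Id_Comp[OF assms(2)]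
  by simp_all

lemma tens_left_Comp:
  assumes "f \<in> hom V A B" "f' \<in> hom V B D" "X \<in> Obj V"
  shows "(f' \<cdot> f) \<odot> Id V X = (f' \<odot> Id V X) \<cdot> (f \<odot> Id V X)"
  using TensA_Comp[OF assms(1,2) Id_in_hom[OF assms(3)] Id_in_hom[OF assms(3)]] 
    Id_Comp[OF Id_in_hom[OF assms(3)]] by simp

lemma tens_right_Comp:
  assumes "f \<in> hom V A B" "f' \<in> hom V B D" "X \<in> Obj V"
  shows "Id V X \<odot> (f' \<cdot> f) = (Id V X \<odot> f') \<cdot> (Id V X \<odot> f)"
  using TensA_Comp[OF Id_in_hom[OF assms(3)] Id_in_hom[OF assms(3)] assms(1,2)] 
    Id_Comp[OF Id_in_hom[OF assms(3)]] by simp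

text \<open>
  The underlying composition, and with it the functors \<open>C(A,-)\<close> and \<open>C(-,X)\<close>, insert an inverse unitor
  and then compose; these naturality laws move the inserted unitor past an argument.
\<close>

lemma lunit_inv_natural:
  assumes f: "f \<in> hom V A B"
  shows "lunit_inv B \<cdot> f = (Id V (Unit V) \<odot> f) \<cdot> lunit_inv A"
proof -
  have AB: "A \<in> Obj V" "B \<in> Obj V" using hom_Obj[OF f] by auto
  have "LUnit V B \<cdot> ((Id V (Unit V) \<odot> f) \<cdot> lunit_inv A) = (LUnit V B \<cdot> (Id V (Unit V) \<odot> f))
      \<cdot> lunit_inv A"
    by (rule Comp_assoc_Arr[symmetric]) (use f AB in \<open>simp_all add: V_simps\<close>)
  also have "\<dots> = (f \<cdot> LUnit V A) \<cdot> lunit_inv A"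
    using LUnit_natural[OF f] by simp
  also have "\<dots> = f \<cdot> (LUnit V A \<cdot> lunit_inv A)"
    by (rule Comp_assoc_Arr) (use f AB in \<open>simp_all add: V_simps\<close>)
  also have "\<dots> = (LUnit V B \<cdot> lunit_inv B) \<cdot> f"
    using AB lunit_inv Comp_Id[OF f] Id_Comp[OF f] by simp
  also have "\<dots> = LUnit V B \<cdot> (lunit_inv B \<cdot> f)"
    by (rule Comp_assoc_Arr) (use f AB in \<open>simp_all add: V_simps\<close>)
  finally show ?thesis
    using AB f
    by - (rule iso_cancel_left[OF LUnit_iso[OF AB(2)] LUnit_in_hom[OF AB(2)], of _ A, symmetric],
      simp_all add: V_simps)
qed

lemma runit_inv_natural:
  assumes f: "f \<in> hom V A B"
  shows "runit_inv B \<cdot> f = (f \<odot> Id V (Unit V)) \<cdot> runit_inv A"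
proof -
  have AB: "A \<in> Obj V" "B \<in> Obj V" using hom_Obj[OF f] by auto
  have "RUnit V B \<cdot> ((f \<odot> Id V (Unit V)) \<cdot> runit_inv A) = (RUnit V B \<cdot> (f \<odot> Id V (Unit V)))
      \<cdot> runit_inv A"
    by (rule Comp_assoc_Arr[symmetric]) (use f AB in \<open>simp_all add: V_simps\<close>)
  also have "\<dots> = (f \<cdot> RUnit V A) \<cdot> runit_inv A"
    using RUnit_natural[OF f] by simp
  also have "\<dots> = f \<cdot> (RUnit V A \<cdot> runit_inv A)"
    by (rule Comp_assoc_Arr) (use f AB in \<open>simp_all add: V_simps\<close>)
  also have "\<dots> = (RUnit V B \<cdot> runit_inv B) \<cdot> f"
    using AB runit_inv Comp_Id[OF f] Id_Comp[OF f] by simp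
  also have "\<dots> = RUnit V B \<cdot> (runit_inv B \<cdot> f)"
    by (rule Comp_assoc_Arr) (use f AB in \<open>simp_all add: V_simps\<close>)
  finally show ?thesis
    using AB f
    by - (rule iso_cancel_left[OF RUnit_iso[OF AB(2)] RUnit_in_hom[OF AB(2)], of _ A, symmetric],
      simp_all add: V_simps)
qed

lemma Id_Unit_tens_inj:
  assumes f: "f \<in> hom V A B" and g: "g \<in> hom V A B"
    and eq: "Id V (Unit V) \<odot> f = Id V (Unit V) \<odot> g"
  shows "f = g"
  by (rule iso_cancel_right[OF LUnit_iso LUnit_in_hom f g])
    (use LUnit_natural[OF f] LUnit_natural[OF g] eq hom_Obj[OF f] in auto)

text \<open>
  Kelly's observation that the left unitor of a tensor product is determined by the pentagon and
  triangle axioms. Tensoring with \<open>I\<close> is faithful, so it suffices to compare the two sides after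
  applying \<open>I \<otimes> -\<close>; there both are obtained from the pentagon for \<open>(I, I, A, B)\<close> by collapsing units
  with the triangle.
\<close>

lemma LUnit_tens:
  assumes A: "A \<in> Obj V" and B: "B \<in> Obj V"
  shows "LUnit V (A \<otimes> B) \<cdot> Assoc V (Unit V) A B = LUnit V A \<odot> Id V B"
proof -
  let ?I = "Unit V"
  let ?i = "Id V ?I"
  note Os = A B Unit_in_Obj Tens_in_Obj
  let ?a = "Assoc V ?I (?I \<otimes> A) B" and ?b = "Assoc V ?I ?I A"
  let ?c = "?a \<cdot> (?b \<odot> Id V B)"
  let ?l = "LUnit V (A \<otimes> B) \<cdot> Assoc V ?I A B"
  have "(?i \<odot> ?l) \<cdot> ?c = ((?i \<odot> LUnit V (A \<otimes> B)) \<cdot> (?i \<odot> Assoc V ?I A B)) \<cdot> ?c"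
    by (subst tens_right_Comp) (simp_all add: V_simps Os)
  also have "\<dots> = (?i \<odot> LUnit V (A \<otimes> B)) \<cdot> ((?i \<odot> Assoc V ?I A B) \<cdot> ?c)"
    by (rule Comp_assoc_Arr) (simp_all add: V_simps Os)
  also have "\<dots> = (?i \<odot> LUnit V (A \<otimes> B)) \<cdot> (Assoc V ?I ?I (A \<otimes> B) \<cdot> Assoc V (?I \<otimes> ?I) A B)"
    using pentagon[of ?I ?I A B] Os by simp
  also have "\<dots> = ((?i \<odot> LUnit V (A \<otimes> B)) \<cdot> Assoc V ?I ?I (A \<otimes> B)) \<cdot> Assoc V (?I \<otimes> ?I) A B"
    by (rule Comp_assoc_Arr[symmetric]) (simp_all add: V_simps Os)
  also have "\<dots> = (RUnit V ?I \<odot> (Id V A \<odot> Id V B)) \<cdot> Assoc V (?I \<otimes> ?I) A B"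
    using triangle[of ?I "A \<otimes> B"] Os TensA_Id[OF A B] by simp
  also have "\<dots> = Assoc V ?I A B \<cdot> ((RUnit V ?I \<odot> Id V A) \<odot> Id V B)"
    by (rule Assoc_natural[symmetric]) (simp_all add: V_simps Os)
  also have "\<dots> = Assoc V ?I A B \<cdot> (((?i \<odot> LUnit V A) \<cdot> ?b) \<odot> Id V B)"
    using triangle[of ?I A] Os by simp
  also have "\<dots> = Assoc V ?I A B \<cdot> (((?i \<odot> LUnit V A) \<odot> Id V B) \<cdot> (?b \<odot> Id V B))"
    by (subst tens_left_Comp) (simp_all add: V_simps Os)
  also have "\<dots> = (Assoc V ?I A B \<cdot> ((?i \<odot> LUnit V A) \<odot> Id V B)) \<cdot> (?b \<odot> Id V B)"
    by (rule Comp_assoc_Arr[symmetric]) (simp_all add: V_simps Os)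
  also have "\<dots> = ((?i \<odot> (LUnit V A \<odot> Id V B)) \<cdot> ?a) \<cdot> (?b \<odot> Id V B)"
    by (subst Assoc_natural[of _ ?I ?I _ "?I \<otimes> A" A _ B B]) (simp_all add: V_simps Os)
  also have "\<dots> = (?i \<odot> (LUnit V A \<odot> Id V B)) \<cdot> ?c"
    by (rule Comp_assoc_Arr) (simp_all add: V_simps Os)
  finally have eq: "(?i \<odot> ?l) \<cdot> ?c = (?i \<odot> (LUnit V A \<odot> Id V B)) \<cdot> ?c" .
  let ?b' = "inv_arr V ?b"
  have b': "?b' \<in> Arr V" "Dom V ?b' = ?I \<otimes> (?I \<otimes> A)" "Cod V ?b' = (?I \<otimes> ?I) \<otimes> A"
      "?b \<cdot> ?b' = Id V (?I \<otimes> (?I \<otimes> A))"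
    using assoc_inv[of ?I ?I A] Os by (auto simp: hom_def)
  have c: "?c \<cdot> (?b' \<odot> Id V B) = ?a"
  proof -
    have "?c \<cdot> (?b' \<odot> Id V B) = ?a \<cdot> ((?b \<odot> Id V B) \<cdot> (?b' \<odot> Id V B))"
      by (rule Comp_assoc_Arr) (simp_all add: V_simps Os b')
    also have "\<dots> = ?a"
      by (subst tens_left_Comp[symmetric, of _ "?I \<otimes> (?I \<otimes> A)" "(?I \<otimes> ?I) \<otimes> A" _ "?I \<otimes> (?I \<otimes> A)"])
        (simp_all add: V_simps Os b' TensA_Id
            Comp_Id[of ?a "(?I \<otimes> (?I \<otimes> A)) \<otimes> B" "?I \<otimes> ((?I \<otimes> A) \<otimes> B)"])
    finally show ?thesis .
  qed
  have "(?i \<odot> ?l) \<cdot> ?a = (?i \<odot> (LUnit V A \<odot> Id V B)) \<cdot> ?a"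
    using arg_cong[OF eq, of "\<lambda>x. x \<cdot> (?b' \<odot> Id V B)"] c
      by (simp add: V_simps Os b' Comp_assoc_Arr)
  then have "?i \<odot> ?l = ?i \<odot> (LUnit V A \<odot> Id V B)"
    by - (rule iso_cancel_right[OF Assoc_iso Assoc_in_hom, of ?I "?I \<otimes> A" B _ "?I \<otimes> (A \<otimes> B)"],
      simp_all add: V_simps Os)
  then show ?thesis
    by - (rule Id_Unit_tens_inj, simp_all add: V_simps Os)
qed

lemma Assoc_lunit_inv:
  assumes A: "A \<in> Obj V" and B: "B \<in> Obj V"
  shows "Assoc V (Unit V) A B \<cdot> (lunit_inv A \<odot> Id V B) = lunit_inv (A \<otimes> B)"
proof (rule iso_cancel_left[OF LUnit_iso LUnit_in_hom, of "A \<otimes> B" _ "A \<otimes> B"])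
  have "LUnit V (A \<otimes> B) \<cdot> (Assoc V (Unit V) A B \<cdot> (lunit_inv A \<odot> Id V B))
    = (LUnit V (A \<otimes> B) \<cdot> Assoc V (Unit V) A B) \<cdot> (lunit_inv A \<odot> Id V B)"
    by (rule Comp_assoc_Arr[symmetric]) (use A B in \<open>simp_all add: V_simps\<close>)
  also have "\<dots> = (LUnit V A \<cdot> lunit_inv A) \<odot> Id V B"
    unfolding LUnit_tens[OF A B]
    by (rule tens_left_Comp[OF lunit_inv(1)[OF A A] LUnit_in_hom[OF A] B, symmetric])
  also have "\<dots> = LUnit V (A \<otimes> B) \<cdot> lunit_inv (A \<otimes> B)"
    using lunit_inv(3) A B Tens_in_Obj TensA_Id by simp
  finally show "LUnit V (A \<otimes> B) \<cdot> (Assoc V (Unit V) A B \<cdot> (lunit_inv A \<odot> Id V B))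
    = LUnit V (A \<otimes> B) \<cdot> lunit_inv (A \<otimes> B)" .
qed (use A B in \<open>simp_all add: V_simps\<close>)

text \<open>
  The triangle axiom read for the inverse unitors. Together with the preceding law it makes
  \<open>C(A,m)\<close> and \<open>C(f,X)\<close> associate with the composition of \<open>C\<close>.
\<close>

lemma Assoc_runit_inv:
  assumes A: "A \<in> Obj V" and B: "B \<in> Obj V"
  shows "Assoc V A (Unit V) B \<cdot> (runit_inv A \<odot> Id V B) = Id V A \<odot> lunit_inv B"
proof -
  let ?x = "Assoc V A (Unit V) B \<cdot> (runit_inv A \<odot> Id V B)"
  have x: "?x \<in> hom V (A \<otimes> B) (A \<otimes> (Unit V \<otimes> B))"
    using A B by (simp add: V_simps)
  have "(Id V A \<odot> LUnit V B) \<cdot> ?x = ((Id V A \<odot> LUnit V B) \<cdot> Assoc V A (Unit V) B) \<cdot>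
      (runit_inv A \<odot> Id V B)"
    by (rule Comp_assoc_Arr[symmetric]) (use A B in \<open>simp_all add: V_simps\<close>)
  also have "\<dots> = (RUnit V A \<cdot> runit_inv A) \<odot> Id V B"
    unfolding triangle[OF A B]
    by (rule tens_left_Comp[OF runit_inv(1)[OF A A] RUnit_in_hom[OF A] B, symmetric])
  also have "\<dots> = Id V (A \<otimes> B)"
    using runit_inv(3) A B TensA_Id by simp
  finally have 1: "(Id V A \<odot> LUnit V B) \<cdot> ?x = Id V (A \<otimes> B)" .
  have 2: "(Id V A \<odot> lunit_inv B) \<cdot> (Id V A \<odot> LUnit V B) = Id V (A \<otimes> (Unit V \<otimes> B))"
    using tens_right_Comp[OF LUnit_in_hom[OF B] lunit_inv(1)[OF B B] A]
      lunit_inv(2)[OF B B] TensA_Id[OF A, of "Unit V \<otimes> B"] Tens_in_Obj[OF Unit_in_Obj B] by simp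
  have "?x = ((Id V A \<odot> lunit_inv B) \<cdot> (Id V A \<odot> LUnit V B)) \<cdot> ?x"
    unfolding 2 using Id_Comp[OF x] by simp
  also have "\<dots> = (Id V A \<odot> lunit_inv B) \<cdot> ((Id V A \<odot> LUnit V B) \<cdot> ?x)"
    by (rule Comp_assoc_Arr) (use A B x in \<open>simp_all add: V_simps\<close>)
  also have "\<dots> = Id V A \<odot> lunit_inv B"
    unfolding 1 by (rule Comp_Id) (use A B in \<open>auto simp: V_simps\<close>)
  finally show ?thesis .
qed

section \<open>Transposition along the closed structure\<close>

lemma transpose:
  assumes f: "f \<in> hom V (W \<otimes> A) B" and "W \<in> Obj V" "A \<in> Obj V"
  shows "transpose V W A B f \<in> hom V W (IHom V A B)"
    and "Ev V A B \<cdot> (transpose V W A B f \<odot> Id V A) = f"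
  using theI'[OF Ev_universal[OF assms(2,3) hom_Obj(2)[OF f] f]] unfolding transpose_def by auto

lemma Ev_cancel:
  assumes "g \<in> hom V W (IHom V A B)" "h \<in> hom V W (IHom V A B)" "A \<in> Obj V" "B \<in> Obj V"
    and "Ev V A B \<cdot> (g \<odot> Id V A) = Ev V A B \<cdot> (h \<odot> Id V A)"
  shows "g = h"
proof -
  have "W \<in> Obj V" using hom_Obj[OF assms(1)] by auto
  moreover have "Ev V A B \<cdot> (h \<odot> Id V A) \<in> hom V (W \<otimes> A) B"
    using assms by (simp add: V_simps)
  ultimately show ?thesis
    using Ev_universal[of W A B "Ev V A B \<cdot> (h \<odot> Id V A)"] assms by blast
qed

text \<open>
  Under transposition \<open>[e,X]\<close> becomes precomposition with \<open>e\<close>, and \<open>[A,n]\<close> below becomes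
  postcomposition with \<open>n\<close>. Arrows into internal homs are only ever compared through their transposes.
\<close>

lemma Ev_HomL:
  assumes e: "e \<in> hom V A B" and w: "w \<in> hom V W (IHom V B X)" and X: "X \<in> Obj V"
  shows "HomL (self_enriched V) e X \<in> hom V (IHom V B X) (IHom V A X)"
    and "Ev V A X \<cdot> ((HomL (self_enriched V) e X \<cdot> w) \<odot> Id V A) = Ev V B X \<cdot> (w \<odot> e)"
proof -
  have O: "A \<in> Obj V" "B \<in> Obj V" "W \<in> Obj V" "IHom V B X \<in> Obj V"
    using hom_Obj[OF e] hom_Obj[OF w] by auto
  let ?t = "Ev V B X \<cdot> (Id V (IHom V B X) \<odot> e)" and ?h = "HomL (self_enriched V) e X"
  have h: "?h = transpose V (IHom V B X) A X ?t"
    using e by (simp add: self_enriched_def hom_def)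
  have t: "?t \<in> hom V (IHom V B X \<otimes> A) X"
    using O X e by (simp add: V_simps)
  show hh: "?h \<in> hom V (IHom V B X) (IHom V A X)"
    unfolding h by (rule transpose(1)[OF t O(4,1)])
  have "Ev V A X \<cdot> ((?h \<cdot> w) \<odot> Id V A) = Ev V A X \<cdot> ((?h \<odot> Id V A) \<cdot> (w \<odot> Id V A))"
    by (subst tens_left_Comp[OF w hh O(1)]) simp
  also have "\<dots> = (Ev V A X \<cdot> (?h \<odot> Id V A)) \<cdot> (w \<odot> Id V A)"
    by (rule Comp_assoc_Arr[symmetric]) (use O X hh w in \<open>simp_all add: V_simps\<close>)
  also have "\<dots> = ?t \<cdot> (w \<odot> Id V A)"
    unfolding h by (simp add: transpose(2)[OF t O(4,1)])
  also have "\<dots> = Ev V B X \<cdot> ((Id V (IHom V B X) \<odot> e) \<cdot> (w \<odot> Id V A))"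
    by (rule Comp_assoc_Arr) (use O X e w in \<open>simp_all add: V_simps\<close>)
  also have "\<dots> = Ev V B X \<cdot> (w \<odot> e)"
    using tens_split(2)[OF w e] by simp
  finally show "Ev V A X \<cdot> ((?h \<cdot> w) \<odot> Id V A) = Ev V B X \<cdot> (w \<odot> e)" .
qed

lemma Ev_HomR:
  assumes n: "n \<in> hom V X Y" and w: "w \<in> hom V W (IHom V A X)" and A: "A \<in> Obj V"
  shows "HomR (self_enriched V) A n \<in> hom V (IHom V A X) (IHom V A Y)"
    and "Ev V A Y \<cdot> ((HomR (self_enriched V) A n \<cdot> w) \<odot> Id V A) = n \<cdot> (Ev V A X \<cdot> (w \<odot> Id V A))"
proof -
  have O: "X \<in> Obj V" "Y \<in> Obj V" "W \<in> Obj V" "IHom V A X \<in> Obj V"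
    using hom_Obj[OF n] hom_Obj[OF w] by auto
  let ?t = "n \<cdot> Ev V A X" and ?h = "HomR (self_enriched V) A n"
  have h: "?h = transpose V (IHom V A X) A Y ?t"
    using n by (simp add: self_enriched_def hom_def)
  have t: "?t \<in> hom V (IHom V A X \<otimes> A) Y"
    using O A n by (simp add: V_simps)
  show hh: "?h \<in> hom V (IHom V A X) (IHom V A Y)"
    unfolding h by (rule transpose(1)[OF t O(4) A])
  have "Ev V A Y \<cdot> ((?h \<cdot> w) \<odot> Id V A) = Ev V A Y \<cdot> ((?h \<odot> Id V A) \<cdot> (w \<odot> Id V A))"
    by (subst tens_left_Comp[OF w hh A]) simp
  also have "\<dots> = (Ev V A Y \<cdot> (?h \<odot> Id V A)) \<cdot> (w \<odot> Id V A)"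
    by (rule Comp_assoc_Arr[symmetric]) (use O A hh w in \<open>simp_all add: V_simps\<close>)
  also have "\<dots> = ?t \<cdot> (w \<odot> Id V A)"
    unfolding h by (simp add: transpose(2)[OF t O(4) A])
  also have "\<dots> = n \<cdot> (Ev V A X \<cdot> (w \<odot> Id V A))"
    by (rule Comp_assoc_Arr) (use O A n w in \<open>simp_all add: V_simps\<close>)
  finally show "Ev V A Y \<cdot> ((?h \<cdot> w) \<odot> Id V A) = n \<cdot> (Ev V A X \<cdot> (w \<odot> Id V A))" .
qed

text \<open>
  The pullback property that expresses \<open>V\<close>-orthogonality, probed with arrows out of \<open>W\<close> and
  transposed: \<open>e\<close> stays orthogonal to \<open>n\<close> after tensoring with \<open>W\<close>. Ordinary orthogonality would give
  this for \<open>W = I\<close> only.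
\<close>

lemma enriched_lifting:
  assumes fs: "enriched_factorization_system V (self_enriched V) E M"
    and e: "e \<in> E" "e \<in> hom V A B" and n: "n \<in> M" "n \<in> hom V D Y"
    and x: "x \<in> hom V (W \<otimes> A) D" and y: "y \<in> hom V (W \<otimes> B) Y" and W: "W \<in> Obj V"
    and eq: "n \<cdot> x = y \<cdot> (Id V W \<odot> e)"
  shows "\<exists>u \<in> hom V (W \<otimes> B) D. n \<cdot> u = y"
proof -
  have O: "A \<in> Obj V" "B \<in> Obj V" "D \<in> Obj V" "Y \<in> Obj V"
    using hom_Obj[OF e(2)] hom_Obj[OF n(2)] by auto
  let ?S = "self_enriched V"
  have sel: "Dom ?S = Dom V" "Cod ?S = Cod V" "Arr ?S = Arr V"
    by (simp_all add: self_enriched_def)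
  have "vorthogonal V ?S e n"
    using fs e n by (auto simp: enriched_factorization_system_def sel hom_def)
  then have pb: "is_pullback V (HomL ?S e D) (HomR ?S B n) (HomR ?S A n) (HomL ?S e Y)"
    using e n by (simp add: vorthogonal_def sel hom_def)
  let ?x = "transpose V W A D x" and ?y = "transpose V W B Y y"
  note tx = transpose[OF x W O(1)] and ty = transpose[OF y W O(2)]
  have i: "Id V (IHom V A D) \<in> hom V (IHom V A D) (IHom V A D)"
    "Id V (IHom V B Y) \<in> hom V (IHom V B Y) (IHom V B Y)"
    "Id V (IHom V B D) \<in> hom V (IHom V B D) (IHom V B D)"
    using O by (simp_all add: V_simps)
  have doms: "Dom V (HomR ?S A n) = IHom V A D" "Dom V (HomL ?S e Y) = IHom V B Y"
    "Dom V (HomL ?S e D) = IHom V B D"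
    using Ev_HomR(1)[OF n(2) i(1) O(1)] Ev_HomL(1)[OF e(2) i(2) O(4)]
      Ev_HomL(1)[OF e(2) i(3) O(3)] by (auto simp: hom_def)
  have R: "HomR ?S A n \<cdot> ?x \<in> hom V W (IHom V A Y)" "HomL ?S e Y \<cdot> ?y \<in> hom V W (IHom V A Y)"
    using Comp_in_hom[OF tx(1) Ev_HomR(1)[OF n(2) tx(1) O(1)]]
      Comp_in_hom[OF ty(1) Ev_HomL(1)[OF e(2) ty(1) O(4)]] by auto
  have "HomR ?S A n \<cdot> ?x = HomL ?S e Y \<cdot> ?y"
  proof (rule Ev_cancel[OF R O(1,4)])
    have "Ev V A Y \<cdot> ((HomL ?S e Y \<cdot> ?y) \<odot> Id V A) = Ev V B Y \<cdot> (?y \<odot> e)"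
      by (rule Ev_HomL(2)[OF e(2) ty(1) O(4)])
    also have "\<dots> = Ev V B Y \<cdot> ((?y \<odot> Id V B) \<cdot> (Id V W \<odot> e))"
      using tens_split(1)[OF ty(1) e(2)] by simp
    also have "\<dots> = (Ev V B Y \<cdot> (?y \<odot> Id V B)) \<cdot> (Id V W \<odot> e)"
      by (rule Comp_assoc_Arr[symmetric]) (use O W e ty(1) in \<open>simp_all add: V_simps\<close>)
    also have "\<dots> = Ev V A Y \<cdot> ((HomR ?S A n \<cdot> ?x) \<odot> Id V A)"
      using Ev_HomR(2)[OF n(2) tx(1) O(1)] by (simp add: eq tx(2) ty(2))
    finally show "Ev V A Y \<cdot> ((HomR ?S A n \<cdot> ?x) \<odot> Id V A) = Ev V A Y \<cdot>
        ((HomL ?S e Y \<cdot> ?y) \<odot> Id V A)"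
      by simp
  qed
  then obtain u where u: "u \<in> hom V W (IHom V B D)" "HomR ?S B n \<cdot> u = ?y"
    using pb tx(1) ty(1) unfolding is_pullback_def doms by blast
  have "n \<cdot> (Ev V B D \<cdot> (u \<odot> Id V B)) = y"
    using Ev_HomR(2)[OF n(2) u(1) O(2)] ty(2) u(2) by simp
  then show ?thesis
    using u(1) O by (intro bexI[of _ "Ev V B D \<cdot> (u \<odot> Id V B)"]) (simp_all add: V_simps)
qed

text \<open>
  The internal hom transposes the right-hand factor of a tensor product; the symmetry is used to
  transpose the left-hand factor \<open>W\<close> instead, which gives \<open>W \<otimes> -\<close> the right adjoint \<open>[W,-]\<close>.
\<close>

definition lcurry :: "'o \<Rightarrow> 'o \<Rightarrow> 'o \<Rightarrow> 'a \<Rightarrow> 'a" where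
  "lcurry W A Y x = transpose V A W Y (x \<cdot> Sym V A W)"

lemma lcurry:
  assumes x: "x \<in> hom V (W \<otimes> A) Y" and O: "W \<in> Obj V" "A \<in> Obj V"
  shows "lcurry W A Y x \<in> hom V A (IHom V W Y)"
    and "Ev V W Y \<cdot> (lcurry W A Y x \<odot> Id V W) = x \<cdot> Sym V A W"
proof -
  have "x \<cdot> Sym V A W \<in> hom V (A \<otimes> W) Y"
    using x O by (simp add: V_simps)
  note t = transpose[OF this O(2,1)]
  show "lcurry W A Y x \<in> hom V A (IHom V W Y)"
    "Ev V W Y \<cdot> (lcurry W A Y x \<odot> Id V W) = x \<cdot> Sym V A W"
    unfolding lcurry_def by (rule t)+
qed

lemma lcurry_eqI:
  assumes x: "x \<in> hom V (W \<otimes> A) Y" and O: "W \<in> Obj V" "A \<in> Obj V"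
    and z: "z \<in> hom V A (IHom V W Y)" "Ev V W Y \<cdot> (z \<odot> Id V W) = x \<cdot> Sym V A W"
  shows "lcurry W A Y x = z"
  by (rule Ev_cancel[of _ A W Y]) (use lcurry[OF x O] z O hom_Obj(2)[OF x] in auto)

lemma Comp_Sym_cancel:
  assumes "x \<in> hom V (W \<otimes> A) Y" "W \<in> Obj V" "A \<in> Obj V"
  shows "(x \<cdot> Sym V A W) \<cdot> Sym V W A = x"
proof -
  have "(x \<cdot> Sym V A W) \<cdot> Sym V W A = x \<cdot> (Sym V A W \<cdot> Sym V W A)"
    by (rule Comp_assoc_Arr) (use assms in \<open>simp_all add: V_simps\<close>)
  then show ?thesis using Sym_Sym[of W A] Comp_Id[OF assms(1)] assms by simp
qed

lemma lcurry_inj: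
  assumes x: "x \<in> hom V (W \<otimes> A) Y" "y \<in> hom V (W \<otimes> A) Y" and O: "W \<in> Obj V" "A \<in> Obj V"
    and eq: "lcurry W A Y x = lcurry W A Y y"
  shows "x = y"
  using lcurry(2)[OF x(1) O] lcurry(2)[OF x(2) O] eq
    Comp_Sym_cancel[OF x(1) O] Comp_Sym_cancel[OF x(2) O] by simp

lemma lcurry_surj:
  assumes z: "z \<in> hom V A (IHom V W Y)" and O: "W \<in> Obj V" "Y \<in> Obj V"
  shows "\<exists>x \<in> hom V (W \<otimes> A) Y. lcurry W A Y x = z"
proof -
  let ?x = "(Ev V W Y \<cdot> (z \<odot> Id V W)) \<cdot> Sym V W A"
  have A: "A \<in> Obj V" using hom_Obj[OF z] by auto
  have x: "?x \<in> hom V (W \<otimes> A) Y"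
    using z O A by (simp add: V_simps)
  have "Ev V W Y \<cdot> (z \<odot> Id V W) \<in> hom V (A \<otimes> W) Y"
    using z O by (simp add: V_simps)
  then have "lcurry W A Y ?x = z"
    using x O A z by - (rule lcurry_eqI, simp_all add: Comp_Sym_cancel)
  with x show ?thesis by blast
qed

lemma lcurry_Comp:
  assumes x: "x \<in> hom V (W \<otimes> B) Y" and f: "f \<in> hom V A B" and W: "W \<in> Obj V"
  shows "lcurry W A Y (x \<cdot> (Id V W \<odot> f)) = lcurry W B Y x \<cdot> f"
proof (rule lcurry_eqI)
  have O: "A \<in> Obj V" "B \<in> Obj V" "Y \<in> Obj V"
    using hom_Obj[OF x] hom_Obj[OF f] by auto
  note l = lcurry[OF x W O(2)]
  show "x \<cdot> (Id V W \<odot> f) \<in> hom V (W \<otimes> A) Y" "lcurry W B Y x \<cdot> f \<in> hom V A (IHom V W Y)"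
    using x f W O l by (simp_all add: V_simps)
  show "W \<in> Obj V" "A \<in> Obj V" using W O by auto
  have "Ev V W Y \<cdot> ((lcurry W B Y x \<cdot> f) \<odot> Id V W) = Ev V W Y \<cdot>
      ((lcurry W B Y x \<odot> Id V W) \<cdot> (f \<odot> Id V W))"
    using tens_left_Comp[OF f l(1) W] by simp
  also have "\<dots> = (Ev V W Y \<cdot> (lcurry W B Y x \<odot> Id V W)) \<cdot> (f \<odot> Id V W)"
    by (rule Comp_assoc_Arr[symmetric]) (use O W f l(1) in \<open>simp_all add: V_simps\<close>)
  also have "\<dots> = x \<cdot> (Sym V B W \<cdot> (f \<odot> Id V W))"
    unfolding l(2) by (rule Comp_assoc_Arr) (use O W f x in \<open>simp_all add: V_simps\<close>)
  also have "\<dots> = x \<cdot> ((Id V W \<odot> f) \<cdot> Sym V A W)"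
    using Sym_natural[OF f Id_in_hom[OF W]] by simp
  also have "\<dots> = (x \<cdot> (Id V W \<odot> f)) \<cdot> Sym V A W"
    by (rule Comp_assoc_Arr[symmetric]) (use O W f x in \<open>simp_all add: V_simps\<close>)
  finally show "Ev V W Y \<cdot> ((lcurry W B Y x \<cdot> f) \<odot> Id V W) = (x \<cdot> (Id V W \<odot> f)) \<cdot> Sym V A W" .
qed

text \<open>
  \<open>W \<otimes> -\<close> is a left adjoint. Stated for an arbitrary compatible family \<open>x\<close> on the diagram \<open>W \<otimes> D\<close>,
  this is the form in which arrows out of \<open>W \<otimes> colim D\<close> are constructed and compared.
\<close>

lemma tensor_preserves_colimit:
  assumes col: "is_colimit A V Do Da L l"
    and Da: "\<And>f. f \<in> Arr A \<Longrightarrow> Dom A f \<in> Obj A \<and> Cod A f \<in> Obj A \<and> Da f \<in> hom V (Do (Dom A f))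
        (Do (Cod A f))"
    and W: "W \<in> Obj V" and Y: "Y \<in> Obj V"
    and x: "\<And>i. i \<in> Obj A \<Longrightarrow> x i \<in> hom V (W \<otimes> Do i) Y"
    and nat: "\<And>f. f \<in> Arr A \<Longrightarrow> x (Cod A f) \<cdot> (Id V W \<odot> Da f) = x (Dom A f)"
  shows "\<exists>!u. u \<in> hom V (W \<otimes> L) Y \<and> (\<forall>i \<in> Obj A. u \<cdot> (Id V W \<odot> l i) = x i)"
proof -
  have l: "l i \<in> hom V (Do i) L" if "i \<in> Obj A" for i
    using col that by (auto simp: is_colimit_def cocone_def)
  have Do: "Do i \<in> Obj V" if "i \<in> Obj A" for i
    using hom_Obj[OF l[OF that]] by auto
  have L: "L \<in> Obj V" using col by (auto simp: is_colimit_def cocone_def)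
  let ?x = "\<lambda>i. lcurry W (Do i) Y (x i)"
  have iff: "(\<forall>i \<in> Obj A. lcurry W L Y u \<cdot> l i = ?x i) \<longleftrightarrow> (\<forall>i \<in> Obj A. u \<cdot> (Id V W \<odot> l i) = x i)"
    if u: "u \<in> hom V (W \<otimes> L) Y" for u
  proof (rule ball_cong[OF refl])
    fix i assume i: "i \<in> Obj A"
    have "u \<cdot> (Id V W \<odot> l i) \<in> hom V (W \<otimes> Do i) Y"
      using u W l[OF i] by (simp add: V_simps)
    from lcurry_inj[OF this x[OF i] W Do[OF i]]
    show "lcurry W L Y u \<cdot> l i = ?x i \<longleftrightarrow> u \<cdot> (Id V W \<odot> l i) = x i"
      unfolding lcurry_Comp[OF u l[OF i] W, symmetric] by (intro iffI) simp_all
  qed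
  have "cocone A V Do Da (IHom V W Y) ?x"
    unfolding cocone_def
  proof (intro conjI ballI)
    show "IHom V W Y \<in> Obj V" using W Y by (rule IHom_in_Obj)
    show "?x i \<in> hom V (Do i) (IHom V W Y)" if "i \<in> Obj A" for i
      by (rule lcurry(1)[OF x[OF that] W Do[OF that]])
    show "?x (Cod A f) \<cdot> Da f = ?x (Dom A f)" if f: "f \<in> Arr A" for f
      using lcurry_Comp[OF x, of "Cod A f" "Da f" "Do (Dom A f)"] nat[OF f] Da[OF f] W by simp
  qed
  then have ex: "\<exists>!z. z \<in> hom V L (IHom V W Y) \<and> (\<forall>i \<in> Obj A. z \<cdot> l i = ?x i)"
    using col by (simp add: is_colimit_def)
  show ?thesis
  proof (rule ex_ex1I)
    obtain z where z: "z \<in> hom V L (IHom V W Y)" "\<forall>i \<in> Obj A. z \<cdot> l i = ?x i"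
      using ex by blast
    from lcurry_surj[OF z(1) W Y] obtain u where u: "u \<in> hom V (W \<otimes> L) Y" "lcurry W L Y u = z"
      by blast
    show "\<exists>u. u \<in> hom V (W \<otimes> L) Y \<and> (\<forall>i \<in> Obj A. u \<cdot> (Id V W \<odot> l i) = x i)"
      using u(1) iff[OF u(1)] z(2) unfolding u(2) by blast
  next
    show "u = v" if "u \<in> hom V (W \<otimes> L) Y \<and> (\<forall>i \<in> Obj A. u \<cdot> (Id V W \<odot> l i) = x i)"
      "v \<in> hom V (W \<otimes> L) Y \<and> (\<forall>i \<in> Obj A. v \<cdot> (Id V W \<odot> l i) = x i)" for u v
    proof (rule lcurry_inj[OF _ _ W L])
      show "u \<in> hom V (W \<otimes> L) Y" "v \<in> hom V (W \<otimes> L) Y" using that by auto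
      then have "lcurry W L Y u \<in> hom V L (IHom V W Y)" "lcurry W L Y v \<in> hom V L (IHom V W Y)"
        "\<forall>i \<in> Obj A. lcurry W L Y u \<cdot> l i = ?x i" "\<forall>i \<in> Obj A. lcurry W L Y v \<cdot> l i = ?x i"
        using lcurry(1) W L that iff by auto
      with ex show "lcurry W L Y u = lcurry W L Y v" by blast
    qed
  qed
qed

text \<open>
  Boundedness of \<open>C(H,-)\<close> only speaks about conical colimits in \<open>V\<close>, whereas cocompleteness of \<open>V\<^sub>0\<close>
  provides ordinary ones. They agree because cones over \<open>[D -, Y]\<close> with vertex \<open>W\<close> transpose to cocones
  under \<open>W \<otimes> D\<close>, and \<open>W \<otimes> -\<close> preserves the colimit.
\<close>

lemma colimit_is_conical:
  assumes col: "is_colimit A V Do Da L l"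
    and Da: "\<And>f. f \<in> Arr A \<Longrightarrow> Dom A f \<in> Obj A \<and> Cod A f \<in> Obj A \<and> Da f \<in> hom V (Do (Dom A f))
        (Do (Cod A f))"
  shows "is_conical_colimit A V (self_enriched V) Do Da L l"
proof -
  let ?S = "self_enriched V"
  have sel: "Obj ?S = Obj V" "hom ?S = hom V" "Comp ?S = Comp V" "HomO ?S = IHom V"
    by (simp_all add: self_enriched_def hom_def fun_eq_iff)
  have l: "l i \<in> hom V (Do i) L" if "i \<in> Obj A" for i
    using col that by (auto simp: is_colimit_def cocone_def)
  have lnat: "l (Cod A f) \<cdot> Da f = l (Dom A f)" if "f \<in> Arr A" for f
    using col that by (auto simp: is_colimit_def cocone_def)
  have Do: "Do i \<in> Obj V" if "i \<in> Obj A" for i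
    using hom_Obj[OF l[OF that]] by auto
  have L: "L \<in> Obj V" using col by (auto simp: is_colimit_def cocone_def)
  have lim: "is_limit (op_cat A) V (\<lambda>i. IHom V (Do i) Y) (\<lambda>f. HomL ?S (Da f) Y) (IHom V L Y)
      (\<lambda>i. HomL ?S (l i) Y)"
    if Y: "Y \<in> Obj V" for Y
  proof -
    have hL: "HomL ?S (l i) Y \<in> hom V (IHom V L Y) (IHom V (Do i) Y)" if "i \<in> Obj A" for i
      using Ev_HomL(1)[OF l[OF that] Id_in_hom[OF IHom_in_Obj[OF L Y]] Y] .
    have hD: "HomL ?S (Da f) Y \<in> hom V (IHom V (Do (Cod A f)) Y) (IHom V (Do (Dom A f)) Y)"
        if "f \<in> Arr A" for f
      using Ev_HomL(1)[of "Da f" _ _ _ _ Y, OF _ Id_in_hom[OF IHom_in_Obj[OF _ Y]] Y] Da[OF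
          that] Do by blast
    have ev: "Ev V (Do i) Y \<cdot> ((HomL ?S (l i) Y \<cdot> w) \<odot> Id V (Do i)) = (Ev V L Y \<cdot> (w \<odot> Id V L)) \<cdot>
        (Id V W \<odot> l i)"
      if i: "i \<in> Obj A" and w: "w \<in> hom V W (IHom V L Y)" for i w W
    proof -
      have "Ev V (Do i) Y \<cdot> ((HomL ?S (l i) Y \<cdot> w) \<odot> Id V (Do i)) = Ev V L Y \<cdot>
          ((w \<odot> Id V L) \<cdot> (Id V W \<odot> l i))"
        using Ev_HomL(2)[OF l[OF i] w Y] tens_split(1)[OF w l[OF i]] by simp
      also have "\<dots> = (Ev V L Y \<cdot> (w \<odot> Id V L)) \<cdot> (Id V W \<odot> l i)"
        by (rule Comp_assoc_Arr[symmetric])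
            (use L Y w l[OF i] hom_Obj[OF w] in \<open>simp_all add: V_simps\<close>)
      finally show ?thesis .
    qed
    have evD: "Ev V (Do (Dom A f)) Y \<cdot> ((HomL ?S (Da f) Y \<cdot> w) \<odot> Id V (Do (Dom A f)))
         = (Ev V (Do (Cod A f)) Y \<cdot> (w \<odot> Id V (Do (Cod A f)))) \<cdot> (Id V W \<odot> Da f)"
      if f: "f \<in> Arr A" and w: "w \<in> hom V W (IHom V (Do (Cod A f)) Y)" for f w W
    proof -
      have d: "Da f \<in> hom V (Do (Dom A f)) (Do (Cod A f))" using Da[OF f] by simp
      have "Ev V (Do (Dom A f)) Y \<cdot> ((HomL ?S (Da f) Y \<cdot> w) \<odot> Id V (Do (Dom A f)))
        = Ev V (Do (Cod A f)) Y \<cdot> ((w \<odot> Id V (Do (Cod A f))) \<cdot> (Id V W \<odot> Da f))"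
        using Ev_HomL(2)[OF d w Y] tens_split(1)[OF w d] by simp
      also have "\<dots> = (Ev V (Do (Cod A f)) Y \<cdot> (w \<odot> Id V (Do (Cod A f)))) \<cdot> (Id V W \<odot> Da f)"
        by (rule Comp_assoc_Arr[symmetric])
            (use Y w d hom_Obj[OF w] hom_Obj[OF d] in \<open>simp_all add: V_simps\<close>)
      finally show ?thesis .
    qed
    have cone: "cone (op_cat A) V (\<lambda>i. IHom V (Do i) Y) (\<lambda>f. HomL ?S (Da f) Y) (IHom V L Y)
        (\<lambda>i. HomL ?S (l i) Y)"
      unfolding cone_def
    proof (intro conjI ballI)
      show "IHom V L Y \<in> Obj V" using L Y by (rule IHom_in_Obj)
      show "HomL ?S (l i) Y \<in> hom V (IHom V L Y) (IHom V (Do i) Y)" if "i \<in> Obj (op_cat A)" for i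
        using hL that by (simp add: op_cat_def)
      fix f assume "f \<in> Arr (op_cat A)"
      then have f: "f \<in> Arr A" by (simp add: op_cat_def)
      note D = Da[OF f]
      have d: "Da f \<in> hom V (Do (Dom A f)) (Do (Cod A f))" using D by simp
      have w: "HomL ?S (l (Cod A f)) Y \<in> hom V (IHom V L Y) (IHom V (Do (Cod A f)) Y)"
        "HomL ?S (l (Dom A f)) Y \<in> hom V (IHom V L Y) (IHom V (Do (Dom A f)) Y)"
        using hL D by auto
      have idL: "Id V (IHom V L Y) \<in> hom V (IHom V L Y) (IHom V L Y)"
        using L Y by (simp add: V_simps)
      have "HomL ?S (Da f) Y \<cdot> HomL ?S (l (Cod A f)) Y = HomL ?S (l (Dom A f)) Y"
      proof (rule Ev_cancel[OF Comp_in_hom[OF w(1) hD[OF f]] w(2) _ Y])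
        show "Do (Dom A f) \<in> Obj V" using D Do by auto
        have "Ev V (Do (Dom A f)) Y \<cdot>
            ((HomL ?S (Da f) Y \<cdot> HomL ?S (l (Cod A f)) Y) \<odot> Id V (Do (Dom A f)))
           = (Ev V (Do (Cod A f)) Y \<cdot> (HomL ?S (l (Cod A f)) Y \<odot> Id V (Do (Cod A f)))) \<cdot>
               (Id V (IHom V L Y) \<odot> Da f)"
          by (rule evD[OF f w(1)])
        also have "\<dots> = ((Ev V L Y \<cdot> (Id V (IHom V L Y) \<odot> Id V L)) \<cdot>
            (Id V (IHom V L Y) \<odot> l (Cod A f))) \<cdot> (Id V (IHom V L Y) \<odot> Da f)"
          using ev[OF _ idL, of "Cod A f"] Comp_Id[OF w(1)] D by simp
        also have "\<dots> = (Ev V L Y \<cdot> (Id V (IHom V L Y) \<odot> Id V L)) \<cdot>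
            ((Id V (IHom V L Y) \<odot> l (Cod A f)) \<cdot> (Id V (IHom V L Y) \<odot> Da f))"
          by (rule Comp_assoc_Arr) (use L Y d l[of "Cod A f"] D in \<open>simp_all add: V_simps\<close>)
        also have "\<dots> = (Ev V L Y \<cdot> (Id V (IHom V L Y) \<odot> Id V L)) \<cdot>
            (Id V (IHom V L Y) \<odot> l (Dom A f))"
          using tens_right_Comp[OF d l, of "IHom V L Y"] lnat[OF f] IHom_in_Obj[OF L Y] D by simp
        also have "\<dots> = Ev V (Do (Dom A f)) Y \<cdot> (HomL ?S (l (Dom A f)) Y \<odot> Id V (Do (Dom A f)))"
          using ev[OF _ idL, of "Dom A f"] Comp_Id[OF w(2)] D by simp
        finally show "Ev V (Do (Dom A f)) Y \<cdot>
            ((HomL ?S (Da f) Y \<cdot> HomL ?S (l (Cod A f)) Y) \<odot> Id V (Do (Dom A f)))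
          = Ev V (Do (Dom A f)) Y \<cdot> (HomL ?S (l (Dom A f)) Y \<odot> Id V (Do (Dom A f)))" .
      qed
      then show "HomL ?S (Da f) Y \<cdot> HomL ?S (l (Dom (op_cat A) f)) Y = HomL ?S
          (l (Cod (op_cat A) f)) Y"
        by (simp add: op_cat_def)
    qed
    have univ: "\<exists>!u. u \<in> hom V W (IHom V L Y) \<and> (\<forall>i \<in> Obj A. HomL ?S (l i) Y \<cdot> u = x i)"
      if c: "cone (op_cat A) V (\<lambda>i. IHom V (Do i) Y) (\<lambda>f. HomL ?S (Da f) Y) W x" for W x
    proof -
      have W: "W \<in> Obj V" and x: "\<And>i. i \<in> Obj A \<Longrightarrow> x i \<in> hom V W (IHom V (Do i) Y)"
        and nat: "\<And>f. f \<in> Arr A \<Longrightarrow> HomL ?S (Da f) Y \<cdot> x (Cod A f) = x (Dom A f)"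
        using c by (auto simp: cone_def op_cat_def)
      let ?x = "\<lambda>i. Ev V (Do i) Y \<cdot> (x i \<odot> Id V (Do i))"
      have iff: "(\<forall>i \<in> Obj A. HomL ?S (l i) Y \<cdot> u = x i) \<longleftrightarrow>
          (\<forall>i \<in> Obj A. (Ev V L Y \<cdot> (u \<odot> Id V L)) \<cdot> (Id V W \<odot> l i) = ?x i)"
        if u: "u \<in> hom V W (IHom V L Y)" for u
      proof (rule ball_cong[OF refl])
        fix i assume i: "i \<in> Obj A"
        show "HomL ?S (l i) Y \<cdot> u = x i \<longleftrightarrow> (Ev V L Y \<cdot> (u \<odot> Id V L)) \<cdot> (Id V W \<odot> l i) = ?x i"
          unfolding ev[OF i u, symmetric]
            using Ev_cancel[OF Comp_in_hom[OF u hL[OF i]] x[OF i] Do[OF i] Y]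
            by (intro iffI) simp_all
      qed
      have ex: "\<exists>!z. z \<in> hom V (W \<otimes> L) Y \<and> (\<forall>i \<in> Obj A. z \<cdot> (Id V W \<odot> l i) = ?x i)"
      proof (rule tensor_preserves_colimit[OF col Da W Y])
        show "?x i \<in> hom V (W \<otimes> Do i) Y" if "i \<in> Obj A" for i
          using x[OF that] Do[OF that] Y by (simp add: V_simps)
        show "?x (Cod A f) \<cdot> (Id V W \<odot> Da f) = ?x (Dom A f)" if "f \<in> Arr A" for f
          using evD[OF that x] nat[OF that] Da[OF that] by simp
      qed
      show ?thesis
      proof (rule ex_ex1I)
        obtain z where z: "z \<in> hom V (W \<otimes> L) Y" "\<forall>i \<in> Obj A. z \<cdot> (Id V W \<odot> l i) = ?x i"
          using ex by blast
        show "\<exists>u. u \<in> hom V W (IHom V L Y) \<and> (\<forall>i \<in> Obj A. HomL ?S (l i) Y \<cdot> u = x i)"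
          using transpose[OF z(1) W L] z(2) iff by (intro exI[of _ "transpose V W L Y z"]) simp
        show "u = v" if u: "u \<in> hom V W (IHom V L Y) \<and> (\<forall>i \<in> Obj A. HomL ?S (l i) Y \<cdot> u = x i)"
          and v: "v \<in> hom V W (IHom V L Y) \<and> (\<forall>i \<in> Obj A. HomL ?S (l i) Y \<cdot> v = x i)" for u v
        proof (rule Ev_cancel[OF _ _ L Y])
          show uv: "u \<in> hom V W (IHom V L Y)" "v \<in> hom V W (IHom V L Y)" using u v by auto
          then have "Ev V L Y \<cdot> (u \<odot> Id V L) \<in> hom V (W \<otimes> L) Y"
              "Ev V L Y \<cdot> (v \<odot> Id V L) \<in> hom V (W \<otimes> L) Y"
            using L Y by (simp_all add: V_simps)
          then show "Ev V L Y \<cdot> (u \<odot> Id V L) = Ev V L Y \<cdot> (v \<odot> Id V L)"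
            using ex iff[OF uv(1)] iff[OF uv(2)] u v by blast
        qed
      qed
    qed
    show ?thesis
      unfolding is_limit_def using cone univ by (simp add: op_cat_def)
  qed
  have "cocone A ?S Do Da L l"
    using col by (simp add: is_colimit_def cocone_def sel)
  then show ?thesis
    unfolding is_conical_colimit_def sel using lim by blast
qed

end

section \<open>The hom functors of an enriched category\<close>

locale enriched_category = sym_monoidal_closed V + vcategory V C
  for V :: "('o, 'a) smc" (structure) and C :: "('x, 'o, 'a) vcat"
begin

abbreviation C0 :: "('x, 'x \<times> 'x \<times> 'a, 'o, 'a) hcat" where
  "C0 \<equiv> underlying V C"

lemmas C_simps = V_simps VHom_in_Obj homD[OF VComp_in_hom] homD[OF VId_in_hom]

lemma C0_simps:
  "Obj C0 = VObj C" "HomO C0 = VHom C" "Id C0 A = (A, A, VId C A)"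
  by (simp_all add: underlying_def)

lemma C0_hom:
  "f \<in> hom C0 A B \<longleftrightarrow> A \<in> VObj C \<and> B \<in> VObj C \<and> (\<exists>g \<in> hom V (Unit V) (VHom C A B). f = (A, B, g))"
  by (auto simp: underlying_def hom_def)

text \<open>
  With \<open>w\<close> in place of the identity, \<open>C(A,g)\<close> and \<open>C(f,X)\<close> act on generalized elements
  \<open>w : W \<rightarrow> C(A,X)\<close> by composing with \<open>g\<close> or \<open>f\<close> as elements of shape \<open>I\<close>. The associativity laws
  below are stated for such elements, which hides the coherence isomorphisms from their users.
\<close>

lemma HomR_apply:
  assumes g: "g \<in> hom V (Unit V) (VHom C X Y)" and w: "w \<in> hom V W (VHom C A X)"
    and O: "A \<in> VObj C" "X \<in> VObj C" "Y \<in> VObj C"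
  shows "HomR C0 A (X, Y, g) \<cdot> w = VComp C A X Y \<cdot> ((g \<odot> w) \<cdot> lunit_inv W)"
proof -
  let ?c = "VComp C A X Y" and ?i = "Id V (VHom C A X)"
  have W: "W \<in> Obj V" using hom_Obj[OF w] by auto
  have "HomR C0 A (X, Y, g) \<cdot> w = (?c \<cdot> ((g \<odot> ?i) \<cdot> lunit_inv (VHom C A X))) \<cdot> w"
    by (simp add: underlying_def)
  also have "\<dots> = ?c \<cdot> ((g \<odot> ?i) \<cdot> (lunit_inv (VHom C A X) \<cdot> w))"
    using g w O W by (simp add: C_simps Comp_assoc_Arr)
  also have "\<dots> = ?c \<cdot> ((g \<odot> ?i) \<cdot> ((Id V (Unit V) \<odot> w) \<cdot> lunit_inv W))"
    using lunit_inv_natural[OF w] by simp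
  also have "\<dots> = ?c \<cdot> (((g \<odot> ?i) \<cdot> (Id V (Unit V) \<odot> w)) \<cdot> lunit_inv W)"
    using g w O W by (simp add: C_simps Comp_assoc_Arr)
  also have "\<dots> = ?c \<cdot> ((g \<odot> w) \<cdot> lunit_inv W)"
    using tens_split(1)[OF g w] by simp
  finally show ?thesis .
qed

lemma HomL_apply:
  assumes f: "f \<in> hom V (Unit V) (VHom C A B)" and w: "w \<in> hom V W (VHom C B X)"
    and O: "A \<in> VObj C" "B \<in> VObj C" "X \<in> VObj C"
  shows "HomL C0 (A, B, f) X \<cdot> w = VComp C A B X \<cdot> ((w \<odot> f) \<cdot> runit_inv W)"
proof -
  let ?c = "VComp C A B X" and ?i = "Id V (VHom C B X)"
  have W: "W \<in> Obj V" using hom_Obj[OF w] by auto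
  have "HomL C0 (A, B, f) X \<cdot> w = (?c \<cdot> ((?i \<odot> f) \<cdot> runit_inv (VHom C B X))) \<cdot> w"
    by (simp add: underlying_def)
  also have "\<dots> = ?c \<cdot> ((?i \<odot> f) \<cdot> (runit_inv (VHom C B X) \<cdot> w))"
    using f w O W by (simp add: C_simps Comp_assoc_Arr)
  also have "\<dots> = ?c \<cdot> ((?i \<odot> f) \<cdot> ((w \<odot> Id V (Unit V)) \<cdot> runit_inv W))"
    using runit_inv_natural[OF w] by simp
  also have "\<dots> = ?c \<cdot> (((?i \<odot> f) \<cdot> (w \<odot> Id V (Unit V))) \<cdot> runit_inv W)"
    using f w O W by (simp add: C_simps Comp_assoc_Arr)
  also have "\<dots> = ?c \<cdot> ((w \<odot> f) \<cdot> runit_inv W)"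
    using tens_split(2)[OF w f] by simp
  finally show ?thesis .
qed

lemma HomR_in_hom:
  assumes "m \<in> hom C0 X Y" "A \<in> VObj C"
  shows "HomR C0 A m \<in> hom V (VHom C A X) (VHom C A Y)"
  using assms unfolding C0_hom by (auto simp: underlying_def C_simps)

lemma HomL_in_hom:
  assumes "f \<in> hom C0 A B" "X \<in> VObj C"
  shows "HomL C0 f X \<in> hom V (VHom C B X) (VHom C A X)"
  using assms unfolding C0_hom by (auto simp: underlying_def C_simps)

lemma VComp_assoc_elements:
  assumes a: "a \<in> hom V W1 (VHom C D E)" and b: "b \<in> hom V W2 (VHom C B D)"
    and c: "c \<in> hom V W3 (VHom C A B)"
    and O: "A \<in> VObj C" "B \<in> VObj C" "D \<in> VObj C" "E \<in> VObj C"
  shows "VComp C A B E \<cdot> ((VComp C B D E \<cdot> (a \<odot> b)) \<odot> c)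
    = VComp C A D E \<cdot> ((a \<odot> (VComp C A B D \<cdot> (b \<odot> c))) \<cdot> Assoc V W1 W2 W3)"
proof -
  have W: "W1 \<in> Obj V" "W2 \<in> Obj V" "W3 \<in> Obj V"
    using hom_Obj[OF a] hom_Obj[OF b] hom_Obj[OF c] by auto
  let ?DE = "VHom C D E" and ?BD = "VHom C B D" and ?AB = "VHom C A B"
  have h: "VComp C B D E \<in> hom V (?DE \<otimes> ?BD) (VHom C B E)" "a \<odot> b \<in> hom V (W1 \<otimes> W2) (?DE \<otimes> ?BD)"
    "Id V ?AB \<in> hom V ?AB ?AB" "Id V ?DE \<in> hom V ?DE ?DE"
    "VComp C A B D \<in> hom V (?BD \<otimes> ?AB) (VHom C A D)" "b \<odot> c \<in> hom V (W2 \<otimes> W3) (?BD \<otimes> ?AB)"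
    using O a b c by (simp_all add: C_simps)
  have "VComp C A B E \<cdot> ((VComp C B D E \<cdot> (a \<odot> b)) \<odot> c)
    = VComp C A B E \<cdot> ((VComp C B D E \<odot> Id V ?AB) \<cdot> ((a \<odot> b) \<odot> c))"
    using TensA_Comp[OF h(2,1) c h(3)] Id_Comp[OF c] by simp
  also have "\<dots> = (VComp C A B E \<cdot> (VComp C B D E \<odot> Id V ?AB)) \<cdot> ((a \<odot> b) \<odot> c)"
    by (rule Comp_assoc_Arr[symmetric]) (use O a b c W in \<open>simp_all add: C_simps\<close>)
  also have "\<dots> = (VComp C A D E \<cdot> ((Id V ?DE \<odot> VComp C A B D) \<cdot> Assoc V ?DE ?BD ?AB)) \<cdot>
      ((a \<odot> b) \<odot> c)"
    using VComp_assoc[OF O] by simp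
  also have "\<dots> = VComp C A D E \<cdot>
      ((Id V ?DE \<odot> VComp C A B D) \<cdot> (Assoc V ?DE ?BD ?AB \<cdot> ((a \<odot> b) \<odot> c)))"
    using O a b c W by (simp add: C_simps Comp_assoc_Arr)
  also have "\<dots> = VComp C A D E \<cdot> ((Id V ?DE \<odot> VComp C A B D) \<cdot> ((a \<odot> (b \<odot> c)) \<cdot> Assoc V W1 W2 W3))"
    using Assoc_natural[OF a b c] by simp
  also have "\<dots> = VComp C A D E \<cdot> (((Id V ?DE \<odot> VComp C A B D) \<cdot> (a \<odot> (b \<odot> c))) \<cdot> Assoc V W1 W2 W3)"
    using O a b c W by (simp add: C_simps Comp_assoc_Arr)
  also have "\<dots> = VComp C A D E \<cdot> ((a \<odot> (VComp C A B D \<cdot> (b \<odot> c))) \<cdot> Assoc V W1 W2 W3)"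
    using TensA_Comp[OF a h(4) h(6,5)] Id_Comp[OF a] by simp
  finally show ?thesis .
qed

text \<open>
  Associativity of composition when the leftmost factor has shape \<open>I\<close>: \<open>m (a b) = (m a) b\<close>.
\<close>

lemma HomR_VComp:
  assumes m: "m \<in> hom C0 D Y" and a: "a \<in> hom V W (VHom C B D)" and b: "b \<in> hom V W' (VHom C A B)"
    and O: "A \<in> VObj C" "B \<in> VObj C"
  shows "HomR C0 A m \<cdot> (VComp C A B D \<cdot> (a \<odot> b)) = VComp C A B Y \<cdot> ((HomR C0 B m \<cdot> a) \<odot> b)"
proof -
  obtain g where g: "g \<in> hom V (Unit V) (VHom C D Y)" "m = (D, Y, g)"
      and DY: "D \<in> VObj C" "Y \<in> VObj C"
    using m unfolding C0_hom by blast
  have W: "W \<in> Obj V" "W' \<in> Obj V" using hom_Obj[OF a] hom_Obj[OF b] by auto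
  have ab: "VComp C A B D \<cdot> (a \<odot> b) \<in> hom V (W \<otimes> W') (VHom C A D)"
    using a b O DY by (simp add: C_simps)
  have h: "(g \<odot> a) \<cdot> lunit_inv W \<in> hom V W (VHom C D Y \<otimes> VHom C B D)"
    "VComp C B D Y \<cdot> (g \<odot> a) \<in> hom V (Unit V \<otimes> W) (VHom C B Y)"
    "lunit_inv W \<in> hom V W (Unit V \<otimes> W)" "Id V W' \<in> hom V W' W'"
    using g a O DY W by (simp_all add: C_simps)
  have "VComp C A B Y \<cdot> ((HomR C0 B m \<cdot> a) \<odot> b)
    = VComp C A B Y \<cdot> (((VComp C B D Y \<cdot> (g \<odot> a)) \<cdot> lunit_inv W) \<odot> (b \<cdot> Id V W'))"
    unfolding g(2) HomR_apply[OF g(1) a O(2) DY] Comp_Id[OF b]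
    using g(1) a O DY W by (simp add: C_simps Comp_assoc_Arr)
  also have "\<dots> = VComp C A B Y \<cdot> (((VComp C B D Y \<cdot> (g \<odot> a)) \<odot> b) \<cdot> (lunit_inv W \<odot> Id V W'))"
    using TensA_Comp[OF h(3,2,4) b] by simp
  also have "\<dots> = (VComp C A B Y \<cdot> ((VComp C B D Y \<cdot> (g \<odot> a)) \<odot> b)) \<cdot> (lunit_inv W \<odot> Id V W')"
    using g(1) a b O DY W by (simp add: C_simps Comp_assoc_Arr)
  also have "\<dots> = (VComp C A D Y \<cdot> ((g \<odot> (VComp C A B D \<cdot> (a \<odot> b))) \<cdot> Assoc V (Unit V) W W')) \<cdot>
      (lunit_inv W \<odot> Id V W')"
    using VComp_assoc_elements[OF g(1) a b O DY] by simp
  also have "\<dots> = VComp C A D Y \<cdot>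
      ((g \<odot> (VComp C A B D \<cdot> (a \<odot> b))) \<cdot> (Assoc V (Unit V) W W' \<cdot> (lunit_inv W \<odot> Id V W')))"
    using g(1) a b O DY W by (simp add: C_simps Comp_assoc_Arr)
  also have "\<dots> = HomR C0 A m \<cdot> (VComp C A B D \<cdot> (a \<odot> b))"
    unfolding g(2) HomR_apply[OF g(1) ab O(1) DY] Assoc_lunit_inv[OF W] ..
  finally show ?thesis by simp
qed

text \<open>
  Associativity of composition when the middle factor has shape \<open>I\<close>: \<open>(a f) b = a (f b)\<close>.
\<close>

lemma VComp_HomL:
  assumes f: "f \<in> hom C0 T X" and a: "a \<in> hom V W (VHom C X Y)" and b: "b \<in> hom V W' (VHom C H T)"
    and O: "H \<in> VObj C" "Y \<in> VObj C"
  shows "VComp C H T Y \<cdot> ((HomL C0 f Y \<cdot> a) \<odot> b) = VComp C H X Y \<cdot> (a \<odot> (HomR C0 H f \<cdot> b))"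
proof -
  obtain g where g: "g \<in> hom V (Unit V) (VHom C T X)" "f = (T, X, g)"
      and TX: "T \<in> VObj C" "X \<in> VObj C"
    using f unfolding C0_hom by blast
  have W: "W \<in> Obj V" "W' \<in> Obj V" using hom_Obj[OF a] hom_Obj[OF b] by auto
  have h: "VComp C T X Y \<cdot> (a \<odot> g) \<in> hom V (W \<otimes> Unit V) (VHom C T Y)"
    "runit_inv W \<in> hom V W (W \<otimes> Unit V)" "Id V W' \<in> hom V W' W'" "Id V W \<in> hom V W W"
    "lunit_inv W' \<in> hom V W' (Unit V \<otimes> W')"
    "VComp C H T X \<cdot> (g \<odot> b) \<in> hom V (Unit V \<otimes> W') (VHom C H X)"
    using g a b O TX W by (simp_all add: C_simps)
  have "VComp C H T Y \<cdot> ((HomL C0 f Y \<cdot> a) \<odot> b)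
    = VComp C H T Y \<cdot> (((VComp C T X Y \<cdot> (a \<odot> g)) \<cdot> runit_inv W) \<odot> (b \<cdot> Id V W'))"
    unfolding g(2) HomL_apply[OF g(1) a TX O(2)] Comp_Id[OF b]
    using g(1) a O TX W by (simp add: C_simps Comp_assoc_Arr)
  also have "\<dots> = VComp C H T Y \<cdot> (((VComp C T X Y \<cdot> (a \<odot> g)) \<odot> b) \<cdot> (runit_inv W \<odot> Id V W'))"
    using TensA_Comp[OF h(2,1,3) b] by simp
  also have "\<dots> = (VComp C H T Y \<cdot> ((VComp C T X Y \<cdot> (a \<odot> g)) \<odot> b)) \<cdot> (runit_inv W \<odot> Id V W')"
    using g(1) a b O TX W by (simp add: C_simps Comp_assoc_Arr)
  also have "\<dots> = (VComp C H X Y \<cdot> ((a \<odot> (VComp C H T X \<cdot> (g \<odot> b))) \<cdot> Assoc V W (Unit V) W')) \<cdot>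
      (runit_inv W \<odot> Id V W')"
    using VComp_assoc_elements[OF a g(1) b O(1) TX O(2)] by simp
  also have "\<dots> = VComp C H X Y \<cdot>
      ((a \<odot> (VComp C H T X \<cdot> (g \<odot> b))) \<cdot> (Assoc V W (Unit V) W' \<cdot> (runit_inv W \<odot> Id V W')))"
    using g(1) a b O TX W by (simp add: C_simps Comp_assoc_Arr)
  also have "\<dots> = VComp C H X Y \<cdot> ((a \<cdot> Id V W) \<odot> ((VComp C H T X \<cdot> (g \<odot> b)) \<cdot> lunit_inv W'))"
    unfolding Assoc_runit_inv[OF W] using TensA_Comp[OF h(4) a h(5,6)] by simp
  also have "\<dots> = VComp C H X Y \<cdot> (a \<odot> (HomR C0 H f \<cdot> b))"
    unfolding g(2) HomR_apply[OF g(1) b O(1) TX] Comp_Id[OF a]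
    using g(1) b O TX W by (simp add: C_simps Comp_assoc_Arr)
  finally show ?thesis .
qed

lemma C0_Comp:
  assumes "(A, B, f) \<in> hom C0 A B" "(B, D, g) \<in> hom C0 B D"
  shows "(B, D, g) \<cdot>\<^bsub>C0\<^esub> (A, B, f) = (A, D, HomR C0 A (B, D, g) \<cdot> f)"
  using assms HomR_apply[of g B D f "Unit V" A] by (auto simp: C0_hom) (simp add: underlying_def)

lemma HomR_Comp:
  assumes f: "f \<in> hom C0 X Y" and g: "g \<in> hom C0 Y Z" and A: "A \<in> VObj C"
  shows "HomR C0 A (g \<cdot>\<^bsub>C0\<^esub> f) = HomR C0 A g \<cdot> HomR C0 A f" and "g \<cdot>\<^bsub>C0\<^esub> f \<in> hom C0 X Z"
proof -
  obtain f' g' where f': "f' \<in> hom V (Unit V) (VHom C X Y)" "f = (X, Y, f')"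
    and g': "g' \<in> hom V (Unit V) (VHom C Y Z)" "g = (Y, Z, g')"
    and O: "X \<in> VObj C" "Y \<in> VObj C" "Z \<in> VObj C"
    using f g unfolding C0_hom by blast
  let ?AX = "VHom C A X" and ?h = "HomR C0 X g \<cdot> f'"
  have AX: "Id V ?AX \<in> hom V ?AX ?AX" using O A by (simp add: C_simps)
  have h: "?h \<in> hom V (Unit V) (VHom C X Z)"
    by (rule Comp_in_hom[OF f'(1) HomR_in_hom[OF g O(1)]])
  have gf: "g \<cdot>\<^bsub>C0\<^esub> f = (X, Z, ?h)"
    using C0_Comp f g f' g' by simp
  then show "g \<cdot>\<^bsub>C0\<^esub> f \<in> hom C0 X Z"
    using h O by (simp add: C0_hom)
  have fin: "(f' \<odot> Id V ?AX) \<cdot> lunit_inv ?AX \<in> hom V ?AX (VHom C X Y \<otimes> ?AX)"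
    using f' O A by (simp add: C_simps)
  note Rg = HomR_in_hom[OF g A] and Rf = HomR_in_hom[OF f A]
  have "HomR C0 A (g \<cdot>\<^bsub>C0\<^esub> f) = (VComp C A X Z \<cdot> (?h \<odot> Id V ?AX)) \<cdot> lunit_inv ?AX"
    unfolding gf using h O A by (simp add: C_simps Comp_assoc_Arr) (simp add: underlying_def)
  also have "\<dots> = (HomR C0 A g \<cdot> (VComp C A X Y \<cdot> (f' \<odot> Id V ?AX))) \<cdot> lunit_inv ?AX"
    using HomR_VComp[OF g f'(1) AX A O(1)] by simp
  also have "\<dots> = HomR C0 A g \<cdot> (VComp C A X Y \<cdot> ((f' \<odot> Id V ?AX) \<cdot> lunit_inv ?AX))"
    using Rg f'(1) O A by (simp add: C_simps Comp_assoc_Arr)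
  also have "\<dots> = HomR C0 A g \<cdot> HomR C0 A f"
    unfolding f'(2) by (simp add: underlying_def)
  finally show "HomR C0 A (g \<cdot>\<^bsub>C0\<^esub> f) = HomR C0 A g \<cdot> HomR C0 A f" .
qed

lemma HomR_Id:
  assumes X: "X \<in> VObj C" and A: "A \<in> VObj C"
  shows "HomR C0 A (Id C0 X) = Id V (VHom C A X)"
proof -
  have "HomR C0 A (Id C0 X) = VComp C A X X \<cdot>
      ((VId C X \<odot> Id V (VHom C A X)) \<cdot> lunit_inv (VHom C A X))"
    by (simp add: underlying_def)
  also have "\<dots> = (VComp C A X X \<cdot> (VId C X \<odot> Id V (VHom C A X))) \<cdot> lunit_inv (VHom C A X)"
    using X A by (simp add: C_simps Comp_assoc_Arr)
  also have "\<dots> = Id V (VHom C A X)"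
    using VId_VComp[OF A X] lunit_inv(3) VHom_in_Obj[OF A X] by simp
  finally show ?thesis .
qed

text \<open>
  Diagrams in \<open>C\<^sub>0\<close>, and in the next lemma cocones, are moved to \<open>V\<^sub>0\<close> along \<open>C(A,-)\<close>, so that
  boundedness of objects of \<open>V\<^sub>0\<close> can be applied to them.
\<close>

lemma HomR_ord_functor:
  assumes D: "ord_functor I C0 Do Da" and A: "A \<in> VObj C"
  shows "ord_functor I V (VHom C A \<circ> Do) (HomR C0 A \<circ> Da)"
proof -
  have Da: "Da f \<in> hom C0 (Do (Dom I f)) (Do (Cod I f))" if "f \<in> Arr I" for f
    using D that by (auto simp: ord_functor_def)
  have "HomR C0 A (Da (g \<cdot>\<^bsub>I\<^esub> f)) = HomR C0 A (Da g) \<cdot> HomR C0 A (Da f)"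
    if "f \<in> Arr I" "g \<in> Arr I" "Cod I f = Dom I g" for f g
  proof -
    have "Da (g \<cdot>\<^bsub>I\<^esub> f) = Da g \<cdot>\<^bsub>C0\<^esub> Da f"
      using D that by (auto simp: ord_functor_def)
    then show ?thesis
      using HomR_Comp(1)[OF Da[OF that(1)] _ A] Da[OF that(2)] that(3) by simp
  qed
  then show ?thesis
    using D A HomR_in_hom[OF Da A] HomR_Id[OF _ A] VHom_in_Obj[OF A]
    by (simp add: ord_functor_def C0_simps)
qed

lemma HomR_cocone:
  assumes D: "ord_functor I C0 Do Da" and m: "cocone I C0 Do Da X m" and A: "A \<in> VObj C"
    and I: "\<And>f. f \<in> Arr I \<Longrightarrow> Cod I f \<in> Obj I"
  shows "cocone I V (VHom C A \<circ> Do) (HomR C0 A \<circ> Da) (VHom C A X) (\<lambda>i. HomR C0 A (m i))"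
proof -
  have Da: "Da f \<in> hom C0 (Do (Dom I f)) (Do (Cod I f))" if "f \<in> Arr I" for f
    using D that by (auto simp: ord_functor_def)
  have mh: "m i \<in> hom C0 (Do i) X" if "i \<in> Obj I" for i
    using m that by (auto simp: cocone_def)
  have nat: "m (Cod I f) \<cdot>\<^bsub>C0\<^esub> Da f = m (Dom I f)" if "f \<in> Arr I" for f
    using m that by (auto simp: cocone_def)
  have "X \<in> VObj C" using m by (auto simp: cocone_def C0_simps)
  then show ?thesis
    using VHom_in_Obj[OF A] HomR_in_hom[OF mh A] HomR_Comp(1)[OF Da mh A, symmetric] I nat
    by (simp add: cocone_def)
qed

text \<open>
  The isomorphism \<open>C(T,Y) \<cong> [X, C(G,Y)]\<close> on elements of shape \<open>W\<close>: an arrow \<open>W \<otimes> X \<rightarrow> C(G,Y)\<close> is the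
  same as an arrow \<open>W \<rightarrow> C(T,Y)\<close>.
\<close>

lemma tensor_universal:
  assumes T: "is_tensor V C X G T \<eta>" and X: "X \<in> Obj V" and G: "G \<in> VObj C" and Y: "Y \<in> VObj C"
    and W: "W \<in> Obj V" and q: "q \<in> hom V (W \<otimes> X) (VHom C G Y)"
  shows "\<exists>!x. x \<in> hom V W (VHom C T Y) \<and> VComp C G T Y \<cdot> (x \<odot> \<eta>) = q"
proof -
  have TO: "T \<in> VObj C" and \<eta>: "\<eta> \<in> hom V X (VHom C G T)"
    using T by (auto simp: is_tensor_def)
  let ?t = "VComp C G T Y \<cdot> (Id V (VHom C T Y) \<odot> \<eta>)"
  let ?\<tau> = "transpose V (VHom C T Y) X (VHom C G Y) ?t"
  have t: "?t \<in> hom V (VHom C T Y \<otimes> X) (VHom C G Y)"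
    using TO \<eta> G Y by (simp add: C_simps)
  have iso: "iso V ?\<tau>" using T Y by (auto simp: is_tensor_def)
  note O = VHom_in_Obj[OF TO Y] VHom_in_Obj[OF G Y]
  note \<tau> = transpose[OF t O(1) X]
  have ev: "Ev V X (VHom C G Y) \<cdot> ((?\<tau> \<cdot> x) \<odot> Id V X) = VComp C G T Y \<cdot> (x \<odot> \<eta>)"
    if x: "x \<in> hom V W (VHom C T Y)" for x
  proof -
    have "Ev V X (VHom C G Y) \<cdot> ((?\<tau> \<cdot> x) \<odot> Id V X) = Ev V X (VHom C G Y) \<cdot>
        ((?\<tau> \<odot> Id V X) \<cdot> (x \<odot> Id V X))"
      using tens_left_Comp[OF x \<tau>(1) X] by simp
    also have "\<dots> = (Ev V X (VHom C G Y) \<cdot> (?\<tau> \<odot> Id V X)) \<cdot> (x \<odot> Id V X)"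
      by (rule Comp_assoc_Arr[symmetric]) (use \<tau>(1) x X O in \<open>simp_all add: V_simps\<close>)
    also have "\<dots> = VComp C G T Y \<cdot> ((Id V (VHom C T Y) \<odot> \<eta>) \<cdot> (x \<odot> Id V X))"
      unfolding \<tau>(2) by (rule Comp_assoc_Arr) (use \<eta> x X TO G Y in \<open>simp_all add: C_simps\<close>)
    also have "\<dots> = VComp C G T Y \<cdot> (x \<odot> \<eta>)"
      using tens_split(2)[OF x \<eta>] by simp
    finally show ?thesis .
  qed
  note q' = transpose[OF q W X] and i = inv_arr[OF iso \<tau>(1)]
  show ?thesis
  proof (rule ex_ex1I)
    let ?x = "inv_arr V ?\<tau> \<cdot> transpose V W X (VHom C G Y) q"
    have x: "?x \<in> hom V W (VHom C T Y)"
      by (rule Comp_in_hom[OF q'(1) i(1)])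
    have "?\<tau> \<cdot> ?x = transpose V W X (VHom C G Y) q"
      using Comp_assoc[OF q'(1) i(1) \<tau>(1)] i(3) Id_Comp[OF q'(1)] by simp
    then show "\<exists>x. x \<in> hom V W (VHom C T Y) \<and> VComp C G T Y \<cdot> (x \<odot> \<eta>) = q"
      using x ev[OF x] q'(2) by auto
    show "x = y" if "x \<in> hom V W (VHom C T Y) \<and> VComp C G T Y \<cdot> (x \<odot> \<eta>) = q"
      "y \<in> hom V W (VHom C T Y) \<and> VComp C G T Y \<cdot> (y \<odot> \<eta>) = q" for x y
    proof (rule iso_cancel_left[OF iso \<tau>(1)])
      show xy: "x \<in> hom V W (VHom C T Y)" "y \<in> hom V W (VHom C T Y)" using that by auto
      show "?\<tau> \<cdot> x = ?\<tau> \<cdot> y"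
        by (rule Ev_cancel[OF Comp_in_hom[OF xy(1) \<tau>(1)] Comp_in_hom[OF xy(2) \<tau>(1)] X O(2)])
          (use ev[OF xy(1)] ev[OF xy(2)] that in simp)
    qed
  qed
qed

section \<open>Detecting factorizations on a generator\<close>

lemma HomL_Id:
  assumes X: "X \<in> VObj C" and Y: "Y \<in> VObj C"
  shows "HomL C0 (Id C0 X) Y = Id V (VHom C X Y)"
proof -
  have "HomL C0 (Id C0 X) Y = VComp C X X Y \<cdot>
      ((Id V (VHom C X Y) \<odot> VId C X) \<cdot> runit_inv (VHom C X Y))"
    by (simp add: underlying_def)
  also have "\<dots> = (VComp C X X Y \<cdot> (Id V (VHom C X Y) \<odot> VId C X)) \<cdot> runit_inv (VHom C X Y)"
    using X Y by (simp add: C_simps Comp_assoc_Arr)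
  also have "\<dots> = Id V (VHom C X Y)"
    using VComp_VId[OF X Y] runit_inv(3) VHom_in_Obj[OF X Y] by simp
  finally show ?thesis .
qed

lemma conical_coproduct_universal:
  assumes col: "is_conical_colimit (discrete \<G>) V C0 T (\<lambda>G. Id C0 (T G)) P \<iota>"
    and Y: "Y \<in> VObj C" and W: "W \<in> Obj V"
    and x: "\<And>G. G \<in> \<G> \<Longrightarrow> x G \<in> hom V W (VHom C (T G) Y)"
  shows "\<exists>!u. u \<in> hom V W (VHom C P Y) \<and> (\<forall>G \<in> \<G>. HomL C0 (\<iota> G) Y \<cdot> u = x G)"
proof -
  have lim: "is_limit (op_cat (discrete \<G>)) V (\<lambda>G. VHom C (T G) Y)
      (\<lambda>G. HomL C0 (Id C0 (T G)) Y) (VHom C P Y) (\<lambda>G. HomL C0 (\<iota> G) Y)"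
    using col Y by (simp add: is_conical_colimit_def C0_simps)
  have T: "T G \<in> VObj C" if "G \<in> \<G>" for G
    using col that by (auto simp: is_conical_colimit_def cocone_def discrete_def C0_hom)
  have "cone (op_cat (discrete \<G>)) V (\<lambda>G. VHom C (T G) Y) (\<lambda>G. HomL C0 (Id C0 (T G)) Y) W x"
    unfolding cone_def op_cat_def discrete_def using W x T HomL_Id[OF _ Y] Id_Comp[OF x] by simp
  then show ?thesis
    using lim unfolding is_limit_def by (simp add: op_cat_def discrete_def)
qed

text \<open>
  The canonical \<open>s : \<Coprod> C(H,X) \<otimes> H \<rightarrow> X\<close> is \<open>V\<close>-orthogonal to \<open>m\<close>, so \<open>C(X,D)\<close> is the pullback of
  \<open>C(P,D)\<close> and \<open>C(X,Y)\<close> over \<open>C(P,Y)\<close>, where \<open>P\<close> is the coproduct. A factorization of \<open>g\<close> through \<open>C(X,m)\<close>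
  is therefore an arrow \<open>W \<rightarrow> C(P,D)\<close> with the right image in \<open>C(P,Y)\<close>. By the universal properties of the
  coproduct and the tensors, such an arrow is a family of arrows \<open>W \<otimes> C(H,X) \<rightarrow> C(H,D)\<close>, and the condition on
  the image says that composing with \<open>m\<close> gives the action of \<open>g\<close> on \<open>C(H,X)\<close>.
\<close>

lemma factors_through_HomR_if_generator_factors:
  assumes fs: "enriched_factorization_system V C0 EC MC"
    and s: "s \<in> EC" "is_generator_arrow V C \<G> X s" and \<G>: "\<G> \<subseteq> VObj C"
    and m: "m \<in> MC" "m \<in> hom C0 D Y" and g: "g \<in> hom V W (VHom C X Y)" and X: "X \<in> VObj C"
    and q: "\<And>H. H \<in> \<G> \<Longrightarrow> \<exists>q \<in> hom V (W \<otimes> VHom C H X) (VHom C H D).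
      HomR C0 H m \<cdot> q = VComp C H X Y \<cdot> (g \<odot> Id V (VHom C H X))"
  shows "\<exists>k \<in> hom V W (VHom C X D). HomR C0 X m \<cdot> k = g"
proof -
  obtain T \<eta> P \<iota> where T: "\<And>G. G \<in> \<G> \<Longrightarrow> is_tensor V C (VHom C G X) G (T G) (\<eta> G)"
    and P: "is_conical_colimit (discrete \<G>) V C0 T (\<lambda>G. Id C0 (T G)) P \<iota>"
    and sh: "s \<in> hom C0 P X"
    and s\<eta>: "\<And>G. G \<in> \<G> \<Longrightarrow> HomR C0 G (s \<cdot>\<^bsub>C0\<^esub> \<iota> G) \<cdot> \<eta> G = Id V (VHom C G X)"
    using s(2) unfolding is_generator_arrow_def by blast
  have W: "W \<in> Obj V" using hom_Obj[OF g] by auto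
  have DY: "D \<in> VObj C" "Y \<in> VObj C" and PO: "P \<in> VObj C" using m(2) sh by (auto simp: C0_hom)
  have TO: "T G \<in> VObj C" and \<eta>: "\<eta> G \<in> hom V (VHom C G X) (VHom C G (T G))"
    and \<iota>: "\<iota> G \<in> hom C0 (T G) P" and GO: "G \<in> VObj C" "VHom C G X \<in> Obj V" if "G \<in> \<G>" for G
    using T[OF that] P that \<G> X VHom_in_Obj
    by (auto simp: is_tensor_def is_conical_colimit_def cocone_def discrete_def)
  have "\<exists>q x. q \<in> hom V (W \<otimes> VHom C G X) (VHom C G D) \<and>
      HomR C0 G m \<cdot> q = VComp C G X Y \<cdot> (g \<odot> Id V (VHom C G X)) \<and>
      x \<in> hom V W (VHom C (T G) D) \<and> VComp C G (T G) D \<cdot> (x \<odot> \<eta> G) = q" if G: "G \<in> \<G>" for G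
    using q[OF G] tensor_universal[OF T[OF G] GO(2)[OF G] GO(1)[OF G] DY(1) W] by blast
  then obtain q x where q: "\<And>G. G \<in> \<G> \<Longrightarrow> HomR C0 G m \<cdot> q G = VComp C G X Y \<cdot> (g \<odot> Id V (VHom C G X))"
    and x: "\<And>G. G \<in> \<G> \<Longrightarrow> x G \<in> hom V W (VHom C (T G) D)"
      "\<And>G. G \<in> \<G> \<Longrightarrow> VComp C G (T G) D \<cdot> (x G \<odot> \<eta> G) = q G"
    by metis
  obtain z where z: "z \<in> hom V W (VHom C P D)" "\<And>G. G \<in> \<G> \<Longrightarrow> HomL C0 (\<iota> G) D \<cdot> z = x G"
    using conical_coproduct_universal[OF P DY(1) W, of x] x(1) by blast
  note Rz = Comp_in_hom[OF z(1) HomR_in_hom[OF m(2) PO]]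
  note Lg = Comp_in_hom[OF g HomL_in_hom[OF sh DY(2)]]
  \<comment> \<open>The product projections and then the tensor units reduce the equation to one between arrows
    out of \<open>W \<otimes> C(G,X)\<close>; both sides come out as the action of \<open>g\<close>.\<close>
  have "HomR C0 P m \<cdot> z = HomL C0 s Y \<cdot> g"
  proof -
    have eq: "HomL C0 (\<iota> G) Y \<cdot> (HomR C0 P m \<cdot> z) = HomL C0 (\<iota> G) Y \<cdot> (HomL C0 s Y \<cdot> g)"
        if G: "G \<in> \<G>" for G
    proof -
      note L = HomL_in_hom[OF \<iota>[OF G] DY(2)] and R\<iota> = HomR_in_hom[OF \<iota>[OF G] GO(1)[OF G]]
      note Rs = HomR_in_hom[OF sh GO(1)[OF G]]
      have h: "HomL C0 (\<iota> G) Y \<cdot> (HomR C0 P m \<cdot> z) \<in> hom V W (VHom C (T G) Y)"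
        "HomL C0 (\<iota> G) Y \<cdot> (HomL C0 s Y \<cdot> g) \<in> hom V W (VHom C (T G) Y)"
        by (rule Comp_in_hom[OF Rz L], rule Comp_in_hom[OF Lg L])
      have "VComp C G (T G) Y \<cdot> ((HomL C0 (\<iota> G) Y \<cdot> (HomR C0 P m \<cdot> z)) \<odot> \<eta> G)
        = VComp C G P Y \<cdot> ((HomR C0 P m \<cdot> z) \<odot> (HomR C0 G (\<iota> G) \<cdot> \<eta> G))"
        by (rule VComp_HomL[OF \<iota>[OF G] Rz \<eta>[OF G] GO(1)[OF G] DY(2)])
      also have "\<dots> = HomR C0 G m \<cdot> (VComp C G P D \<cdot> (z \<odot> (HomR C0 G (\<iota> G) \<cdot> \<eta> G)))"
        by (rule HomR_VComp[OF m(2) z(1) Comp_in_hom[OF \<eta>[OF G] R\<iota>] GO(1)[OF G] PO, symmetric])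
      also have "\<dots> = HomR C0 G m \<cdot> (VComp C G (T G) D \<cdot> ((HomL C0 (\<iota> G) D \<cdot> z) \<odot> \<eta> G))"
        using VComp_HomL[OF \<iota>[OF G] z(1) \<eta>[OF G] GO(1)[OF G] DY(1)] by simp
      also have "\<dots> = VComp C G X Y \<cdot> (g \<odot> Id V (VHom C G X))"
        using z(2)[OF G] x(2)[OF G] q[OF G] by simp
      finally have 1: "VComp C G (T G) Y \<cdot> ((HomL C0 (\<iota> G) Y \<cdot> (HomR C0 P m \<cdot> z)) \<odot> \<eta> G)
        = VComp C G X Y \<cdot> (g \<odot> Id V (VHom C G X))" .
      have "VComp C G (T G) Y \<cdot> ((HomL C0 (\<iota> G) Y \<cdot> (HomL C0 s Y \<cdot> g)) \<odot> \<eta> G)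
        = VComp C G P Y \<cdot> ((HomL C0 s Y \<cdot> g) \<odot> (HomR C0 G (\<iota> G) \<cdot> \<eta> G))"
        by (rule VComp_HomL[OF \<iota>[OF G] Lg \<eta>[OF G] GO(1)[OF G] DY(2)])
      also have "\<dots> = VComp C G X Y \<cdot> (g \<odot> (HomR C0 G s \<cdot> (HomR C0 G (\<iota> G) \<cdot> \<eta> G)))"
        by (rule VComp_HomL[OF sh g Comp_in_hom[OF \<eta>[OF G] R\<iota>] GO(1)[OF G] DY(2)])
      also have "\<dots> = VComp C G X Y \<cdot> (g \<odot> Id V (VHom C G X))"
        using Comp_assoc[OF \<eta>[OF G] R\<iota> Rs] HomR_Comp(1)[OF \<iota>[OF G] sh GO(1)[OF G]] s\<eta>[OF G] by simp
      finally have 2: "VComp C G (T G) Y \<cdot> ((HomL C0 (\<iota> G) Y \<cdot> (HomL C0 s Y \<cdot> g)) \<odot> \<eta> G)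
        = VComp C G X Y \<cdot> (g \<odot> Id V (VHom C G X))" .
      have "VComp C G X Y \<cdot> (g \<odot> Id V (VHom C G X)) \<in> hom V (W \<otimes> VHom C G X) (VHom C G Y)"
        using g X DY GO[OF G] by (simp add: C_simps)
      with tensor_universal[OF T[OF G] GO(2)[OF G] GO(1)[OF G] DY(2) W] h 1 2 show ?thesis by blast
    qed
    have "HomL C0 (\<iota> G) Y \<cdot> (HomR C0 P m \<cdot> z) \<in> hom V W (VHom C (T G) Y)" if "G \<in> \<G>" for G
      by (rule Comp_in_hom[OF Rz HomL_in_hom[OF \<iota>[OF that] DY(2)]])
    from conical_coproduct_universal[OF P DY(2) W, OF this] Rz Lg eq show ?thesis
      by (metis (no_types, lifting))
  qed
  moreover have "is_pullback V (HomL C0 s D) (HomR C0 X m) (HomR C0 P m) (HomL C0 s Y)"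
    using fs s(1) m sh by (auto simp: enriched_factorization_system_def vorthogonal_def hom_def)
  moreover have "Dom V (HomL C0 s D) = VHom C X D" "Dom V (HomR C0 P m) = VHom C P D"
    "Dom V (HomL C0 s Y) = VHom C X Y"
    using HomL_in_hom[OF sh] HomR_in_hom[OF m(2) PO] DY by (auto simp: hom_def)
  ultimately show ?thesis
    using z(1) g unfolding is_pullback_def by (metis (no_types, lifting))
qed

end

context sym_monoidal_closed
begin

lemma tensor_coproduct_universal:
  assumes col: "is_colimit (discrete S) V T (\<lambda>i. Id V (T i)) P \<iota>" and W: "W \<in> Obj V"
      and Y: "Y \<in> Obj V"
    and x: "\<And>i. i \<in> S \<Longrightarrow> x i \<in> hom V (W \<otimes> T i) Y"
  shows "\<exists>!u. u \<in> hom V (W \<otimes> P) Y \<and> (\<forall>i \<in> S. u \<cdot> (Id V W \<odot> \<iota> i) = x i)"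
proof -
  have T: "T i \<in> Obj V" if "i \<in> S" for i
    using col that hom_Obj by (fastforce simp: is_colimit_def cocone_def discrete_def)
  show ?thesis
    using tensor_preserves_colimit[OF col, of W Y x] W Y x T TensA_Id[OF W T] Comp_Id[OF
        x] Id_in_hom[OF T]
    by (simp add: discrete_def)
qed

text \<open>
  The canonical \<open>E\<close>-arrow from the coproduct of the copowers \<open>V(G,Z) \<cdot> G\<close> to \<open>Z\<close> stays a coproduct of
  copowers after tensoring with \<open>W\<close>. The given factorizations glue to one of \<open>y\<close> restricted to it, which
  the lifting property extends to \<open>W \<otimes> Z\<close>.
\<close>

lemma tensor_factors_through_if_generator_factors:
  assumes fs: "enriched_factorization_system V (self_enriched V) E M"
    and gen: "ord_generator U V E \<G>" and n: "n \<in> M" "n \<in> hom V D Y"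
    and W: "W \<in> Obj V" and Z: "Z \<in> Obj V" and y: "y \<in> hom V (W \<otimes> Z) Y"
    and h: "\<And>G p. G \<in> \<G> \<Longrightarrow> p \<in> hom V G Z \<Longrightarrow> \<exists>h \<in> hom V (W \<otimes> G) D. n \<cdot> h = y \<cdot> (Id V W \<odot> p)"
  shows "\<exists>u \<in> hom V (W \<otimes> Z) D. n \<cdot> u = y"
proof -
  have DY: "D \<in> Obj V" "Y \<in> Obj V" using hom_Obj[OF n(2)] by auto
  obtain s where s: "s \<in> E" "is_ord_generator_arrow V \<G> Z s"
    using gen Z by (auto simp: ord_generator_def)
  then obtain T \<kappa> P \<iota> where T: "\<And>G. G \<in> \<G> \<Longrightarrow> is_colimit (discrete (hom V G Z)) V (\<lambda>_. G)
      (\<lambda>_. Id V G) (T G) (\<kappa> G)"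
    and P: "is_colimit (discrete \<G>) V T (\<lambda>G. Id V (T G)) P \<iota>" and sh: "s \<in> hom V P Z"
    and s\<kappa>: "\<And>G f. G \<in> \<G> \<Longrightarrow> f \<in> hom V G Z \<Longrightarrow> (s \<cdot> \<iota> G) \<cdot> \<kappa> G f = f"
    unfolding is_ord_generator_arrow_def by blast
  have \<iota>: "\<iota> G \<in> hom V (T G) P" if "G \<in> \<G>" for G
    using P that by (auto simp: is_colimit_def cocone_def discrete_def)
  let ?w = "\<lambda>f. Id V W \<odot> f"
  have w: "?w f \<in> hom V (W \<otimes> A) (W \<otimes> B)" if "f \<in> hom V A B" for f A B
    using TensA_in_hom[OF Id_in_hom[OF W] that] .
  have wc: "(x \<cdot> ?w f) \<cdot> ?w g = x \<cdot> ?w (f \<cdot> g)"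
    if "g \<in> hom V A B" "f \<in> hom V B B'" "x \<in> hom V (W \<otimes> B') A'" for x f g A B B' A'
    using Comp_assoc[OF w[OF that(1)] w[OF that(2)] that(3)] tens_right_Comp[OF that(1,2) W] by simp
  have "\<exists>t. t \<in> hom V (W \<otimes> T G) D \<and> n \<cdot> t = y \<cdot> ?w (s \<cdot> \<iota> G)" if G: "G \<in> \<G>" for G
  proof -
    obtain k where k: "\<And>f. f \<in> hom V G Z \<Longrightarrow> k f \<in> hom V (W \<otimes> G) D"
        "\<And>f. f \<in> hom V G Z \<Longrightarrow> n \<cdot> k f = y \<cdot> ?w f"
      using h[OF G] by metis
    have \<kappa>: "\<kappa> G f \<in> hom V G (T G)" if "f \<in> hom V G Z" for f
      using T[OF G] that by (auto simp: is_colimit_def cocone_def discrete_def)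
    obtain t where t: "t \<in> hom V (W \<otimes> T G) D" "\<And>f. f \<in> hom V G Z \<Longrightarrow> t \<cdot> ?w (\<kappa> G f) = k f"
      using tensor_coproduct_universal[OF T[OF G] W DY(1), of k] k(1) by blast
    have ex: "\<exists>!v. v \<in> hom V (W \<otimes> T G) Y \<and> (\<forall>f \<in> hom V G Z. v \<cdot> ?w (\<kappa> G f) = y \<cdot> ?w f)"
      by (rule tensor_coproduct_universal[OF T[OF G] W DY(2)]) (rule Comp_in_hom[OF w y])
    have "n \<cdot> t \<in> hom V (W \<otimes> T G) Y \<and> (\<forall>f \<in> hom V G Z. (n \<cdot> t) \<cdot> ?w (\<kappa> G f) = y \<cdot> ?w f)"
      using Comp_in_hom[OF t(1) n(2)] Comp_assoc[OF w[OF \<kappa>] t(1) n(2)] t(2) k(2) by simp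
    moreover have si: "s \<cdot> \<iota> G \<in> hom V (T G) Z" by (rule Comp_in_hom[OF \<iota>[OF G] sh])
    then have "y \<cdot> ?w (s \<cdot> \<iota> G) \<in> hom V (W \<otimes> T G) Y \<and>
        (\<forall>f \<in> hom V G Z. (y \<cdot> ?w (s \<cdot> \<iota> G)) \<cdot> ?w (\<kappa> G f) = y \<cdot> ?w f)"
      using Comp_in_hom[OF w[OF si] y] wc[OF \<kappa> si y] s\<kappa>[OF G] by simp
    ultimately show ?thesis using t(1) ex by blast
  qed
  then obtain t where t: "\<And>G. G \<in> \<G> \<Longrightarrow> t G \<in> hom V (W \<otimes> T G) D"
      "\<And>G. G \<in> \<G> \<Longrightarrow> n \<cdot> t G = y \<cdot> ?w (s \<cdot> \<iota> G)"
    by metis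
  obtain r where r: "r \<in> hom V (W \<otimes> P) D" "\<And>G. G \<in> \<G> \<Longrightarrow> r \<cdot> ?w (\<iota> G) = t G"
    using tensor_coproduct_universal[OF P W DY(1), of t] t(1) by blast
  have ex: "\<exists>!v. v \<in> hom V (W \<otimes> P) Y \<and> (\<forall>G \<in> \<G>. v \<cdot> ?w (\<iota> G) = y \<cdot> ?w (s \<cdot> \<iota> G))"
    by (rule tensor_coproduct_universal[OF P W DY(2)])
        (rule Comp_in_hom[OF w[OF Comp_in_hom[OF \<iota> sh]] y])
  have "n \<cdot> r \<in> hom V (W \<otimes> P) Y \<and> (\<forall>G \<in> \<G>. (n \<cdot> r) \<cdot> ?w (\<iota> G) = y \<cdot> ?w (s \<cdot> \<iota> G))"
    using Comp_in_hom[OF r(1) n(2)] Comp_assoc[OF w[OF \<iota>] r(1) n(2)] r(2) t(2) by simp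
  moreover have "y \<cdot> ?w s \<in> hom V (W \<otimes> P) Y \<and> (\<forall>G \<in> \<G>. (y \<cdot> ?w s) \<cdot> ?w (\<iota> G) = y \<cdot> ?w (s \<cdot> \<iota> G))"
    using Comp_in_hom[OF w[OF sh] y] wc[OF \<iota> sh y] by simp
  ultimately have "n \<cdot> r = y \<cdot> ?w s" using ex by blast
  then show ?thesis
    by (rule enriched_lifting[OF fs s(1) sh n r(1) y W])
qed

end

context category
begin

text \<open>
  Factor \<open>u = m e\<close>. Since \<open>u t\<close> is orthogonal to \<open>m\<close>, the arrow \<open>m\<close> is a split epimorphism; being monic
  it is invertible, so \<open>u\<close> inherits from \<open>e\<close> the orthogonality to \<open>M\<close>.
\<close>

lemma left_class_cancel:
  assumes fs: "factorization_system C E M" and M: "\<And>m. m \<in> M \<Longrightarrow> monic C m"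
    and u: "u \<in> hom C A B" and t: "t \<in> hom C Z A" and ut: "u \<cdot> t \<in> E"
  shows "u \<in> E"
proof -
  obtain e m D where e: "e \<in> E" "e \<in> hom C A D" and m: "m \<in> M" "m \<in> hom C D B" and ue: "u = m \<cdot> e"
  proof -
    have "u \<in> Arr C" using u by (simp add: hom_def)
    then obtain e m where em: "e \<in> E" "m \<in> M" "Cod C e = Dom C m" "u = m \<cdot> e"
      using fs unfolding factorization_system_def by blast
    moreover from em have "e \<in> Arr C" "m \<in> Arr C"
      using fs by (auto simp: factorization_system_def)
    ultimately show thesis
      using that[of e "Dom C m" m] u by (auto simp: hom_def Comp_simps)
  qed
  have B: "Id C B \<in> hom C B B" and D: "Id C D \<in> hom C D D"
    using hom_Obj[OF m(2)] Id_in_hom by auto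
  note uth = Comp_in_hom[OF t u] and et = Comp_in_hom[OF t e(2)]
  have "orthogonal C (u \<cdot> t) m"
    using fs ut m(1) uth by (auto simp: factorization_system_def hom_def)
  moreover have "m \<cdot> (e \<cdot> t) = Id C B \<cdot> (u \<cdot> t)"
    using Comp_assoc[OF t e(2) m(2)] Id_Comp[OF uth] ue by simp
  moreover have "e \<cdot> t \<in> hom C (Dom C (u \<cdot> t)) (Dom C m)" "Id C B \<in> hom C (Cod C (u \<cdot> t)) (Cod C m)"
    using et uth m(2) B by (simp_all add: hom_def)
  ultimately obtain d where "d \<in> hom C (Cod C (u \<cdot> t)) (Dom C m)" and md: "m \<cdot> d = Id C B"
    unfolding orthogonal_def by blast
  then have d: "d \<in> hom C B D" using uth m(2) by (simp add: hom_def)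
  have "m \<cdot> (d \<cdot> m) = m \<cdot> Id C D"
    using Comp_assoc[OF m(2) d m(2)] md Id_Comp[OF m(2)] Comp_Id[OF m(2)] by simp
  then have dm: "d \<cdot> m = Id C D"
    using M[OF m(1)] Comp_in_hom[OF m(2) d] D m(2) by (auto simp: monic_def hom_def)
  \<comment> \<open>\<open>d\<close> is now a two-sided inverse of \<open>m\<close>, and lifts against \<open>e\<close> become lifts against \<open>u\<close> by
    composing with it.\<close>
  have "orthogonal C u n" if n: "n \<in> M" for n
    unfolding orthogonal_def
  proof (intro ballI impI)
    fix a b assume a: "a \<in> hom C (Dom C u) (Dom C n)" and b: "b \<in> hom C (Cod C u) (Cod C n)"
      and eq: "n \<cdot> a = b \<cdot> u"
    have nh: "n \<in> hom C (Dom C n) (Cod C n)" using fs n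
      by (auto simp: factorization_system_def hom_def)
    have a': "a \<in> hom C A (Dom C n)" and b': "b \<in> hom C B (Cod C n)" using a b u
      by (auto simp: hom_def)
    note bm = Comp_in_hom[OF m(2) b']
    have "orthogonal C e n" using fs e n by (auto simp: factorization_system_def hom_def)
    moreover have "n \<cdot> a = (b \<cdot> m) \<cdot> e"
      using eq ue Comp_assoc[OF e(2) m(2) b'] by simp
    ultimately have ex: "\<exists>!c. c \<in> hom C D (Dom C n) \<and> c \<cdot> e = a \<and> n \<cdot> c = b \<cdot> m"
      using a' bm e(2) unfolding orthogonal_def by (auto simp: hom_def)
    then obtain c where c: "c \<in> hom C D (Dom C n)" "c \<cdot> e = a" "n \<cdot> c = b \<cdot> m" by blast
    show "\<exists>!c. c \<in> hom C (Cod C u) (Dom C n) \<and> c \<cdot> u = a \<and> n \<cdot> c = b"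
    proof (rule ex1I[of _ "c \<cdot> d"])
      have "(c \<cdot> d) \<cdot> u = a"
        using ue Comp_assoc[OF u d c(1)] Comp_assoc[OF e(2) m(2) d] dm Id_Comp[OF e(2)] c(2) by simp
      moreover have "n \<cdot> (c \<cdot> d) = b"
        using Comp_assoc[OF d c(1) nh] c(3) Comp_assoc[OF d m(2) b'] md Comp_Id[OF b'] by simp
      ultimately show "c \<cdot> d \<in> hom C (Cod C u) (Dom C n) \<and> (c \<cdot> d) \<cdot> u = a \<and> n \<cdot> (c \<cdot> d) = b"
        using Comp_in_hom[OF d c(1)] u by (simp add: hom_def)
      fix c' assume "c' \<in> hom C (Cod C u) (Dom C n) \<and> c' \<cdot> u = a \<and> n \<cdot> c' = b"
      then have c': "c' \<in> hom C B (Dom C n)" "c' \<cdot> u = a" "n \<cdot> c' = b" using u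
        by (auto simp: hom_def)
      have "c' \<cdot> m \<in> hom C D (Dom C n) \<and> (c' \<cdot> m) \<cdot> e = a \<and> n \<cdot> (c' \<cdot> m) = b \<cdot> m"
        using Comp_in_hom[OF m(2) c'(1)] Comp_assoc[OF e(2) m(2) c'(1)] ue c'(2)
          Comp_assoc[OF m(2) c'(1) nh] c'(3) by simp
      with ex c have "c' \<cdot> m = c" by blast
      then show "c' = c \<cdot> d"
        using Comp_assoc[OF d m(2) c'(1)] md Comp_Id[OF c'(1)] by simp
    qed
  qed
  then show ?thesis
    using fs u by (auto simp: factorization_system_def hom_def)
qed

lemma discrete_cocone:
  assumes "P \<in> Obj C" "\<And>i. i \<in> S \<Longrightarrow> x i \<in> hom C (T i) P"
  shows "cocone (discrete S) C T (\<lambda>i. Id C (T i)) P x"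
  using assms Comp_Id[OF assms(2)] by (simp add: cocone_def discrete_def)

lemma coproduct_universal:
  assumes col: "is_colimit (discrete S) C T (\<lambda>i. Id C (T i)) P \<iota>" and Y: "Y \<in> Obj C"
    and x: "\<And>i. i \<in> S \<Longrightarrow> x i \<in> hom C (T i) Y"
  shows "\<exists>!u. u \<in> hom C P Y \<and> (\<forall>i \<in> S. u \<cdot> \<iota> i = x i)"
proof -
  have "Obj (discrete S) = S" by (simp add: discrete_def)
  with col discrete_cocone[OF Y, of S x T] x show ?thesis
    unfolding is_colimit_def by simp
qed

text \<open>
  If every arrow from the generator to \<open>X\<close> lifts along \<open>u\<close>, then the lifts assemble to a lift of the
  canonical \<open>E\<close>-arrow of \<open>X\<close>, and cancellation applies.
\<close>

lemma left_class_if_generator_lifts: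
  assumes fs: "factorization_system C E M" and M: "\<And>m. m \<in> M \<Longrightarrow> monic C m"
    and gen: "ord_generator U C E \<G>" and u: "u \<in> hom C L X"
    and lift: "\<And>G f. G \<in> \<G> \<Longrightarrow> f \<in> hom C G X \<Longrightarrow> \<exists>h \<in> hom C G L. u \<cdot> h = f"
  shows "u \<in> E"
proof -
  have LX: "L \<in> Obj C" "X \<in> Obj C" using hom_Obj[OF u] by auto
  then obtain s where s: "s \<in> E" "is_ord_generator_arrow C \<G> X s"
    using gen by (auto simp: ord_generator_def)
  then obtain T \<kappa> P \<iota> where T: "\<And>G. G \<in> \<G> \<Longrightarrow> is_colimit (discrete (hom C G X)) C (\<lambda>_. G)
      (\<lambda>_. Id C G) (T G) (\<kappa> G)"
    and P: "is_colimit (discrete \<G>) C T (\<lambda>G. Id C (T G)) P \<iota>" and sh: "s \<in> hom C P X"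
    and s\<kappa>: "\<And>G f. G \<in> \<G> \<Longrightarrow> f \<in> hom C G X \<Longrightarrow> (s \<cdot> \<iota> G) \<cdot> \<kappa> G f = f"
    unfolding is_ord_generator_arrow_def by blast
  have \<iota>: "\<iota> G \<in> hom C (T G) P" if "G \<in> \<G>" for G
    using P that by (auto simp: is_colimit_def cocone_def discrete_def)
  have "\<exists>t. t \<in> hom C (T G) L \<and> u \<cdot> t = s \<cdot> \<iota> G" if G: "G \<in> \<G>" for G
  proof -
    obtain h where h: "\<And>f. f \<in> hom C G X \<Longrightarrow> h f \<in> hom C G L" "\<And>f. f \<in> hom C G X \<Longrightarrow> u \<cdot> h f = f"
      using lift[OF G] by metis
    have \<kappa>: "\<kappa> G f \<in> hom C G (T G)" if "f \<in> hom C G X" for f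
      using T[OF G] that by (auto simp: is_colimit_def cocone_def discrete_def)
    obtain t where t: "t \<in> hom C (T G) L" "\<And>f. f \<in> hom C G X \<Longrightarrow> t \<cdot> \<kappa> G f = h f"
      using coproduct_universal[OF T[OF G] LX(1), of h] h(1) by blast
    have ex: "\<exists>!v. v \<in> hom C (T G) X \<and> (\<forall>f \<in> hom C G X. v \<cdot> \<kappa> G f = f)"
      using coproduct_universal[OF T[OF G] LX(2), of "\<lambda>f. f"] by blast
    have "u \<cdot> t \<in> hom C (T G) X \<and> (\<forall>f \<in> hom C G X. (u \<cdot> t) \<cdot> \<kappa> G f = f)"
      using Comp_in_hom[OF t(1) u] Comp_assoc[OF \<kappa> t(1) u] t(2) h(2) by simp
    moreover have "s \<cdot> \<iota> G \<in> hom C (T G) X \<and> (\<forall>f \<in> hom C G X. (s \<cdot> \<iota> G) \<cdot> \<kappa> G f = f)"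
      using Comp_in_hom[OF \<iota>[OF G] sh] s\<kappa>[OF G] by simp
    ultimately show ?thesis using t(1) ex by blast
  qed
  then obtain t where t: "\<And>G. G \<in> \<G> \<Longrightarrow> t G \<in> hom C (T G) L" "\<And>G. G \<in> \<G> \<Longrightarrow> u \<cdot> t G = s \<cdot> \<iota> G"
    by metis
  obtain r where r: "r \<in> hom C P L" "\<And>G. G \<in> \<G> \<Longrightarrow> r \<cdot> \<iota> G = t G"
    using coproduct_universal[OF P LX(1), of t] t(1) by blast
  have ex: "\<exists>!v. v \<in> hom C P X \<and> (\<forall>G \<in> \<G>. v \<cdot> \<iota> G = s \<cdot> \<iota> G)"
    by (rule coproduct_universal[OF P LX(2)]) (rule Comp_in_hom[OF \<iota> sh])
  have "u \<cdot> r \<in> hom C P X \<and> (\<forall>G \<in> \<G>. (u \<cdot> r) \<cdot> \<iota> G = s \<cdot> \<iota> G)"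
    using Comp_in_hom[OF r(1) u] Comp_assoc[OF \<iota> r(1) u] r(2) t(2) by simp
  then have "u \<cdot> r = s" using ex sh by blast
  then show ?thesis using left_class_cancel[OF fs M u r(1)] s(1) by simp
qed

text \<open>
  The content of boundedness over \<open>Set\<close>: an arrow into \<open>X\<close> factors through a member of the cocone. The
  set-theoretic colimit consists of classes of pairs \<open>(i, h)\<close>, on each of which \<open>m i h\<close> is constant, so
  any representative of a preimage of \<open>f\<close> is a factorization.
\<close>

lemma bounded_object_factor:
  assumes G: "ord_bounded_object U \<alpha> C E M G"
    and A: "small_category U A" "filtered \<alpha> A" and D: "ord_functor A C Do Da"
    and m: "cocone A C Do Da X m" "\<And>i. i \<in> Obj A \<Longrightarrow> m i \<in> M"
    and L: "is_colimit A C Do Da L l" and u: "u \<in> hom C L X" "\<And>i. i \<in> Obj A \<Longrightarrow> u \<cdot> l i = m i" "u \<in> E"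
    and f: "f \<in> hom C G X"
  shows "\<exists>i \<in> Obj A. \<exists>h \<in> hom C G (Do i). m i \<cdot> h = f"
proof -
  let ?r = "{((Dom A a, x), (Cod A a, Da a \<cdot> x)) | a x. a \<in> Arr A \<and> x \<in> hom C G (Do (Dom A a))}"
  let ?eval = "\<lambda>(i, h). m i \<cdot> h"
  have "f \<in> (\<lambda>q. the_elem (?eval ` q)) ` set_colimit A (\<lambda>i. hom C G (Do i)) (\<lambda>a h. Da a \<cdot> h)"
    using G A D m L u f unfolding ord_bounded_object_def by blast
  then obtain i h where ih: "i \<in> Obj A" "h \<in> hom C G (Do i)"
    and f': "f = the_elem (?eval ` ((?r \<union> ?r\<inverse>)\<^sup>* `` {(i, h)}))"
    by (auto simp: set_colimit_def Let_def elim!: quotientE)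
  define r where "r = ?r"
  have step_eq: "?eval p = ?eval p'" if "(p, p') \<in> r" for p p'
  proof -
    from that obtain a x where a: "a \<in> Arr A" "x \<in> hom C G (Do (Dom A a))" "p = (Dom A a, x)"
        "p' = (Cod A a, Da a \<cdot> x)"
      unfolding r_def by blast
    have "Da a \<in> hom C (Do (Dom A a)) (Do (Cod A a))" "m (Cod A a) \<cdot> Da a = m (Dom A a)"
      using D m(1) a(1) by (auto simp: ord_functor_def cocone_def)
    moreover have "m (Cod A a) \<in> hom C (Do (Cod A a)) X"
      using m(1) a(1) A(1) category.Cod_in_Obj by (fastforce simp: cocone_def small_category_def)
    ultimately show ?thesis using a Comp_assoc[of x G "Do (Dom A a)" "Da a" "Do (Cod A a)" "m
        (Cod A a)" X] by simp
  qed
  define R where "R = (r \<union> r\<inverse>)\<^sup>*"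
  have const: "?eval p = m i \<cdot> h" if "((i, h), p) \<in> R" for p
    using that unfolding R_def
  proof (induction rule: rtrancl_induct)
    case (step p p')
    from step(2) have "(p, p') \<in> r \<or> (p', p) \<in> r" by blast
    then have "?eval p = ?eval p'"
      by (elim disjE) (erule step_eq, erule step_eq[symmetric])
    with step.IH show ?case by simp
  qed simp
  have "?eval ` (R `` {(i, h)}) = (\<lambda>_. m i \<cdot> h) ` (R `` {(i, h)})"
    by (rule image_cong[OF refl]) (rule const, simp)
  also have "\<dots> = {m i \<cdot> h}"
    by (rule image_constant[of "(i, h)"]) (simp add: R_def)
  finally have "f = m i \<cdot> h"
    unfolding f' R_def r_def by simp
  then show ?thesis using ih by blast
qed

end


section \<open>Filtered categories and regular cardinals\<close>

lemma discrete_category: "category (discrete S)"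
  by unfold_locales (auto simp: discrete_def hom_def)

text \<open>
  A set \<open>S\<close> of objects is a discrete diagram, whose cocones are upper bounds. Using the set itself as
  the index makes repetitions harmless: a family with fewer than \<open>\<beta>\<close> indices has a range with fewer than
  \<open>\<beta>\<close> elements.
\<close>

lemma filtered_upper_bound:
  assumes A: "category A" "filtered \<beta> A" and S: "S \<subseteq> Obj A" "|S| <o \<beta>"
  shows "\<exists>k \<in> Obj A. \<forall>i \<in> S. \<exists>a. a \<in> hom A i k"
proof -
  interpret A: category A by (rule A(1))
  have "ord_functor (discrete S) A (\<lambda>i. i) (Id A)"
    using S(1) A.Id_in_hom A.Id_Comp[OF A.Id_in_hom] by (auto simp: ord_functor_def discrete_def)
  moreover have "|Arr (discrete S)| <o \<beta>" using S(2) by (simp add: discrete_def)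
  ultimately obtain k x where "cocone (discrete S) A (\<lambda>i. i) (Id A) k x"
    using A(2) discrete_category[of S] unfolding filtered_def by blast
  then show ?thesis by (auto simp: cocone_def discrete_def)
qed

lemma filtered_mono: "filtered \<beta> A \<Longrightarrow> \<alpha> \<le>o \<beta> \<Longrightarrow> filtered \<alpha> A"
  unfolding filtered_def using ordLess_ordLeq_trans by blast

lemma small_copy:
  assumes S: "|S| <o |U|"
  shows "\<exists>S' \<subseteq> U. |S| =o |S'|"
proof -
  obtain f where f: "inj_on f S" "f ` S \<subseteq> U"
    using ordLess_imp_ordLeq[OF S] card_of_ordLeq[of S U] by blast
  then have "|S| =o |f ` S|"
    using card_of_ordIso[of S "f ` S"] unfolding bij_betw_def by blast
  with f(2) show ?thesis by blast
qed

text \<open>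
  An infinite successor cardinal is regular, and because the cardinality of \<open>U\<close> is a strong limit the successor of
  a small cardinal is small: it is at most the cardinality of a power set. Regular cardinals are here
  relations on the type of \<open>U\<close>, so both the starting cardinal and its successor are copied into \<open>U\<close>.
\<close>

lemma regular_cardinal_above:
  fixes U :: "'u set" and T :: "'t set"
  assumes U: "universe U" and T: "small U T"
    and \<alpha>: "regular_cardinal U \<alpha>1" "regular_cardinal U \<alpha>2"
  shows "\<exists>\<beta>. regular_cardinal U \<beta> \<and> \<alpha>1 \<le>o \<beta> \<and> \<alpha>2 \<le>o \<beta> \<and> |T| <o \<beta>"
proof -
  have infU: "infinite U"
    using U ordLess_imp_ordLeq infinite_iff_natLeq_ordLeq unfolding universe_def by blast
  have \<alpha>F: "|Field \<alpha>1| =o \<alpha>1" "|Field \<alpha>2| =o \<alpha>2"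
    using \<alpha> card_of_Field_ordIso unfolding regular_cardinal_def by auto
  have \<alpha>U: "|Field \<alpha>1| <o |U|" "|Field \<alpha>2| <o |U|"
    using \<alpha> \<alpha>F ordIso_ordLess_trans unfolding regular_cardinal_def by blast+
  \<comment> \<open>The disjoint sum is a small set that dominates all three cardinals.\<close>
  let ?S0 = "T <+> (Field \<alpha>1 <+> Field \<alpha>2)"
  have S0: "|?S0| <o |U|"
    using T \<alpha>U infU unfolding small_def by (intro card_of_Plus_ordLess_infinite)
  obtain S where S: "S \<subseteq> U" "|?S0| =o |S|" using small_copy[OF S0] by blast
  have SU: "|S| <o |U|" using ordIso_ordLess_trans[OF ordIso_symmetric[OF S(2)] S0] .
  then have PU: "|Pow S| <o |U|" using U S(1) unfolding universe_def by blast
  have cS: "cardSuc |S| <o |U|"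
    using cardSuc_least[OF card_of_Card_order card_of_Card_order card_of_Pow[of S]] PU
      ordLeq_ordLess_trans by blast
  let ?F = "Field (cardSuc |S| )"
  have F: "|?F| =o cardSuc |S|"
    using card_of_Field_ordIso[OF cardSuc_Card_order[OF card_of_Card_order]] .
  then have "|?F| <o |U|" using cS by (rule ordIso_ordLess_trans)
  then obtain F' where F': "F' \<subseteq> U" "|?F| =o |F'|" using small_copy[of ?F U] by blast
  have eq: "cardSuc |S| =o |F'|" using ordIso_transitive[OF ordIso_symmetric[OF F] F'(2)] .
  have \<alpha>S: "\<alpha>1 \<le>o |S|" "\<alpha>2 \<le>o |S|" and TS: "|T| \<le>o |S|"
  proof -
    have "|Field \<alpha>1| \<le>o |?S0|" "|Field \<alpha>2| \<le>o |?S0|"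
      using card_of_Plus1[of "Field \<alpha>1" "Field \<alpha>2"] card_of_Plus2[of "Field \<alpha>2" "Field \<alpha>1"]
        card_of_Plus2[of "Field \<alpha>1 <+> Field \<alpha>2" T] ordLeq_transitive by blast+
    then show "\<alpha>1 \<le>o |S|" "\<alpha>2 \<le>o |S|"
      using \<alpha>F S(2) ordIso_symmetric ordIso_ordLeq_trans ordLeq_ordIso_trans by blast+
    show "|T| \<le>o |S|"
      using ordLeq_ordIso_trans[OF card_of_Plus1 S(2)] .
  qed
  have Scard: "Card_order |S|" by (rule card_of_Card_order)
  have "cinfinite \<alpha>1" using \<alpha>(1) unfolding regular_cardinal_def by blast
  then have "cinfinite |S|" using \<alpha>S(1) by (rule cinfinite_mono[rotated])
  then have Sinf: "Cinfinite |S|" using Scard by blast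
  have SF: "|S| <o |F'|"
    using ordLess_ordIso_trans[OF cardSuc_greater[OF Scard] eq] .
  have "Cinfinite |F'|"
    using Cinfinite_cong[OF eq Cinfinite_cardSuc[OF Sinf]] .
  moreover have "regularCard |F'|"
    by (rule regularCard_ordIso[OF eq Cinfinite_cardSuc[OF Sinf] regularCard_cardSuc[OF Sinf]])
  moreover have "|F'| <o |U|"
    using ordIso_ordLess_trans[OF ordIso_symmetric[OF eq] cS] .
  ultimately have "regular_cardinal U |F'|" unfolding regular_cardinal_def by blast
  moreover have "\<alpha>1 \<le>o |F'|" "\<alpha>2 \<le>o |F'|" "|T| <o |F'|"
    using \<alpha>S TS SF ordLess_imp_ordLeq ordLeq_transitive ordLeq_ordLess_trans by blast+
  ultimately show ?thesis by blast
qed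

lemma small_Sigma:
  assumes U: "universe U" and S: "small U S" and F: "\<And>a. a \<in> S \<Longrightarrow> small U (F a)"
  shows "small U (SIGMA a:S. F a)"
proof -
  have "infinite U"
    using U ordLess_imp_ordLeq infinite_iff_natLeq_ordLeq unfolding universe_def by blast
  then have "stable |U|"
    using U regularCard_stable[OF card_of_Card_order, of U] unfolding universe_def
      by (simp add: Field_card_of)
  then show ?thesis
    using stable_elim S F unfolding small_def by blast
qed

section \<open>Boundedness of every object\<close>

context enriched_category
begin

text \<open>
  The core of the argument. The size of \<open>\<beta>\<close> is used in two ways: a \<open>\<beta>\<close>-filtered diagram is filtered
  enough for the objects that are already known to be bounded, and the arrows counted by \<open>few\<close>, each
  of which factors through the cocone at an index of its own, find a common upper bound of these indices.
\<close>

lemma bounded_object_if_few_generator_arrows: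
  fixes U :: "'u set" and \<beta> :: "'u rel"
  assumes colim: "has_small_colimits U V"
    and V: "ord_locally_bounded_at U \<alpha>V V E M \<G>V"
    and fs: "enriched_factorization_system V (self_enriched V) E M"
    and tens: "\<And>G G'. G \<in> \<G>V \<Longrightarrow> G' \<in> \<G>V \<Longrightarrow> ord_bounded_object U \<alpha>V V E M (G \<otimes> G')"
    and C: "factegory V M C0 EC MC" and gen: "enriched_generator U V C EC \<G>"
    and bd: "\<And>H. H \<in> \<G> \<Longrightarrow> bounded_object U \<alpha>C V E C EC MC H"
    and \<beta>: "\<alpha>V \<le>o \<beta>" "\<alpha>C \<le>o \<beta>" and X: "X \<in> VObj C"
    and few: "|SIGMA H:\<G>. SIGMA G:\<G>V. hom V G (VHom C H X)| <o \<beta>"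
  shows "bounded_object U \<beta> V E C EC MC X"
  unfolding bounded_object_def bounded_functor_def
proof (intro allI impI, elim conjE)
  fix I :: "('u, 'u) cat" and Do Da Y m L l u L' l' u'
  let ?S = "self_enriched V"
  assume I: "small_category U I" "filtered \<beta> I" and D: "ord_functor I C0 Do Da"
    and m: "cocone I C0 Do Da Y m" and mM: "\<forall>i \<in> Obj I. m i \<in> MC"
    and L: "is_conical_colimit I V C0 Do Da L l"
    and u: "u \<in> hom C0 L Y" "\<forall>i \<in> Obj I. u \<cdot>\<^bsub>C0\<^esub> l i = m i"
    and L': "is_conical_colimit I V ?S (HomO C0 X \<circ> Do) (HomR C0 X \<circ> Da) L' l'"
    and u': "u' \<in> hom ?S L' (HomO C0 X Y)" "\<forall>i \<in> Obj I. u' \<cdot>\<^bsub>?S\<^esub> l' i = HomR C0 X (m i)"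
    and uE: "u \<in> EC"
  have sel: "Obj ?S = Obj V" "hom ?S = hom V" "Comp ?S = Comp V"
    by (simp_all add: self_enriched_def hom_def fun_eq_iff)
  have Icat: "category I" using I(1) by (simp add: small_category_def)
  have Iobj: "Dom I a \<in> Obj I" "Cod I a \<in> Obj I" if "a \<in> Arr I" for a
    using category.Dom_in_Obj[OF Icat that] category.Cod_in_Obj[OF Icat that] .
  have Da: "Da a \<in> hom C0 (Do (Dom I a)) (Do (Cod I a))" if "a \<in> Arr I" for a
    using D that by (auto simp: ord_functor_def)
  have mh: "m i \<in> hom C0 (Do i) Y" if "i \<in> Obj I" for i
    using m that by (auto simp: cocone_def)
  have mnat: "m (Cod I a) \<cdot>\<^bsub>C0\<^esub> Da a = m (Dom I a)" if "a \<in> Arr I" for a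
    using m that by (auto simp: cocone_def)
  have Y: "Y \<in> VObj C" using m by (auto simp: cocone_def C0_simps)
  have \<G>: "\<G> \<subseteq> VObj C" using gen by (simp add: enriched_generator_def)
  have l'h: "l' i \<in> hom V (VHom C X (Do i)) L'" if "i \<in> Obj I" for i
    using L' that by (auto simp: is_conical_colimit_def cocone_def sel C0_simps)
  have u'h: "u' \<in> hom V L' (VHom C X Y)" and u'l': "\<And>i. i \<in> Obj I \<Longrightarrow> u' \<cdot> l' i = HomR C0 X (m i)"
    using u' by (auto simp: sel C0_simps)
  have fsV: "factorization_system V E M" and monic: "\<And>m. m \<in> M \<Longrightarrow> monic V m"
    and genV: "ord_generator U V E \<G>V"
    using V by (auto simp: ord_locally_bounded_at_def proper_def)
  have MR: "HomR C0 H (m i) \<in> M" if "i \<in> Obj I" "H \<in> VObj C" for i H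
    using C mM that by (auto simp: factegory_def C0_simps)
  show "u' \<in> E"
  proof (rule left_class_if_generator_lifts[OF fsV monic genV u'h])
    fix G g assume G: "G \<in> \<G>V" and g: "g \<in> hom V G (VHom C X Y)"
    have GO: "G \<in> Obj V" using hom_Obj[OF g] by auto
    \<comment> \<open>The colimit \<open>K\<close> of the \<open>C(H, D i)\<close> is the place where the two kinds of boundedness meet: that
      of \<open>H\<close> puts \<open>K \<rightarrow> C(H,Y)\<close> into \<open>E\<close>, that of \<open>G \<otimes> G'\<close> then factors arrows through its stages.\<close>
    have factor: "\<exists>i h. i \<in> Obj I \<and> h \<in> hom V (G \<otimes> G') (VHom C H (Do i)) \<and>
        HomR C0 H (m i) \<cdot> h = VComp C H X Y \<cdot> (g \<odot> p)"
      if H: "H \<in> \<G>" and G': "G' \<in> \<G>V" and p: "p \<in> hom V G' (VHom C H X)" for H G' p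
    proof -
      have HO: "H \<in> VObj C" using H \<G> by auto
      note F = HomR_ord_functor[OF D HO] and coc = HomR_cocone[OF D m HO Iobj(2)]
      obtain K k where K: "is_colimit I V (VHom C H \<circ> Do) (HomR C0 H \<circ> Da) K k"
        using colim I(1) F unfolding has_small_colimits_def by blast
      have Kc: "is_conical_colimit I V ?S (HomO C0 H \<circ> Do) (HomR C0 H \<circ> Da) K k"
        unfolding C0_simps
        by (rule colimit_is_conical[OF K]) (use Iobj HomR_in_hom[OF Da HO] in auto)
      obtain v where v: "v \<in> hom V K (VHom C H Y)" "\<And>i. i \<in> Obj I \<Longrightarrow> v \<cdot> k i = HomR C0 H (m i)"
        using K coc unfolding is_colimit_def by blast
      have "v \<in> E"
        using bd[OF H] I(1) filtered_mono[OF I(2) \<beta>(2)] D m mM L u uE Kc v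
        unfolding bounded_object_def bounded_functor_def sel C0_simps by blast
      moreover have "VComp C H X Y \<cdot> (g \<odot> p) \<in> hom V (G \<otimes> G') (VHom C H Y)"
        using g p HO X Y by (simp add: C_simps)
      ultimately show ?thesis
        using bounded_object_factor[OF tens[OF G G'] I(1) filtered_mono[OF I(2) \<beta>(1)] F coc _ K
            v(1) v(2)]
          MR[OF _ HO] by (metis comp_apply)
    qed
    let ?T = "SIGMA H:\<G>. SIGMA G:\<G>V. hom V G (VHom C H X)"
    have "\<forall>t \<in> ?T. \<exists>i. i \<in> Obj I \<and> (\<exists>h. h \<in> hom V (G \<otimes> fst (snd t)) (VHom C (fst t) (Do i)) \<and>
        HomR C0 (fst t) (m i) \<cdot> h = VComp C (fst t) X Y \<cdot> (g \<odot> snd (snd t)))"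
      using factor by (force simp: mem_Sigma_iff)
    then obtain \<iota> where \<iota>: "\<forall>t \<in> ?T. \<iota> t \<in> Obj I \<and>
        (\<exists>h. h \<in> hom V (G \<otimes> fst (snd t)) (VHom C (fst t) (Do (\<iota> t))) \<and>
          HomR C0 (fst t) (m (\<iota> t)) \<cdot> h = VComp C (fst t) X Y \<cdot> (g \<odot> snd (snd t)))"
      by (rule bchoice[THEN exE])
    have "\<exists>k \<in> Obj I. \<forall>i \<in> \<iota> ` ?T. \<exists>a. a \<in> hom I i k"
    proof (rule filtered_upper_bound[OF Icat I(2)])
      show "\<iota> ` ?T \<subseteq> Obj I" using \<iota> by blast
      show "|\<iota> ` ?T| <o \<beta>" by (rule ordLeq_ordLess_trans[OF card_of_image few])
    qed
    then obtain k where k: "k \<in> Obj I" "\<And>t. t \<in> ?T \<Longrightarrow> \<exists>a. a \<in> hom I (\<iota> t) k"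
      by blast
    have "\<exists>q \<in> hom V (G \<otimes> VHom C H X) (VHom C H (Do k)).
        HomR C0 H (m k) \<cdot> q = VComp C H X Y \<cdot> (g \<odot> Id V (VHom C H X))" if H: "H \<in> \<G>" for H
    proof -
      have HO: "H \<in> VObj C" using H \<G> by auto
      note HX = VHom_in_Obj[OF HO X]
      have c: "VComp C H X Y \<in> hom V (VHom C X Y \<otimes> VHom C H X) (VHom C H Y)"
        by (rule VComp_in_hom[OF HO X Y])
      have gi: "g \<odot> Id V (VHom C H X) \<in> hom V (G \<otimes> VHom C H X) (VHom C X Y \<otimes> VHom C H X)"
        by (rule TensA_in_hom[OF g Id_in_hom[OF HX]])
      show ?thesis
      proof (rule tensor_factors_through_if_generator_factors[OF fs genV MR[OF k(1) HO]
            HomR_in_hom[OF mh[OF k(1)] HO] GO HX Comp_in_hom[OF gi c]])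
        fix G' p assume G': "G' \<in> \<G>V" and p: "p \<in> hom V G' (VHom C H X)"
        have t: "(H, G', p) \<in> ?T" using H G' p by simp
        let ?i = "\<iota> (H, G', p)"
        obtain h where h: "h \<in> hom V (G \<otimes> G') (VHom C H (Do ?i))"
          "HomR C0 H (m ?i) \<cdot> h = VComp C H X Y \<cdot> (g \<odot> p)"
          using bspec[OF \<iota> t] by auto
        obtain a where a: "a \<in> Arr I" "Dom I a = ?i" "Cod I a = k"
          using k(2)[OF t] by (auto simp: hom_def)
        have ah: "Da a \<in> hom C0 (Do ?i) (Do k)" using Da[OF a(1)] a by simp
        note Ra = HomR_in_hom[OF ah HO] and Rk = HomR_in_hom[OF mh[OF k(1)] HO]
        have "HomR C0 H (m k) \<cdot> (HomR C0 H (Da a) \<cdot> h) = HomR C0 H (m ?i) \<cdot> h"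
          using Comp_assoc[OF h(1) Ra Rk] HomR_Comp(1)[OF ah mh[OF k(1)] HO] mnat[OF a(1)] a by simp
        also have "\<dots> = VComp C H X Y \<cdot> ((g \<odot> Id V (VHom C H X)) \<cdot> (Id V G \<odot> p))"
          using h(2) tens_split(1)[OF g p] by simp
        also have "\<dots> = (VComp C H X Y \<cdot> (g \<odot> Id V (VHom C H X))) \<cdot> (Id V G \<odot> p)"
          by (rule Comp_assoc[OF TensA_in_hom[OF Id_in_hom[OF GO] p] gi c, symmetric])
        finally show "\<exists>h \<in> hom V (G \<otimes> G') (VHom C H (Do k)).
            HomR C0 H (m k) \<cdot> h = (VComp C H X Y \<cdot> (g \<odot> Id V (VHom C H X))) \<cdot> (Id V G \<odot> p)"
          using Comp_in_hom[OF h(1) Ra] by blast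
      qed
    qed
    moreover obtain s where "s \<in> EC" "is_generator_arrow V C \<G> X s"
      using gen X by (auto simp: enriched_generator_def)
    ultimately obtain f where f: "f \<in> hom V G (VHom C X (Do k))" "HomR C0 X (m k) \<cdot> f = g"
      using factors_through_HomR_if_generator_factors[of EC MC s \<G> X "m k" "Do k" Y g G]
        C \<G> mM k(1) mh[OF k(1)] g X by (auto simp: factegory_def)
    have "u' \<cdot> (l' k \<cdot> f) = g"
      using Comp_assoc[OF f(1) l'h[OF k(1)] u'h] u'l'[OF k(1)] f(2) by simp
    then show "\<exists>h \<in> hom V G L'. u' \<cdot> h = g"
      using Comp_in_hom[OF f(1) l'h[OF k(1)]] by blast
  qed
qed

end

theorem proposition6p1p14:
  fixes U :: "'u set"
    and V :: "('o, 'a) smc" and E M :: "'a set"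
    and C :: "('x, 'o, 'a) vcat" and EC MC :: "('x \<times> 'x \<times> 'a) set"
    and J :: "('j, 'o, 'a) vcat" and jo :: "'j \<Rightarrow> 'x" and ja :: "'j \<Rightarrow> 'j \<Rightarrow> 'a"
  assumes "universe U"
    and "sym_monoidal_closed V" and "locally_small U V"
    and "has_small_limits U V" and "has_small_colimits U V"
    and "locally_bounded_closed U V E M"
    and "vcategory V C" and "locally_bounded U V E M C EC MC"
    and "subcategory_of_arities V C J jo ja" and "small U (VObj J)"
  shows "bounded_arities U V E C EC MC J jo"
proof -
  interpret enriched_category V C
    using assms(2,7) by (rule enriched_category.intro)
  obtain \<alpha>V \<G>V where \<alpha>V: "regular_cardinal U \<alpha>V" and V: "ord_locally_bounded_at U \<alpha>V V E M \<G>V"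
    and fs: "enriched_factorization_system V (self_enriched V) E M"
    and tens: "\<And>G G'. G \<in> \<G>V \<Longrightarrow> G' \<in> \<G>V \<Longrightarrow> ord_bounded_object U \<alpha>V V E M (G \<otimes>\<^bsub>V\<^esub> G')"
    using assms(6) unfolding locally_bounded_closed_def locally_bounded_closed_at_def by blast
  obtain \<alpha>C \<G> where \<alpha>C: "regular_cardinal U \<alpha>C" and C: "factegory V M C0 EC MC"
    and gen: "enriched_generator U V C EC \<G>"
    and bd: "\<And>H. H \<in> \<G> \<Longrightarrow> bounded_object U \<alpha>C V E C EC MC H"
    using assms(8) unfolding locally_bounded_def locally_bounded_at_def cocomplete_proper_factegory_def
    by blast
  have jo: "jo x \<in> VObj C" if "x \<in> VObj J" for x
    using assms(9) that by (auto simp: subcategory_of_arities_def vfunctor_def)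
  \<comment> \<open>The arrows for all objects of \<open>J\<close> are counted together, which gives one cardinal for all of them.\<close>
  let ?T = "\<lambda>x. SIGMA H:\<G>. SIGMA G:\<G>V. hom V G (VHom C H (jo x))"
  have \<G>: "small U \<G>" "\<G> \<subseteq> VObj C" "small U \<G>V" "\<G>V \<subseteq> Obj V"
    using gen V by (auto simp: enriched_generator_def ord_locally_bounded_at_def ord_generator_def)
  have "small U (hom V G (VHom C H (jo x)))" if "x \<in> VObj J" "H \<in> \<G>" "G \<in> \<G>V" for x H G
  proof -
    have "G \<in> Obj V" "VHom C H (jo x) \<in> Obj V"
      using that \<G> by (auto intro: VHom_in_Obj jo)
    then show ?thesis using assms(3) by (simp add: locally_small_def)
  qed
  then have "small U (SIGMA x:VObj J. ?T x)"
    using assms(1,10) \<G>(1,3) by (intro small_Sigma)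
  then obtain \<beta> where \<beta>: "regular_cardinal U \<beta>" "\<alpha>V \<le>o \<beta>" "\<alpha>C \<le>o \<beta>" "|SIGMA x:VObj J. ?T x| <o \<beta>"
    using regular_cardinal_above[OF assms(1) _ \<alpha>V \<alpha>C] by blast
  have "bounded_object U \<beta> V E C EC MC (jo x)" if x: "x \<in> VObj J" for x
  proof -
    have "|?T x| \<le>o |SIGMA x:VObj J. ?T x|"
      by (rule card_of_ordLeqI[of "Pair x"]) (use x in \<open>auto simp: inj_on_def\<close>)
    then have few: "|?T x| <o \<beta>" using \<beta>(4) by (rule ordLeq_ordLess_trans)
    show ?thesis
      by (rule bounded_object_if_few_generator_arrows[OF assms(5) V fs tens C gen bd \<beta>(2,3) jo[OF x] few])
  qed
  then show ?thesis
    using assms(10) \<beta>(1) unfolding bounded_arities_def by blast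
qed

end
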